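(* Let $G$ be a nonbipartite matching covered graph with a nontrivial tight cut. Then $G\in\mathfrak{B}$ if and only if $G$ is (isomorphic to) one of $C_{\bigtriangleup}^1$, $T_2$, $T_3$, $T_4$, $T_5$, or $T_6$.
   Context: Graphs are finite, loopless, and may have parallel edges (parallel edges are distinct edges, so perfect matchings differing only by the choice of a parallel edge are different). An edge is a $k$-matching edge if it belongs to exactly $k$ perfect matchings. A connected graph is matching covered if every edge belongs to at least one perfect matching. $\mathfrak{B}$ is the class of connected graphs (admitting a perfect matching) in which every edge is either a $1$-matching edge or a $2$-matching edge, and no perfect matching contains both a $1$-matching edge and a $2$-matching edge. For $X\subseteq V(G)$, $\nabla(X)$ is the set of edges with exactly one end in $X$; it is a cut with shores $X$ and $V(G)\setminus X$, and it is trivial if one of its shores is a single vertex. A cut $C=\nabla(X)$ with $|X|$ odd in a matching covered graph is tight if $|C\cap M|=1$ for every perfect matching $M$. Triangle replacement at a vertex $u$ of degree $3$ with incident edges $u_1u,u_2u,u_3u$: delete $u$, add a new triangle $w_1w_2w_3$, and add the edges $u_iw_i$ ($i=1,2,3$) ($u_1,u_2,u_3$ need not be distinct). The graphs are: - $C_{\bigtriangleup}^1$: obtained from $C_4^2$ (the $4$-cycle with two opposite edges doubled) by triangle replacement at one vertex. It has vertices $v_1,v_2,v_3,v_1',v_2',v_3'$ and edges: $v_1v_2$ (twice), $v_2v_3$, $v_1v_1'$, $v_3v_2'$, $v_3v_3'$, $v_1'v_2'$, $v_2'v_3'$, $v_1'v_3'$. - $T_2$: obtained from $C_{\bigtriangleup}^1$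 by triangle replacement at an end of the double edge; equivalently, two disjoint copies of $K_4$ minus an edge, with the two degree-$2$ vertices of one copy joined to the two degree-$2$ vertices of the other by two disjoint edges. - $T_3$: the $4$-regular graph on vertices $p,u,q,r,s,t$ with edges $pq,pr,ps,pt,uq,ur,us,ut$ (each once), $qr$ (twice), $st$ (twice). - $T_4,T_5,T_6$: obtained from $K_{3,3}$ with bipartition $(A,B)$ by triangle replacement at exactly one, exactly two, or all three vertices of $A$, respectively. *)

theory Defs
  imports Main
begin

text \<open>Undirected graphs with labelled edges, so that parallel edges are distinct objects.\<close>

record ('v, 'e) multigraph =
  verts :: "'v set"
  edges :: "'e set"
  ends :: "'e \<Rightarrow> 'v set"

definition finite_loopless_graph :: "('v, 'e) multigraph \<Rightarrow> bool" where
  "finite_loopless_graph G \<longleftrightarrow>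
     finite (verts G) \<and> finite (edges G) \<and>
     (\<forall>e \<in> edges G. ends G e \<subseteq> verts G \<and> card (ends G e) = 2)"

definition incident_edges :: "('v, 'e) multigraph \<Rightarrow> 'v \<Rightarrow> 'e set" where
  "incident_edges G u = {e \<in> edges G. u \<in> ends G e}"

definition adjacency :: "('v, 'e) multigraph \<Rightarrow> ('v \<times> 'v) set" where
  "adjacency G = {(u, v). \<exists>e \<in> edges G. ends G e = {u, v}}"

definition connected_graph :: "('v, 'e) multigraph \<Rightarrow> bool" where
  "connected_graph G \<longleftrightarrow>
     verts G \<noteq> {} \<and> (\<forall>u \<in> verts G. \<forall>v \<in> verts G. (u, v) \<in> (adjacency G)\<^sup>*)"

definition bipartite :: "('v, 'e) multigraph \<Rightarrow> bool" where
  "bipartite G \<longleftrightarrow>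
     (\<exists>A B. A \<union> B = verts G \<and> A \<inter> B = {} \<and>
        (\<forall>e \<in> edges G. \<exists>a \<in> A. \<exists>b \<in> B. ends G e = {a, b}))"

definition graph_iso :: "('v, 'e) multigraph \<Rightarrow> ('w, 'f) multigraph \<Rightarrow> bool" where
  "graph_iso G H \<longleftrightarrow>
     (\<exists>f g. bij_betw f (verts G) (verts H) \<and> bij_betw g (edges G) (edges H) \<and>
        (\<forall>e \<in> edges G. ends H (g e) = f ` ends G e))"

definition perfect_matching :: "('v, 'e) multigraph \<Rightarrow> 'e set \<Rightarrow> bool" where
  "perfect_matching G M \<longleftrightarrow>
     M \<subseteq> edges G \<and> (\<forall>v \<in> verts G. \<exists>!e. e \<in> M \<and> v \<in> ends G e)"

definition matching_edge :: "('v, 'e) multigraph \<Rightarrow> nat \<Rightarrow> 'e \<Rightarrow> bool" where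
  "matching_edge G k e \<longleftrightarrow>
     e \<in> edges G \<and> card {M. perfect_matching G M \<and> e \<in> M} = k"

definition matching_covered :: "('v, 'e) multigraph \<Rightarrow> bool" where
  "matching_covered G \<longleftrightarrow>
     connected_graph G \<and> (\<forall>e \<in> edges G. \<exists>M. perfect_matching G M \<and> e \<in> M)"

definition class_B :: "('v, 'e) multigraph set" where
  "class_B =
     {G. finite_loopless_graph G \<and> connected_graph G \<and> (\<exists>M. perfect_matching G M) \<and>
         (\<forall>e \<in> edges G. matching_edge G 1 e \<or> matching_edge G 2 e) \<and>
         \<not> (\<exists>M. perfect_matching G M \<and>
               (\<exists>e \<in> M. \<exists>f \<in> M. matching_edge G 1 e \<and> matching_edge G 2 f))}"

definition cut :: "('v, 'e) multigraph \<Rightarrow> 'v set \<Rightarrow> 'e set" where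
  "cut G X = {e \<in> edges G. card (ends G e \<inter> X) = 1}"

text \<open>Cuts are referred to by one of their shores \<open>X\<close>; the other shore is \<open>verts G - X\<close>.\<close>

definition tight_cut :: "('v, 'e) multigraph \<Rightarrow> 'v set \<Rightarrow> bool" where
  "tight_cut G X \<longleftrightarrow>
     X \<subseteq> verts G \<and> odd (card X) \<and>
     (\<forall>M. perfect_matching G M \<longrightarrow> card (cut G X \<inter> M) = 1)"

definition trivial_cut :: "('v, 'e) multigraph \<Rightarrow> 'v set \<Rightarrow> bool" where
  "trivial_cut G X \<longleftrightarrow> card X = 1 \<or> card (verts G - X) = 1"

text \<open>
  Replacement of a vertex \<open>u\<close> of degree 3 by a triangle.  The new vertices are indexed by the
  three edges at \<open>u\<close>: an edge \<open>e\<close> joining \<open>u\<close> to \<open>x\<close> becomes an edge \<open>Inl e\<close> joining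
  \<open>Inl x\<close> to the new vertex \<open>Inr e\<close>, and \<open>Inr e\<close>, as an edge, is the side of the triangle
  opposite to the vertex \<open>Inr e\<close>.  Indexing by edges rather than by neighbours allows \<open>u\<close> to be
  incident with parallel edges.
\<close>

definition triangle_replacement ::
    "('v, 'e) multigraph \<Rightarrow> 'v \<Rightarrow> ('v + 'e, 'e + 'e) multigraph" where
  "triangle_replacement G u =
     \<lparr>verts = Inl ` (verts G - {u}) \<union> Inr ` incident_edges G u,
      edges = Inl ` edges G \<union> Inr ` incident_edges G u,
      ends = case_sum
        (\<lambda>e. if u \<in> ends G e then Inl ` (ends G e - {u}) \<union> {Inr e} else Inl ` ends G e)
        (\<lambda>e. Inr ` (incident_edges G u - {e}))\<rparr>"

text \<open>The graph without isolated vertices whose edges, with multiplicity, are given by a list.\<close>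

definition graph_of_list :: "('v \<times> 'v) list \<Rightarrow> ('v, nat) multigraph" where
  "graph_of_list es =
     \<lparr>verts = fst ` set es \<union> snd ` set es,
      edges = {..<length es},
      ends = (\<lambda>i. {fst (es ! i), snd (es ! i)})\<rparr>"

text \<open>The vertices \<open>v\<^sub>1, v\<^sub>2, v\<^sub>3\<close> are \<open>1, 2, 3\<close>, and their primed versions are \<open>4, 5, 6\<close>.\<close>

definition C_triangle_1 :: "(nat, nat) multigraph" where
  "C_triangle_1 = graph_of_list
     [(1, 2), (1, 2), (2, 3), (1, 4), (3, 5), (3, 6), (4, 5), (5, 6), (4, 6)]"

text \<open>The vertex \<open>1\<close> is an end of the double edge; the other end is equivalent under symmetry.\<close>

definition T2 :: "(nat + nat, nat + nat) multigraph" where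
  "T2 = triangle_replacement C_triangle_1 1"

text \<open>The vertices \<open>p, u, q, r, s, t\<close> are \<open>0, 1, 2, 3, 4, 5\<close>.\<close>

definition T3 :: "(nat, nat) multigraph" where
  "T3 = graph_of_list
     [(0, 2), (0, 3), (0, 4), (0, 5), (1, 2), (1, 3), (1, 4), (1, 5),
      (2, 3), (2, 3), (4, 5), (4, 5)]"

text \<open>The colour class \<open>A\<close> is \<open>{0, 1, 2}\<close>.\<close>

definition K33 :: "(nat, nat) multigraph" where
  "K33 = graph_of_list (List.product [0, 1, 2] [3, 4, 5])"

definition T4 :: "(nat + nat, nat + nat) multigraph" where
  "T4 = triangle_replacement K33 0"

definition T5 ::
    "((nat + nat) + (nat + nat), (nat + nat) + (nat + nat)) multigraph" where
  "T5 = triangle_replacement T4 (Inl 1)"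

definition T6 ::
    "(((nat + nat) + (nat + nat)) + ((nat + nat) + (nat + nat)),
      ((nat + nat) + (nat + nat)) + ((nat + nat) + (nat + nat))) multigraph" where
  "T6 = triangle_replacement T5 (Inl (Inl 2))"

end

(* Double counting makes a graph of the class k-regular. A perfect matching M of edges lying in no
   other perfect matching forms a Hamiltonian cycle with every other perfect matching N, and an
   alternating set of chords of that cycle yields a further perfect matching. As in Bogdanov's lemma
   on monochromatic perfect matchings this leaves little room: two such matchings M, N force K_4
   (k = 3) or K_4 with a doubled perfect matching (k = 4), and for k = 3 a single such M leaves
   only C_4^2, C_triangle_1 and T_2. Both contractions of a tight cut stay in the class, and every
   edge of the cut lies in exactly one perfect matching of one of them, so one contraction has two
   such matchings. Hence k = 4 and G = T_3, or k = 3 and one shore is a triangle. If no edge is in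
   exactly one perfect matching, a Tutte-Berge barrier shows that the graph with the triangle
   shrunk is bipartite, hence K_{3,3}, or again has a nontrivial tight cut, and induction applies. *)

theory Submission
  imports Defs "HOL-Combinatorics.List_Permutation"
begin

subsection \<open>Perfect matchings\<close>

text \<open>Call the 1-matching edges single. The number of perfect matchings through an edge of a
  tight cut is the product of its numbers in the two contractions. A product of at most 2 has a
  factor 1, so every cut edge is single in one contraction, and the degree \<open>k\<close> is at
  most the number of perfect matchings of single edges in both together. Regularity fixes the other
  counts: \<open>m\<close> such matchings leave \<open>2 * (k - m)\<close> others. For
  \<open>k = 3\<close> this makes 5 or 6 perfect matchings if \<open>m\<close> is 1 or 0, and
  counting against these numbers decides the small cases. The obstacle is \<open>m = 0\<close>,
  where no matching comes with a Hamiltonian cycle. There tightness itself supplies the barrier. Let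
  \<open>s\<close> be the shrunk triangle: a perfect matching of the graph left after deleting
  \<open>s\<close> and its three neighbours would extend by the three cut edges to one crossing the
  cut three times. By parity the deficiency of that graph is at least 2, just enough for its odd
  parts together with \<open>{s}\<close> to be as numerous as the barrier enlarged by the three
  neighbours. Where a triangle may be put back is decided by evaluating the conditions of the class
  on edge lists.\<close>

definition medge :: "('v, 'e) multigraph \<Rightarrow> 'e set \<Rightarrow> 'v \<Rightarrow> 'e" where
  "medge G M v = (THE e. e \<in> M \<and> v \<in> ends G e)"

definition mate :: "('v, 'e) multigraph \<Rightarrow> 'e set \<Rightarrow> 'v \<Rightarrow> 'v" where
  "mate G M v = (THE w. ends G (medge G M v) = {v, w})"

text \<open>An edge is a k-matching edge for one \<open>k\<close> only; naming this number allows
  products and sums over contractions.\<close>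

definition pcount :: "('v, 'e) multigraph \<Rightarrow> 'e \<Rightarrow> nat" where
  "pcount G e = card {M. perfect_matching G M \<and> e \<in> M}"

lemma graph_endsE:
  assumes "finite_loopless_graph G" "e \<in> edges G"
  obtains v w where "ends G e = {v, w}" "v \<noteq> w" "v \<in> verts G" "w \<in> verts G"
proof -
  have "card (ends G e) = 2" "ends G e \<subseteq> verts G"
    using assms by (auto simp: finite_loopless_graph_def)
  then obtain v w where "ends G e = {v, w}" "v \<noteq> w" by (meson card_2_iff)
  then show ?thesis using that \<open>ends G e \<subseteq> verts G\<close> by auto
qed

lemma graph_ends_otherE:
  assumes "finite_loopless_graph G" "e \<in> edges G" "v \<in> ends G e"
  obtains w where "ends G e = {v, w}" "v \<noteq> w" "v \<in> verts G" "w \<in> verts G"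
proof -
  obtain a b where "ends G e = {a, b}" "a \<noteq> b" "a \<in> verts G" "b \<in> verts G"
    using graph_endsE[OF assms(1,2)] .
  then show ?thesis using that assms(3) by (cases "v = a") (auto simp: insert_commute)
qed

lemma pm_subset: "perfect_matching G M \<Longrightarrow> M \<subseteq> edges G"
  by (simp add: perfect_matching_def)

lemma pm_unique:
  assumes "perfect_matching G M" "v \<in> verts G" "e \<in> M" "f \<in> M" "v \<in> ends G e" "v \<in> ends G f"
  shows "e = f"
  using assms by (auto simp: perfect_matching_def)

lemma medge:
  assumes "perfect_matching G M" "v \<in> verts G"
  shows "medge G M v \<in> M" "v \<in> ends G (medge G M v)"
proof -
  have "\<exists>!e. e \<in> M \<and> v \<in> ends G e" using assms by (simp add: perfect_matching_def)
  from theI'[OF this] show "medge G M v \<in> M" "v \<in> ends G (medge G M v)"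
    by (auto simp: medge_def)
qed

lemma medge_eqI:
  assumes "perfect_matching G M" "v \<in> verts G" "e \<in> M" "v \<in> ends G e"
  shows "medge G M v = e"
  using pm_unique[OF assms(1,2) _ assms(3)] medge[OF assms(1,2)] assms(4) by blast

lemma medge_edges:
  "perfect_matching G M \<Longrightarrow> v \<in> verts G \<Longrightarrow> medge G M v \<in> edges G"
  using medge(1) pm_subset by (metis subsetD)

lemma mate:
  assumes "finite_loopless_graph G" "perfect_matching G M" "v \<in> verts G"
  shows "ends G (medge G M v) = {v, mate G M v}" "mate G M v \<noteq> v" "mate G M v \<in> verts G"
proof -
  obtain w where w: "ends G (medge G M v) = {v, w}" "v \<noteq> w" "w \<in> verts G"
    using graph_ends_otherE[OF assms(1) medge_edges[OF assms(2,3)] medge(2)[OF assms(2,3)]] by blast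
  then have "mate G M v = w" unfolding mate_def
    by (intro the_equality) (auto simp: doubleton_eq_iff)
  then show "ends G (medge G M v) = {v, mate G M v}" "mate G M v \<noteq> v" "mate G M v \<in> verts G"
    using w by auto
qed

lemma medge_mate:
  assumes "finite_loopless_graph G" "perfect_matching G M" "v \<in> verts G"
  shows "medge G M (mate G M v) = medge G M v" "mate G M (mate G M v) = v"
proof -
  show *: "medge G M (mate G M v) = medge G M v"
    using mate[OF assms] medge[OF assms(2,3)] by (intro medge_eqI[OF assms(2)]) auto
  have "ends G (medge G M v) = {mate G M v, mate G M (mate G M v)}"
    using mate(1)[OF assms(1,2) mate(3)[OF assms]] * by simp
  then show "mate G M (mate G M v) = v"
    using mate(1)[OF assms] mate(2)[OF assms] by (auto simp: doubleton_eq_iff)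
qed

lemma mate_eqI:
  assumes "finite_loopless_graph G" "perfect_matching G M" "e \<in> M" "ends G e = {v, w}"
  shows "mate G M v = w" "medge G M v = e"
proof -
  have e: "e \<in> edges G" using assms pm_subset by blast
  then have v: "v \<in> verts G" using assms(1,4) by (auto simp: finite_loopless_graph_def)
  have "v \<noteq> w" using assms(1,4) e by (auto simp: finite_loopless_graph_def)
  show m: "medge G M v = e" using assms(2-4) v by (intro medge_eqI) auto
  then show "mate G M v = w" using mate[OF assms(1,2) v] assms(4) \<open>v \<noteq> w\<close>
    by (auto simp: doubleton_eq_iff)
qed

lemma pm_eq_medge:
  assumes "finite_loopless_graph G" "perfect_matching G M"
  shows "M = medge G M ` verts G"
proof
  show "M \<subseteq> medge G M ` verts G"
  proof
    fix e assume e: "e \<in> M"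
    then obtain v w where "ends G e = {v, w}" "v \<in> verts G"
      using graph_endsE[OF assms(1)] pm_subset[OF assms(2)] by (metis subsetD)
    then show "e \<in> medge G M ` verts G" using mate_eqI(2)[OF assms e] by blast
  qed
qed (use medge[OF assms(2)] in auto)

lemma pm_eqI:
  assumes "finite_loopless_graph G" "perfect_matching G M" "perfect_matching G N" "M \<subseteq> N"
  shows "M = N"
proof -
  have "medge G M v = medge G N v" if "v \<in> verts G" for v
    using medge[OF assms(2) that] assms(4) by (intro medge_eqI[OF assms(3) that, symmetric]) auto
  then show ?thesis using pm_eq_medge[OF assms(1,2)] pm_eq_medge[OF assms(1,3)] by simp
qed

lemma finite_pms:
  assumes "finite_loopless_graph G"
  shows "finite {M. perfect_matching G M}" "finite {M. perfect_matching G M \<and> P M}"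
proof -
  have "finite (Pow (edges G))" using assms by (simp add: finite_loopless_graph_def)
  then show "finite {M. perfect_matching G M}"
    by (rule rev_finite_subset) (auto simp: perfect_matching_def)
  then show "finite {M. perfect_matching G M \<and> P M}"
    by (rule rev_finite_subset) auto
qed

lemma pm_finite:
  assumes "finite_loopless_graph G" "perfect_matching G M"
  shows "finite M"
  using assms finite_subset[OF pm_subset] by (auto simp: finite_loopless_graph_def)

lemma card_verts_pm:
  assumes "finite_loopless_graph G" "perfect_matching G M"
  shows "card (verts G) = 2 * card M"
proof -
  have V: "verts G = (\<Union>e\<in>M. ends G e)"
    using assms pm_subset[OF assms(2)] by (fastforce simp: finite_loopless_graph_def perfect_matching_def)
  have "card (\<Union>e\<in>M. ends G e) = (\<Sum>e\<in>M. card (ends G e))"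
  proof (rule card_UN_disjoint)
    show "finite M" using pm_finite[OF assms] .
    show "\<forall>i\<in>M. finite (ends G i)"
    proof
      fix i assume "i \<in> M"
      then have "card (ends G i) = 2" using assms pm_subset by (auto simp: finite_loopless_graph_def)
      then show "finite (ends G i)" by (metis card.infinite zero_neq_numeral)
    qed
    show "\<forall>i\<in>M. \<forall>j\<in>M. i \<noteq> j \<longrightarrow> ends G i \<inter> ends G j = {}"
      using pm_unique[OF assms(2)] V by blast
  qed
  also have "\<dots> = (\<Sum>e\<in>M. 2)"
    using assms pm_subset[OF assms(2)] by (intro sum.cong) (auto simp: finite_loopless_graph_def)
  finally show ?thesis using V by simp
qed

text \<open>Exchange principle: pieces of \<open>M\<close> and of \<open>N\<close> on vertex sets
  closed under the respective matching, completed by extra edges \<open>S\<close> on the remaining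
  vertices, cover every vertex once. The alternating-cycle and chord exchanges below are
  instances.\<close>

lemma pm_glue:
  assumes G: "finite_loopless_graph G" and M: "perfect_matching G M" and N: "perfect_matching G N"
    and S: "S \<subseteq> edges G" "\<And>e. e \<in> S \<Longrightarrow> ends G e \<subseteq> VS" "\<And>v. v \<in> VS \<Longrightarrow> \<exists>!e. e \<in> S \<and> v \<in> ends G e"
    and V: "verts G = VS \<union> VM \<union> VN" "VS \<inter> VM = {}" "VS \<inter> VN = {}" "VM \<inter> VN = {}"
    and cl: "\<And>v. v \<in> VM \<Longrightarrow> mate G M v \<in> VM" "\<And>v. v \<in> VN \<Longrightarrow> mate G N v \<in> VN"
  shows "perfect_matching G (S \<union> medge G M ` VM \<union> medge G N ` VN)"
proof -
  have eM: "ends G (medge G M v) \<subseteq> VM" if "v \<in> VM" for v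
    using mate(1)[OF G M] V(1) cl(1) that by auto
  have eN: "ends G (medge G N v) \<subseteq> VN" if "v \<in> VN" for v
    using mate(1)[OF G N] V(1) cl(2) that by auto
  have sub: "S \<union> medge G M ` VM \<union> medge G N ` VN \<subseteq> edges G"
    using S(1) medge_edges[OF M] medge_edges[OF N] V(1) by auto
  have "\<exists>!e. e \<in> S \<union> medge G M ` VM \<union> medge G N ` VN \<and> v \<in> ends G e" if v: "v \<in> verts G" for v
  proof -
    consider "v \<in> VS" | "v \<in> VM" | "v \<in> VN" using v V(1) by blast
    then show ?thesis
    proof cases
      case 1
      then have "e \<notin> medge G M ` VM" "e \<notin> medge G N ` VN" if "v \<in> ends G e" for e
        using that eM eN V(2,3) by blast+
      then show ?thesis using S(3)[OF 1] by blast
    next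
      case 2
      have "e = medge G M v" if e: "e \<in> S \<union> medge G M ` VM \<union> medge G N ` VN" "v \<in> ends G e" for e
      proof -
        have "e \<notin> S" using that S(2) 2 V(2) by blast
        moreover have "e \<notin> medge G N ` VN" using that eN 2 V(4) by blast
        ultimately obtain x where "x \<in> VM" "e = medge G M x" using e by blast
        then have "e \<in> M" using medge(1)[OF M, of x] V(1) by simp
        then show ?thesis using medge_eqI[OF M v _ e(2)] by simp
      qed
      moreover have "medge G M v \<in> medge G M ` VM" using 2 by simp
      ultimately show ?thesis using medge(2)[OF M v] by (metis UnCI)
    next
      case 3
      have "e = medge G N v" if e: "e \<in> S \<union> medge G M ` VM \<union> medge G N ` VN" "v \<in> ends G e" for e
      proof -
        have "e \<notin> S" using that S(2) 3 V(3) by blast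
        moreover have "e \<notin> medge G M ` VM" using that eM 3 V(4) by blast
        ultimately obtain x where "x \<in> VN" "e = medge G N x" using e by blast
        then have "e \<in> N" using medge(1)[OF N, of x] V(1) by simp
        then show ?thesis using medge_eqI[OF N v _ e(2)] by simp
      qed
      moreover have "medge G N v \<in> medge G N ` VN" using 3 by simp
      ultimately show ?thesis using medge(2)[OF N v] by (metis UnCI)
    qed
  qed
  then show ?thesis using sub by (simp add: perfect_matching_def)
qed

subsection \<open>Balanced graphs\<close>

text \<open>The conditions defining \<^term>\<open>class_B\<close> without connectedness, which is never needed and
  whose preservation under contraction need then not be checked.\<close>

definition balanced :: "('v, 'e) multigraph \<Rightarrow> bool" where
  "balanced G \<longleftrightarrow> finite_loopless_graph G \<and> verts G \<noteq> {} \<and> (\<exists>M. perfect_matching G M) \<and>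
     (\<forall>e \<in> edges G. pcount G e = 1 \<or> pcount G e = 2) \<and>
     (\<forall>M. perfect_matching G M \<longrightarrow> (\<forall>e\<in>M. \<forall>f\<in>M. pcount G e = pcount G f))"

lemma class_B_balanced: "G \<in> class_B \<Longrightarrow> balanced G"
proof -
  assume G: "G \<in> class_B"
  have pc: "\<forall>e\<in>edges G. pcount G e = 1 \<or> pcount G e = 2"
    using G by (auto simp: class_B_def matching_edge_def pcount_def)
  have "pcount G e = pcount G f" if "perfect_matching G M" "e \<in> M" "f \<in> M" for M e f
  proof -
    have E: "e \<in> edges G" "f \<in> edges G" using that pm_subset by blast+
    have no: "\<And>M e f. perfect_matching G M \<Longrightarrow> e \<in> M \<Longrightarrow> f \<in> M \<Longrightarrow>
       \<not> (matching_edge G 1 e \<and> matching_edge G 2 f)"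
      using G unfolding class_B_def by blast
    show ?thesis
      using no[OF that(1-3)] no[OF that(1,3,2)] E bspec[OF pc E(1)] bspec[OF pc E(2)]
      by (auto simp: matching_edge_def pcount_def)
  qed
  then show ?thesis using G pc unfolding balanced_def class_B_def connected_graph_def by blast
qed

lemma balanced_class_B:
  assumes "balanced G" "connected_graph G" shows "G \<in> class_B"
proof -
  have me: "matching_edge G k e \<longleftrightarrow> e \<in> edges G \<and> pcount G e = k" for k e
    by (simp add: matching_edge_def pcount_def)
  have "\<not> (\<exists>M. perfect_matching G M \<and> (\<exists>e\<in>M. \<exists>f\<in>M. matching_edge G 1 e \<and> matching_edge G 2 f))"
    using assms(1) unfolding me balanced_def by (metis one_eq_numeral_iff semiring_norm(85))
  moreover have "\<forall>e\<in>edges G. matching_edge G 1 e \<or> matching_edge G 2 e"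
    using assms(1) unfolding me balanced_def by simp
  ultimately show ?thesis using assms unfolding class_B_def balanced_def by simp
qed

section \<open>Single and double edges\<close>

definition singles :: "('v, 'e) multigraph \<Rightarrow> 'e set" where
  "singles G = {e \<in> edges G. pcount G e = 1}"

definition pms1 :: "('v, 'e) multigraph \<Rightarrow> 'e set set" where
  "pms1 G = {M. perfect_matching G M \<and> M \<subseteq> singles G}"

definition pms2 :: "('v, 'e) multigraph \<Rightarrow> 'e set set" where
  "pms2 G = {M. perfect_matching G M \<and> M \<inter> singles G = {}}"

lemma finite_pms12:
  "finite_loopless_graph G \<Longrightarrow> finite (pms1 G)" "finite_loopless_graph G \<Longrightarrow> finite (pms2 G)"
  unfolding pms1_def pms2_def by (simp_all add: finite_pms)

lemma balanced_graph: "balanced G \<Longrightarrow> finite_loopless_graph G"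
  by (simp add: balanced_def)

lemma balanced_pm_cases:
  assumes "balanced G" "perfect_matching G M"
  shows "M \<in> pms1 G \<or> M \<in> pms2 G"
proof (rule ccontr)
  assume "\<not> ?thesis"
  then obtain e f where "e \<in> M" "f \<in> M" "pcount G e = 1" "pcount G f \<noteq> 1"
    using assms(2) pm_subset[OF assms(2)] unfolding pms1_def pms2_def singles_def by blast
  then show False using assms unfolding balanced_def by metis
qed

text \<open>The empty set of edges would belong to both sides; it is no perfect matching because the
  graph has a vertex.\<close>

lemma pms12_disjoint:
  assumes "balanced G" shows "pms1 G \<inter> pms2 G = {}"
proof -
  have "M \<noteq> {}" if "perfect_matching G M" for M
    using that assms medge(1)[OF that] unfolding balanced_def by blast
  then show ?thesis unfolding pms1_def pms2_def by blast
qed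

lemma card_eq_pms12:
  assumes "balanced G"
  shows "card {M. perfect_matching G M} = card (pms1 G) + card (pms2 G)"
proof -
  have "{M. perfect_matching G M} = pms1 G \<union> pms2 G"
    using balanced_pm_cases[OF assms] by (auto simp: pms1_def pms2_def)
  then show ?thesis
    using card_Un_disjoint[OF finite_pms12[OF balanced_graph[OF assms]] pms12_disjoint[OF assms]] by simp
qed

lemma card_pms_at_edge:
  "e \<in> edges G \<Longrightarrow> balanced G \<Longrightarrow> e \<notin> singles G \<Longrightarrow> pcount G e = 2"
  unfolding balanced_def singles_def by blast

text \<open>A perfect matching of single edges is determined by any one of its edges. Every other
  perfect matching is therefore disjoint from it, which is what the chord arguments exploit.\<close>

lemma pms1_unique:
  assumes "balanced G" "M \<in> pms1 G" "perfect_matching G N" "e \<in> M" "e \<in> N"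
  shows "M = N"
proof -
  have "pcount G e = 1" using assms by (auto simp: pms1_def singles_def)
  then obtain P where P: "{M. perfect_matching G M \<and> e \<in> M} = {P}"
    unfolding pcount_def by (auto simp: card_1_singleton_iff)
  have "M \<in> {M. perfect_matching G M \<and> e \<in> M}" "N \<in> {M. perfect_matching G M \<and> e \<in> M}"
    using assms by (auto simp: pms1_def)
  then show ?thesis unfolding P by simp
qed

lemma singles_in_pms1:
  assumes "balanced G" "e \<in> singles G" "perfect_matching G M" "e \<in> M"
  shows "M \<in> pms1 G"
  using balanced_pm_cases[OF assms(1,3)] assms(2,4) by (auto simp: pms2_def)

lemma edge_in_pm:
  assumes "balanced G" "e \<in> edges G"
  obtains M where "perfect_matching G M" "e \<in> M"
proof -
  have "pcount G e = 1 \<or> pcount G e = 2" using assms by (simp add: balanced_def)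
  then have "pcount G e \<noteq> 0" by auto
  then have "{M. perfect_matching G M \<and> e \<in> M} \<noteq> {}" unfolding pcount_def by (metis card.empty)
  then show ?thesis using that by blast
qed

text \<open>Counting incident pairs (perfect matching, edge at \<open>v\<close>) shows that the graph is regular.\<close>

lemma card_singles_at:
  assumes B: "balanced G" and v: "v \<in> verts G"
  shows "card (incident_edges G v \<inter> singles G) = card (pms1 G)"
proof -
  have "bij_betw (\<lambda>M. medge G M v) (pms1 G) (incident_edges G v \<inter> singles G)"
  proof (rule bij_betwI')
    fix M N assume MN: "M \<in> pms1 G" "N \<in> pms1 G"
    then have pm: "perfect_matching G M" "perfect_matching G N" by (auto simp: pms1_def)
    show "(medge G M v = medge G N v) = (M = N)"
      using pms1_unique[OF B MN(1) pm(2)] medge(1)[OF pm(1) v] medge(1)[OF pm(2) v] by metis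
  next
    fix M assume M: "M \<in> pms1 G"
    then have pm: "perfect_matching G M" by (auto simp: pms1_def)
    show "medge G M v \<in> incident_edges G v \<inter> singles G"
      using M medge[OF pm v] by (auto simp: incident_edges_def pms1_def singles_def)
  next
    fix e assume e: "e \<in> incident_edges G v \<inter> singles G"
    then obtain M where M: "perfect_matching G M" "e \<in> M"
      using edge_in_pm[OF B] by (auto simp: singles_def)
    then have "M \<in> pms1 G" using singles_in_pms1[OF B _ M] e by blast
    moreover have "e = medge G M v"
      using e medge_eqI[OF M(1) v M(2)] by (auto simp: incident_edges_def)
    ultimately show "\<exists>M\<in>pms1 G. e = medge G M v" by blast
  qed
  then show ?thesis using bij_betw_same_card by metis
qed

text \<open>Each double edge at \<open>v\<close> lies in two perfect matchings, and each matching in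
  \<open>pms2 G\<close> uses exactly one double edge at \<open>v\<close>.\<close>

lemma card_doubles_at:
  assumes B: "balanced G" and v: "v \<in> verts G"
  shows "2 * card (incident_edges G v - singles G) = card (pms2 G)"
proof -
  have G: "finite_loopless_graph G" using balanced_graph[OF B] .
  define I where "I = incident_edges G v - singles G"
  define F where "F = (\<lambda>e. {M. perfect_matching G M \<and> e \<in> M})"
  have fI: "finite I" using G by (simp add: I_def incident_edges_def finite_loopless_graph_def)
  have "pms2 G = (\<Union>e\<in>I. F e)"
  proof
    show "pms2 G \<subseteq> (\<Union>e\<in>I. F e)"
    proof
      fix M assume M: "M \<in> pms2 G"
      then have pm: "perfect_matching G M" by (simp add: pms2_def)
      have "medge G M v \<in> I" using M medge[OF pm v] pm_subset[OF pm]
        by (auto simp: I_def incident_edges_def pms2_def)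
      then show "M \<in> (\<Union>e\<in>I. F e)" using pm medge[OF pm v] by (auto simp: F_def)
    qed
    show "(\<Union>e\<in>I. F e) \<subseteq> pms2 G"
      using balanced_pm_cases[OF B] by (auto simp: F_def I_def pms1_def)
  qed
  moreover have "card (\<Union>e\<in>I. F e) = (\<Sum>e\<in>I. card (F e))"
  proof (rule card_UN_disjoint[OF fI])
    show "\<forall>i\<in>I. finite (F i)" unfolding F_def using finite_pms(2)[OF G] by blast
    show "\<forall>i\<in>I. \<forall>j\<in>I. i \<noteq> j \<longrightarrow> F i \<inter> F j = {}"
      using pm_unique[OF _ v] by (fastforce simp: F_def I_def incident_edges_def)
  qed
  moreover have "(\<Sum>e\<in>I. card (F e)) = (\<Sum>e\<in>I. 2)"
  proof (rule sum.cong[OF refl])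
    fix e assume "e \<in> I"
    then show "card (F e) = 2"
      using card_pms_at_edge[OF _ B, of e] by (auto simp: I_def F_def pcount_def incident_edges_def)
  qed
  ultimately show ?thesis by (simp add: I_def)
qed

lemma degree_eq:
  assumes B: "balanced G" and v: "v \<in> verts G"
  shows "2 * card (incident_edges G v) = 2 * card (pms1 G) + card (pms2 G)"
proof -
  have "finite (incident_edges G v)"
    using balanced_graph[OF B] by (simp add: incident_edges_def finite_loopless_graph_def)
  then have "card (incident_edges G v) =
      card (incident_edges G v \<inter> singles G) + card (incident_edges G v - singles G)"
    by (metis card_Int_Diff)
  then show ?thesis using card_singles_at[OF assms] card_doubles_at[OF assms] by simp
qed

text \<open>The common degree of a balanced graph, written without reference to a vertex. The
  halving is exact, since at any vertex the matchings in \<open>pms2 G\<close> are grouped in pairs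
  by their edge.\<close>

definition degree :: "('v, 'e) multigraph \<Rightarrow> nat" where
  "degree G = card (pms1 G) + card (pms2 G) div 2"

lemma card_incident:
  assumes "balanced G" "v \<in> verts G"
  shows "card (incident_edges G v) = degree G"
  using degree_eq[OF assms] unfolding degree_def by simp

text \<open>In degree 3 this gives 5 perfect matchings in all when one of them consists of single
  edges, and 6 when none does.\<close>

lemma pms2_card:
  assumes "balanced G" shows "card (pms2 G) = 2 * (degree G - card (pms1 G))"
proof -
  obtain v where "v \<in> verts G" using assms by (auto simp: balanced_def)
  then show ?thesis using degree_eq[OF assms, of v] card_incident[OF assms, of v] by linarith
qed

subsection \<open>Pairs of involutions\<close>

text \<open>An abstract form of the union of two perfect matchings. The points are vertices when the
  involutions are the mates under \<open>M\<close> and \<open>N\<close>; they are edges in the later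
  argument on 2-regular bipartite graphs, where each involution passes to the other edge at the end
  of a fixed colour.\<close>

locale two_involutions =
  fixes V :: "'a set" and \<mu> \<nu> :: "'a \<Rightarrow> 'a"
  assumes finV: "finite V"
    and mu: "x \<in> V \<Longrightarrow> \<mu> x \<in> V" "x \<in> V \<Longrightarrow> \<mu> x \<noteq> x" "x \<in> V \<Longrightarrow> \<mu> (\<mu> x) = x"
    and nu: "x \<in> V \<Longrightarrow> \<nu> x \<in> V" "x \<in> V \<Longrightarrow> \<nu> x \<noteq> x" "x \<in> V \<Longrightarrow> \<nu> (\<nu> x) = x"
begin

definition rho :: "'a \<Rightarrow> 'a" where "rho x = \<nu> (\<mu> x)"

lemma rho_in: "x \<in> V \<Longrightarrow> rho x \<in> V"
  by (simp add: rho_def mu nu)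

lemma rho_pow_in: "x \<in> V \<Longrightarrow> (rho ^^ i) x \<in> V"
  by (induction i) (auto simp: rho_in)

lemma mu_inj: "x \<in> V \<Longrightarrow> y \<in> V \<Longrightarrow> \<mu> x = \<mu> y \<Longrightarrow> x = y"
  by (metis mu(3))

lemma nu_inj: "x \<in> V \<Longrightarrow> y \<in> V \<Longrightarrow> \<nu> x = \<nu> y \<Longrightarrow> x = y"
  by (metis nu(3))

lemma rho_inj: "x \<in> V \<Longrightarrow> y \<in> V \<Longrightarrow> rho x = rho y \<Longrightarrow> x = y"
  by (metis rho_def mu_inj nu_inj mu(1))

lemma rho_pow_cancel:
  "x \<in> V \<Longrightarrow> y \<in> V \<Longrightarrow> (rho ^^ i) x = (rho ^^ i) y \<Longrightarrow> x = y"
  by (induction i) (auto dest: rho_inj[OF rho_pow_in rho_pow_in])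

text \<open>A coincidence would descend to a fixed point of \<open>\<mu>\<close> or \<open>\<nu>\<close> in the middle of the walk.\<close>

lemma rho_pow_ne_mu: "x \<in> V \<Longrightarrow> (rho ^^ d) x \<noteq> \<mu> x"
proof (induction d arbitrary: x rule: less_induct)
  case (less d)
  consider "d = 0" | "d = 1" | e where "d = Suc (Suc e)" by (metis One_nat_def not0_implies_Suc)
  then show ?case
  proof cases
    case 1 then show ?thesis using mu(2)[OF less.prems] by auto
  next
    case 2 then show ?thesis using nu(2)[OF mu(1)[OF less.prems]] by (auto simp: rho_def)
  next
    case 3
    show ?thesis
    proof
      assume "(rho ^^ d) x = \<mu> x"
      moreover have "(rho ^^ d) x = rho ((rho ^^ e) (rho x))" using 3 by (simp add: funpow_swap1)
      ultimately have eq: "\<nu> (\<mu> ((rho ^^ e) (rho x))) = \<mu> x" by (metis rho_def)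
      have in': "(rho ^^ e) (rho x) \<in> V" using less.prems by (simp add: rho_in rho_pow_in)
      have "\<mu> ((rho ^^ e) (rho x)) = \<nu> (\<mu> x)" using eq nu(3)[OF mu(1)[OF in']] by metis
      then have "(rho ^^ e) (rho x) = \<mu> (rho x)" using mu(3)[OF in'] by (metis rho_def)
      then show False using less.IH[of e "rho x"] 3 rho_in[OF less.prems] by simp
    qed
  qed
qed

lemma rho_pow_ne_mu2:
  assumes "v \<in> V" shows "(rho ^^ i) v \<noteq> \<mu> ((rho ^^ j) v)"
  proof
    assume eq: "(rho ^^ i) v = \<mu> ((rho ^^ j) v)"
    consider "j \<le> i" | "i \<le> j" by linarith
    then show False
    proof cases
      case 1
      then have "(rho ^^ i) v = (rho ^^ (i - j)) ((rho ^^ j) v)"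
        by (metis funpow_add comp_apply le_add_diff_inverse2)
      then show False using rho_pow_ne_mu[OF rho_pow_in[OF assms]] eq by metis
    next
      case 2
      have "(rho ^^ j) v = \<mu> ((rho ^^ i) v)" using eq mu(3)[OF rho_pow_in[OF assms]] by metis
      moreover have "(rho ^^ j) v = (rho ^^ (j - i)) ((rho ^^ i) v)"
        using 2 by (metis funpow_add comp_apply le_add_diff_inverse2)
      ultimately show False using rho_pow_ne_mu[OF rho_pow_in[OF assms]] by metis
    qed
  qed

lemma rho_period:
  assumes "v \<in> V" obtains m where "m > 0" "(rho ^^ m) v = v" "\<And>i. 0 < i \<Longrightarrow> i < m \<Longrightarrow> (rho ^^ i) v \<noteq> v"
proof -
  have "\<not> inj_on (\<lambda>i. (rho ^^ i) v) (UNIV :: nat set)"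
  proof
    assume "inj_on (\<lambda>i. (rho ^^ i) v) (UNIV :: nat set)"
    moreover have "(\<lambda>i. (rho ^^ i) v) ` UNIV \<subseteq> V" using rho_pow_in[OF assms] by auto
    ultimately show False using finV by (metis finite_imageD finite_subset infinite_UNIV_nat)
  qed
  then obtain i j where "i < j" "(rho ^^ i) v = (rho ^^ j) v"
    unfolding inj_on_def by (metis linorder_neqE_nat)
  then have "(rho ^^ i) v = (rho ^^ i) ((rho ^^ (j - i)) v)"
    by (metis add_diff_inverse_nat funpow_add less_imp_le_nat comp_apply not_less)
  then have "v = (rho ^^ (j - i)) v" using rho_pow_cancel[OF assms rho_pow_in[OF assms]] by blast
  then have ex: "j - i > 0 \<and> (rho ^^ (j - i)) v = v" using \<open>i < j\<close> by simp
  define m where "m = (LEAST m. m > 0 \<and> (rho ^^ m) v = v)"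
  have "m > 0 \<and> (rho ^^ m) v = v" unfolding m_def by (rule LeastI[where P="\<lambda>m. m > 0 \<and> (rho ^^ m) v = v", OF ex])
  moreover have "(rho ^^ i) v \<noteq> v" if "0 < i" "i < m" for i
    using not_less_Least[of i "\<lambda>m. m > 0 \<and> (rho ^^ m) v = v"] that unfolding m_def by blast
  ultimately show ?thesis using that by blast
qed

text \<open>Even positions carry the powers of \<open>rho\<close>, odd positions their images under
  \<open>\<mu>\<close>. The two kinds never coincide, so the alternating walk from \<open>v\<close>
  closes up to a cycle whose length is twice the period of \<open>rho\<close>.\<close>

lemma orbit:
  assumes "v \<in> V"
  obtains c :: "nat \<Rightarrow> 'a" and m :: nat where "m > 0" "inj_on c {..<2 * m}" "c ` {..<2 * m} \<subseteq> V" "c 0 = v"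
    "\<And>i. i < m \<Longrightarrow> \<mu> (c (2 * i)) = c (2 * i + 1)"
    "\<And>i. i + 1 < m \<Longrightarrow> \<nu> (c (2 * i + 1)) = c (2 * i + 2)"
    "\<nu> (c (2 * m - 1)) = c 0"
proof -
  obtain m where m: "m > 0" "(rho ^^ m) v = v" "\<And>i. 0 < i \<Longrightarrow> i < m \<Longrightarrow> (rho ^^ i) v \<noteq> v"
    using rho_period[OF assms] by blast
  define c where "c = (\<lambda>k. if even k then (rho ^^ (k div 2)) v else \<mu> ((rho ^^ (k div 2)) v))"
  have ce: "c (2 * i) = (rho ^^ i) v" for i by (simp add: c_def)
  have co: "c (2 * i + 1) = \<mu> ((rho ^^ i) v)" for i by (simp add: c_def)
  have inj: "i = j" if "i \<le> j" "j < m" "(rho ^^ i) v = (rho ^^ j) v" for i j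
  proof (rule ccontr)
    assume "i \<noteq> j"
    have "(rho ^^ i) v = (rho ^^ i) ((rho ^^ (j - i)) v)"
      using that by (metis add_diff_inverse_nat funpow_add comp_apply not_less)
    then have "v = (rho ^^ (j - i)) v" using rho_pow_cancel[OF assms rho_pow_in[OF assms]] by blast
    moreover have "0 < j - i" "j - i < m" using that \<open>i \<noteq> j\<close> by auto
    ultimately show False using m(3)[of "j - i"] by metis
  qed
  have inj': "i = j" if "i < m" "j < m" "(rho ^^ i) v = (rho ^^ j) v" for i j
    using inj[of i j] inj[of j i] that by (metis nat_le_linear)
  note ne = rho_pow_ne_mu2[OF assms]
  have "inj_on c {..<2 * m}"
  proof (rule inj_onI)
    fix x y assume xy: "x \<in> {..<2 * m}" "y \<in> {..<2 * m}" "c x = c y"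
    have d: "x div 2 < m" "y div 2 < m" using xy by auto
    have par: "even x = even y"
      using xy(3) ne[of "x div 2" "y div 2"] ne[of "y div 2" "x div 2"] by (auto simp: c_def split: if_splits)
    moreover have "(rho ^^ (x div 2)) v = (rho ^^ (y div 2)) v"
      using xy(3) par mu_inj[OF rho_pow_in[OF assms] rho_pow_in[OF assms]] by (auto simp: c_def split: if_splits)
    ultimately show "x = y" using inj'[OF d] by (metis even_two_times_div_two odd_two_times_div_two_succ)
  qed
  moreover have "c ` {..<2 * m} \<subseteq> V" using rho_pow_in[OF assms] mu(1) by (auto simp: c_def)
  moreover have "c 0 = v" by (simp add: c_def)
  moreover have "\<mu> (c (2 * i)) = c (2 * i + 1)" for i using ce co by simp
  moreover have "\<nu> (c (2 * i + 1)) = c (2 * i + 2)" for i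
    using ce[of "Suc i"] co[of i] by (simp add: rho_def)
  moreover have "\<nu> (c (2 * m - 1)) = c 0"
  proof -
    have h: "2 * m - 1 = 2 * (m - 1) + 1" using m(1) by simp
    have "\<nu> (c (2 * m - 1)) = rho ((rho ^^ (m - 1)) v)" by (simp only: h co rho_def)
    moreover have "rho ((rho ^^ (m - 1)) v) = (rho ^^ m) v"
      using m(1) by (metis Suc_diff_1 comp_apply funpow.simps(2))
    ultimately show ?thesis using m(2) by (simp add: c_def)
  qed
  ultimately show ?thesis by (intro that[of m c] m(1))
qed

text \<open>Alternating cycles are even, so their points can be coloured alternately. One cycle is
  split off at a time: the \<open>rho\<close>-orbit of a point gets one colour, its image under
  \<open>\<mu>\<close> the other.\<close>

lemma transversal:
  obtains W where "W \<subseteq> V" "\<And>x. x \<in> V \<Longrightarrow> (\<mu> x \<in> W) \<longleftrightarrow> x \<notin> W" "\<And>x. x \<in> V \<Longrightarrow> (\<nu> x \<in> W) \<longleftrightarrow> x \<notin> W"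
proof -
  have "U \<subseteq> V \<Longrightarrow> \<mu> ` U \<subseteq> U \<Longrightarrow> \<nu> ` U \<subseteq> U \<Longrightarrow>
    \<exists>W\<subseteq>U. \<forall>x\<in>U. ((\<mu> x \<in> W) \<longleftrightarrow> x \<notin> W) \<and> ((\<nu> x \<in> W) \<longleftrightarrow> x \<notin> W)" for U
  proof (induction "card U" arbitrary: U rule: less_induct)
    case less
    show ?case
    proof (cases "U = {}")
      case False
      then obtain v where v: "v \<in> U" by blast
      then have vV: "v \<in> V" using less.prems(1) by blast
      obtain m where m: "m > 0" "(rho ^^ m) v = v" using rho_period[OF vV] by blast
      define A where "A = range (\<lambda>i. (rho ^^ i) v)"
      have AU: "A \<subseteq> U"
      proof -
        have "(rho ^^ i) v \<in> U" for i
          using v less.prems(2,3) by (induction i) (auto simp: rho_def image_subset_iff)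
        then show ?thesis by (auto simp: A_def)
      qed
      have AV: "x \<in> V" if "x \<in> A" for x using that AU less.prems(1) by blast
      have mA: "\<mu> x \<notin> A" if xA: "x \<in> A" for x
      proof
        assume "\<mu> x \<in> A"
        then obtain i j where "\<mu> x = (rho ^^ i) v" "x = (rho ^^ j) v" using xA unfolding A_def by blast
        then show False using rho_pow_ne_mu2[OF vV, of i j] by simp
      qed
      have nuA: "\<nu> (\<mu> x) \<in> A" if xA: "x \<in> A" for x
      proof -
        obtain i where "x = (rho ^^ i) v" using xA by (auto simp: A_def)
        then have "\<nu> (\<mu> x) = (rho ^^ Suc i) v" by (simp add: rho_def)
        then show ?thesis unfolding A_def by blast
      qed
      have pred: "\<exists>y\<in>A. x = \<nu> (\<mu> y)" if xA: "x \<in> A" for x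
      proof -
        obtain i where "x = (rho ^^ i) v" using xA by (auto simp: A_def)
        \<comment> \<open>Adding the period makes the exponent positive, so that one application of
          \<open>rho\<close> can be peeled off.\<close>
        then have "x = (rho ^^ (i + m)) v" using m(2) by (simp add: funpow_add)
        then have "x = rho ((rho ^^ (i + m - 1)) v)" using m(1)
          by (metis Suc_diff_1 add_gr_0 comp_apply funpow.simps(2))
        then show ?thesis unfolding A_def rho_def by blast
      qed
      have nuA': "\<exists>y\<in>A. \<nu> x = \<mu> y" if "x \<in> A" for x
        using pred[OF that] nu(3) mu(1) AV by metis
      define Orb where "Orb = A \<union> \<mu> ` A"
      have Orbc: "\<mu> x \<in> Orb" "\<nu> x \<in> Orb" if "x \<in> Orb" for x
        using that nuA nuA' mu(3)[OF AV] unfolding Orb_def by auto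
      have "Orb \<subseteq> U" using AU less.prems(2) by (auto simp: Orb_def)
      have "v \<in> Orb" unfolding Orb_def A_def by (metis UnI1 funpow_0 rangeI)
      have fU: "finite U" using finV less.prems(1) finite_subset by blast
      have "card (U - Orb) < card U" using \<open>v \<in> Orb\<close> \<open>Orb \<subseteq> U\<close> v fU by (intro psubset_card_mono) auto
      moreover have cl: "\<mu> x \<in> U - Orb" "\<nu> x \<in> U - Orb" if "x \<in> U - Orb" for x
      proof -
        have "x \<in> V" using that less.prems(1) by blast
        then have "\<mu> (\<mu> x) = x" "\<nu> (\<nu> x) = x" using mu(3) nu(3) by auto
        then show "\<mu> x \<in> U - Orb" "\<nu> x \<in> U - Orb" using Orbc that less.prems(2,3) by (metis DiffD1 DiffD2 DiffI image_subset_iff)+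
      qed
      ultimately obtain W where W: "W \<subseteq> U - Orb"
        "\<forall>x\<in>U - Orb. ((\<mu> x \<in> W) \<longleftrightarrow> x \<notin> W) \<and> ((\<nu> x \<in> W) \<longleftrightarrow> x \<notin> W)"
        using less.hyps[of "U - Orb"] less.prems(1) by blast
      have 1: "(\<mu> x \<in> A) \<longleftrightarrow> x \<notin> A" "(\<nu> x \<in> A) \<longleftrightarrow> x \<notin> A" if x: "x \<in> Orb" for x
      proof -
        consider "x \<in> A" | y where "y \<in> A" "x = \<mu> y" "x \<notin> A" using x mA unfolding Orb_def by blast
        then have "((\<mu> x \<in> A) \<longleftrightarrow> x \<notin> A) \<and> ((\<nu> x \<in> A) \<longleftrightarrow> x \<notin> A)"
        proof cases
          case 1
          then show ?thesis using mA nuA'[OF 1] by auto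
        next
          case 2
          then show ?thesis using nuA[OF 2(1)] mu(3)[OF AV[OF 2(1)]] by auto
        qed
        then show "(\<mu> x \<in> A) \<longleftrightarrow> x \<notin> A" "(\<nu> x \<in> A) \<longleftrightarrow> x \<notin> A" by auto
      qed
      have "\<forall>x\<in>U. ((\<mu> x \<in> W \<union> A) \<longleftrightarrow> x \<notin> W \<union> A) \<and> ((\<nu> x \<in> W \<union> A) \<longleftrightarrow> x \<notin> W \<union> A)"
      proof
        fix x assume x: "x \<in> U"
        have AO: "A \<subseteq> Orb" by (auto simp: Orb_def)
        show "((\<mu> x \<in> W \<union> A) \<longleftrightarrow> x \<notin> W \<union> A) \<and> ((\<nu> x \<in> W \<union> A) \<longleftrightarrow> x \<notin> W \<union> A)"
        proof (cases "x \<in> Orb")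
          case True
          then show ?thesis using 1[OF True] Orbc[OF True] W(1) by blast
        next
          case False
          then show ?thesis using W(2) cl[of x] x AO by blast
        qed
      qed
      moreover have "W \<union> A \<subseteq> U" using W(1) AU by blast
      ultimately show ?thesis by blast
    qed simp
  qed
  from this[of V] obtain W where W: "W \<subseteq> V"
    "\<forall>x\<in>V. ((\<mu> x \<in> W) \<longleftrightarrow> x \<notin> W) \<and> ((\<nu> x \<in> W) \<longleftrightarrow> x \<notin> W)"
    using mu(1) nu(1) by (auto simp: image_subset_iff)
  show ?thesis by (rule that[of W]) (use W in simp_all)
qed

end

subsection \<open>Hamiltonian cycles formed by two perfect matchings\<close>

lemma two_involutions_mate:
  assumes "finite_loopless_graph G" "perfect_matching G M" "perfect_matching G N"
  shows "two_involutions (verts G) (mate G M) (mate G N)"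
  using assms mate[OF assms(1)] medge_mate[OF assms(1)]
  by unfold_locales (auto simp: finite_loopless_graph_def)

text \<open>The union of two perfect matchings consists of even cycles and common edges, and a
  transversal is one colour class. The case \<open>M = N\<close> is included and serves for degree
  1.\<close>

lemma bipartite_if_two_pms:
  assumes "finite_loopless_graph G" "perfect_matching G M" "perfect_matching G N" "edges G \<subseteq> M \<union> N"
  shows "bipartite G"
proof -
  interpret two_involutions "verts G" "mate G M" "mate G N" by (rule two_involutions_mate[OF assms(1-3)])
  obtain W where W: "W \<subseteq> verts G" "\<And>x. x \<in> verts G \<Longrightarrow> (mate G M x \<in> W) \<longleftrightarrow> x \<notin> W"
    "\<And>x. x \<in> verts G \<Longrightarrow> (mate G N x \<in> W) \<longleftrightarrow> x \<notin> W"
    using transversal by blast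
  have "\<exists>a\<in>W. \<exists>b\<in>verts G - W. ends G e = {a, b}" if e: "e \<in> edges G" for e
  proof -
    obtain v w where vw: "ends G e = {v, w}" "v \<in> verts G" "w \<in> verts G"
      using graph_endsE[OF assms(1) e] by metis
    have "mate G M v = w \<or> mate G N v = w"
      using mate_eqI(1)[OF assms(1,2) _ vw(1)] mate_eqI(1)[OF assms(1,3) _ vw(1)] e assms(4) by blast
    then have "v \<in> W \<longleftrightarrow> w \<notin> W" using W(2,3)[OF vw(2)] by blast
    then show ?thesis using vw by (cases "v \<in> W") (auto simp: doubleton_eq_iff)
  qed
  then show ?thesis unfolding bipartite_def using W(1) by (intro exI[of _ W] exI[of _ "verts G - W"]) auto
qed

text \<open>Parity convention: \<open>M\<close> joins an even position to the next one,
  \<open>N\<close> an odd position to the next one. Only the \<open>N\<close>-edge between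
  \<open>n - 1\<close> and 0 wraps around, which accounts for the exceptional cases on the side of
  \<open>N\<close>.\<close>

locale ham_cycle =
  fixes G :: "('v, 'e) multigraph" and M N :: "'e set" and c :: "nat \<Rightarrow> 'v" and n :: nat
  assumes G: "finite_loopless_graph G" and M: "perfect_matching G M" and N: "perfect_matching G N"
    and disj: "M \<inter> N = {}"
    and bij: "bij_betw c {..<n} (verts G)" and even_n: "even n" and n_pos: "0 < n"
    and mate_M: "\<And>i. i < n \<Longrightarrow> even i \<Longrightarrow> mate G M (c i) = c (i + 1)"
    and mate_N: "\<And>i. i + 1 < n \<Longrightarrow> odd i \<Longrightarrow> mate G N (c i) = c (i + 1)"
    and mate_N_last: "mate G N (c (n - 1)) = c 0"
begin

lemma n_eq: "n = card (verts G)"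
  using bij_betw_same_card[OF bij] by simp

lemma c_in: "i < n \<Longrightarrow> c i \<in> verts G"
  using bij by (auto simp: bij_betw_def)

lemma c_eq: "i < n \<Longrightarrow> j < n \<Longrightarrow> c i = c j \<longleftrightarrow> i = j"
  using bij by (auto simp: bij_betw_def inj_on_def)

lemma c_ex: "v \<in> verts G \<Longrightarrow> \<exists>i<n. v = c i"
  using bij by (auto simp: bij_betw_def image_iff)

lemma mate_M_odd: "i < n \<Longrightarrow> odd i \<Longrightarrow> mate G M (c i) = c (i - 1)"
  using mate_M[of "i - 1"] medge_mate(2)[OF G M c_in[of "i - 1"]] by (auto elim!: oddE)

lemma mate_N_even: "i < n \<Longrightarrow> even i \<Longrightarrow> 0 < i \<Longrightarrow> mate G N (c i) = c (i - 1)"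
  using mate_N[of "i - 1"] medge_mate(2)[OF G N c_in[of "i - 1"]] by auto

lemma mate_N_0: "mate G N (c 0) = c (n - 1)"
  using mate_N_last medge_mate(2)[OF G N c_in[of "n - 1"]] n_pos by simp

lemma even_less: "i < n \<Longrightarrow> even i \<Longrightarrow> i + 1 < n"
  using even_n by (metis Suc_eq_plus1 Suc_lessI even_Suc)

lemma glue:
  assumes S: "S \<subseteq> edges G" "\<And>e. e \<in> S \<Longrightarrow> ends G e \<subseteq> c ` IS"
      "\<And>i. i \<in> IS \<Longrightarrow> \<exists>!e. e \<in> S \<and> c i \<in> ends G e"
    and I: "{..<n} = IS \<union> IM \<union> IN" "IS \<inter> IM = {}" "IS \<inter> IN = {}" "IM \<inter> IN = {}"
    and clM: "\<And>i. i \<in> IM \<Longrightarrow> even i \<Longrightarrow> i + 1 \<in> IM" "\<And>i. i \<in> IM \<Longrightarrow> odd i \<Longrightarrow> i - 1 \<in> IM"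
    and clN: "\<And>i. i \<in> IN \<Longrightarrow> odd i \<Longrightarrow> i \<noteq> n - 1 \<Longrightarrow> i + 1 \<in> IN"
      "\<And>i. i \<in> IN \<Longrightarrow> even i \<Longrightarrow> i \<noteq> 0 \<Longrightarrow> i - 1 \<in> IN" "0 \<in> IN \<longleftrightarrow> n - 1 \<in> IN"
  shows "perfect_matching G (S \<union> medge G M ` c ` IM \<union> medge G N ` c ` IN)"
proof (rule pm_glue[OF G M N S(1), where VS = "c ` IS"])
  have sub: "i < n" if "i \<in> IS \<union> IM \<union> IN" for i using that I(1) by blast
  have dj: "c ` A \<inter> c ` B = {}" if "A \<inter> B = {}" "A \<subseteq> {..<n}" "B \<subseteq> {..<n}" for A B
    using that bij by (metis bij_betw_def image_empty inj_on_image_Int)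
  show "c ` IS \<inter> c ` IM = {}" "c ` IS \<inter> c ` IN = {}" "c ` IM \<inter> c ` IN = {}"
    by (rule dj; use I in blast)+
  show "verts G = c ` IS \<union> c ` IM \<union> c ` IN" using bij I(1) by (auto simp: bij_betw_def image_Un)
  show "mate G M v \<in> c ` IM" if v: "v \<in> c ` IM" for v
  proof -
    obtain i where i: "v = c i" "i \<in> IM" "i < n" using v sub by blast
    then show ?thesis using mate_M[of i] mate_M_odd[of i] clM by (cases "even i") auto
  qed
  show "mate G N v \<in> c ` IN" if v: "v \<in> c ` IN" for v
  proof -
    obtain i where i: "v = c i" "i \<in> IN" "i < n" using v sub by blast
    consider "i = 0" | "i = n - 1" "odd i" | "even i" "0 < i" | "odd i" "i + 1 < n" "i \<noteq> n - 1"
      using i(3) by (cases "even i"; cases "i = 0"; cases "i = n - 1") auto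
    then show ?thesis
      using mate_N[of i] mate_N_even[of i] mate_N_0 mate_N_last clN i by cases auto
  qed
  show "\<exists>!e. e \<in> S \<and> v \<in> ends G e" if "v \<in> c ` IS" for v
    using that S(3) by (metis imageE)
qed (use S(2) in auto)

text \<open>The ends of an odd chord cut the cycle into two arcs with an even number of inner
  positions, and each arc can be tiled by cycle edges. For even \<open>a\<close> the arc between the
  ends starts at an odd position, so it takes \<open>N\<close> and the outer arc takes
  \<open>M\<close>; for odd \<open>a\<close> the roles are exchanged.\<close>

lemma odd_chord_pm:
  assumes e: "e \<in> edges G" "ends G e = {c a, c b}" and ab: "a < b" "b < n" "odd (b - a)"
  shows "even a \<Longrightarrow> perfect_matching G ({e} \<union> medge G M ` c ` ({..<a} \<union> {b<..<n}) \<union> medge G N ` c ` {a<..<b})"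
    and "odd a \<Longrightarrow> perfect_matching G ({e} \<union> medge G M ` c ` {a<..<b} \<union> medge G N ` c ` ({..<a} \<union> {b<..<n}))"
proof -
  have par: "even a \<longleftrightarrow> odd b" using ab by (auto simp: even_diff_nat)
  show "perfect_matching G ({e} \<union> medge G M ` c ` ({..<a} \<union> {b<..<n}) \<union> medge G N ` c ` {a<..<b})" if "even a"
  proof (rule glue[where IS = "{a, b}"])
    show "{..<n} = {a, b} \<union> ({..<a} \<union> {b<..<n}) \<union> {a<..<b}" using ab by auto
    show "i + 1 \<in> {..<a} \<union> {b<..<n}" if i: "i \<in> {..<a} \<union> {b<..<n}" "even i" for i
      using i even_less[of i] par ab \<open>even a\<close> by (auto elim!: evenE)
    show "i - 1 \<in> {..<a} \<union> {b<..<n}" if i: "i \<in> {..<a} \<union> {b<..<n}" "odd i" for i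
      using i par ab \<open>even a\<close> by (auto elim!: oddE)
    show "i + 1 \<in> {a<..<b}" if i: "i \<in> {a<..<b}" "odd i" for i
      using i par ab \<open>even a\<close> by (auto elim!: oddE)
    show "i - 1 \<in> {a<..<b}" if i: "i \<in> {a<..<b}" "even i" for i
      using i ab \<open>even a\<close> by (auto elim!: evenE)
  qed (use e ab in auto)
  show "perfect_matching G ({e} \<union> medge G M ` c ` {a<..<b} \<union> medge G N ` c ` ({..<a} \<union> {b<..<n}))" if "odd a"
  proof (rule glue[where IS = "{a, b}"])
    \<comment> \<open>Here \<open>b\<close> is even and \<open>n - 1\<close> is odd; the wrap-around
      edge of \<open>N\<close> therefore stays inside the outer arc.\<close>
    have bn: "b < n - 1" using ab \<open>odd a\<close> par even_less[of b] by auto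
    show "{..<n} = {a, b} \<union> {a<..<b} \<union> ({..<a} \<union> {b<..<n})" using ab by auto
    show "i + 1 \<in> {a<..<b}" if i: "i \<in> {a<..<b}" "even i" for i
      using i par ab \<open>odd a\<close> by (auto elim!: evenE)
    show "i - 1 \<in> {a<..<b}" if i: "i \<in> {a<..<b}" "odd i" for i
      using i ab \<open>odd a\<close> by (auto elim!: oddE)
    show "i + 1 \<in> {..<a} \<union> {b<..<n}" if i: "i \<in> {..<a} \<union> {b<..<n}" "odd i" "i \<noteq> n - 1" for i
      using i ab \<open>odd a\<close> by (auto elim!: oddE)
    show "i - 1 \<in> {..<a} \<union> {b<..<n}" if i: "i \<in> {..<a} \<union> {b<..<n}" "even i" for i
      using i par ab \<open>odd a\<close> by (auto elim!: evenE)
    show "0 \<in> {..<a} \<union> {b<..<n} \<longleftrightarrow> n - 1 \<in> {..<a} \<union> {b<..<n}"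
      using bn \<open>odd a\<close> by (auto intro: Nat.gr0I)
  qed (use e ab in auto)
qed

text \<open>An even chord alone leaves arcs that cannot be tiled. Two crossing even chords of
  opposite parity leave four arcs with an even number of inner positions, which take
  \<open>M\<close> and \<open>N\<close> alternately around the cycle.\<close>

lemma crossing_pm:
  assumes e: "e \<in> edges G" "ends G e = {c a, c a'}" and f: "f \<in> edges G" "ends G f = {c b, c b'}"
    and ab: "a < b" "b < a'" "a' < b'" "b' < n" "even (a' - a)" "even (b' - b)" "odd (b - a)"
  shows "even a \<Longrightarrow> perfect_matching G ({e, f} \<union> medge G M ` c ` ({..<a} \<union> {b<..<a'} \<union> {b'<..<n})
      \<union> medge G N ` c ` ({a<..<b} \<union> {a'<..<b'}))"
    and "odd a \<Longrightarrow> perfect_matching G ({e, f} \<union> medge G M ` c ` ({a<..<b} \<union> {a'<..<b'})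
      \<union> medge G N ` c ` ({..<a} \<union> {b<..<a'} \<union> {b'<..<n}))"
proof -
  have par: "even a' \<longleftrightarrow> even a" "even b \<longleftrightarrow> odd a" "even b' \<longleftrightarrow> odd a" using ab by (auto simp: even_diff_nat)
  have ne: "c a \<noteq> c b" "c a \<noteq> c b'" "c a' \<noteq> c b" "c a' \<noteq> c b'" using c_eq ab by auto
  have ex: "\<exists>!d. d \<in> {e, f} \<and> c i \<in> ends G d" if "i \<in> {a, a', b, b'}" for i
    using that e f ne by auto
  show "perfect_matching G ({e, f} \<union> medge G M ` c ` ({..<a} \<union> {b<..<a'} \<union> {b'<..<n})
      \<union> medge G N ` c ` ({a<..<b} \<union> {a'<..<b'}))" if a: "even a"
  proof (rule glue[where IS = "{a, a', b, b'}", OF _ _ ex])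
    show "{..<n} = {a, a', b, b'} \<union> ({..<a} \<union> {b<..<a'} \<union> {b'<..<n}) \<union> ({a<..<b} \<union> {a'<..<b'})" using ab by auto
    show "i + 1 \<in> {..<a} \<union> {b<..<a'} \<union> {b'<..<n}" if i: "i \<in> {..<a} \<union> {b<..<a'} \<union> {b'<..<n}" "even i" for i
      using i even_less[of i] a par ab by (auto elim!: evenE)
    show "i - 1 \<in> {..<a} \<union> {b<..<a'} \<union> {b'<..<n}" if i: "i \<in> {..<a} \<union> {b<..<a'} \<union> {b'<..<n}" "odd i" for i
      using i a par ab by (auto elim!: oddE)
    show "i + 1 \<in> {a<..<b} \<union> {a'<..<b'}" if i: "i \<in> {a<..<b} \<union> {a'<..<b'}" "odd i" for i
      using i a par ab by (auto elim!: oddE)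
    show "i - 1 \<in> {a<..<b} \<union> {a'<..<b'}" if i: "i \<in> {a<..<b} \<union> {a'<..<b'}" "even i" for i
      using i a par ab by (auto elim!: evenE)
  qed (use e f ab in auto)
  show "perfect_matching G ({e, f} \<union> medge G M ` c ` ({a<..<b} \<union> {a'<..<b'})
      \<union> medge G N ` c ` ({..<a} \<union> {b<..<a'} \<union> {b'<..<n}))" if a: "odd a"
  proof (rule glue[where IS = "{a, a', b, b'}", OF _ _ ex])
    \<comment> \<open>As for a single chord: \<open>b'\<close> is even, hence not the last position,
      and the edge joining \<open>n - 1\<close> to 0 is not broken.\<close>
    have bn: "b' < n - 1" using ab a par even_less[of b'] by auto
    show "{..<n} = {a, a', b, b'} \<union> ({a<..<b} \<union> {a'<..<b'}) \<union> ({..<a} \<union> {b<..<a'} \<union> {b'<..<n})" using ab by auto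
    show "i + 1 \<in> {a<..<b} \<union> {a'<..<b'}" if i: "i \<in> {a<..<b} \<union> {a'<..<b'}" "even i" for i
      using i a par ab by (auto elim!: evenE)
    show "i - 1 \<in> {a<..<b} \<union> {a'<..<b'}" if i: "i \<in> {a<..<b} \<union> {a'<..<b'}" "odd i" for i
      using i a par ab by (auto elim!: oddE)
    show "i + 1 \<in> {..<a} \<union> {b<..<a'} \<union> {b'<..<n}" if i: "i \<in> {..<a} \<union> {b<..<a'} \<union> {b'<..<n}" "odd i" "i \<noteq> n - 1" for i
      using i a par ab by (auto elim!: oddE)
    show "i - 1 \<in> {..<a} \<union> {b<..<a'} \<union> {b'<..<n}" if i: "i \<in> {..<a} \<union> {b<..<a'} \<union> {b'<..<n}" "even i" for i
      using i a par ab by (auto elim!: evenE)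
    show "0 \<in> {..<a} \<union> {b<..<a'} \<union> {b'<..<n} \<longleftrightarrow> n - 1 \<in> {..<a} \<union> {b<..<a'} \<union> {b'<..<n}"
      using bn a by (auto intro: Nat.gr0I)
  qed (use e f ab in auto)
qed

end

text \<open>If the alternating cycle through \<open>v\<close> missed a vertex, taking
  \<open>N\<close> on the cycle and \<open>M\<close> elsewhere would give a third perfect matching
  inside \<open>M \<union> N\<close>.\<close>

lemma ham_cycle_exists:
  fixes G :: "('v, 'e) multigraph"
  assumes G: "finite_loopless_graph G" and M: "perfect_matching G M" and N: "perfect_matching G N"
    and disj: "M \<inter> N = {}"
    and irred: "\<And>Q. perfect_matching G Q \<Longrightarrow> Q \<subseteq> M \<union> N \<Longrightarrow> Q = M \<or> Q = N"
    and v: "v \<in> verts G"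
  obtains c n where "ham_cycle G M N c n" "c 0 = v"
proof -
  interpret two_involutions "verts G" "mate G M" "mate G N" by (rule two_involutions_mate[OF G M N])
  obtain c :: "nat \<Rightarrow> 'v" and m :: nat where c: "m > 0" "inj_on c {..<2 * m}" "c ` {..<2 * m} \<subseteq> verts G" "c 0 = v"
    "\<And>i. i < m \<Longrightarrow> mate G M (c (2 * i)) = c (2 * i + 1)"
    "\<And>i. i + 1 < m \<Longrightarrow> mate G N (c (2 * i + 1)) = c (2 * i + 2)"
    "mate G N (c (2 * m - 1)) = c 0"
    by (rule orbit[OF v]) (rule that; assumption)
  define Orb where "Orb = c ` {..<2 * m}"
  have clOrb: "mate G M x \<in> Orb" "mate G N x \<in> Orb" if x: "x \<in> Orb" for x
  proof -
    obtain i where i: "x = c i" "i < 2 * m" using x by (auto simp: Orb_def)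
    have V: "c j \<in> verts G" if "j < 2 * m" for j using that c(3) by auto
    have m1: "\<exists>j<2*m. mate G M (c i) = c j"
    proof (cases "even i")
      case True
      then obtain j where "i = 2 * j" by (auto elim: evenE)
      then show ?thesis using c(5)[of j] i(2) by (intro exI[of _ "2 * j + 1"]) auto
    next
      case False
      then obtain j where j: "i = 2 * j + 1" by (auto elim: oddE)
      then have "mate G M (c i) = c (2 * j)" using c(5)[of j] i(2) mu(3)[OF V[of "2 * j"]] by auto
      then show ?thesis using j i(2) by (intro exI[of _ "2 * j"]) auto
    qed
    have m2: "\<exists>j<2*m. mate G N (c i) = c j"
    proof (cases "even i")
      case False
      then obtain j where j: "i = 2 * j + 1" by (auto elim: oddE)
      show ?thesis
      proof (cases "j + 1 < m")
        case True
        then show ?thesis using c(6)[of j] j by (intro exI[of _ "2 * j + 2"]) auto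
      next
        case False
        then have "i = 2 * m - 1" using j i(2) by simp
        then show ?thesis using c(1,7) by (intro exI[of _ 0]) auto
      qed
    next
      case True
      then obtain j where j: "i = 2 * j" by (auto elim: evenE)
      show ?thesis
      proof (cases j)
        case 0
        then have "mate G N (c i) = c (2 * m - 1)" using c(1,7) nu(3)[OF V[of "2 * m - 1"]] j by simp
        then show ?thesis using c(1) by (intro exI[of _ "2 * m - 1"]) auto
      next
        case (Suc k)
        then have "mate G N (c (2 * k + 1)) = c i" using c(6)[of k] j i(2) by simp
        then have "mate G N (c i) = c (2 * k + 1)" using nu(3)[OF V[of "2 * k + 1"]] j Suc i(2) by auto
        then show ?thesis using j Suc i(2) by (intro exI[of _ "2 * k + 1"]) auto
      qed
    qed
    show "mate G M x \<in> Orb" "mate G N x \<in> Orb" using m1 m2 i(1) by (auto simp: Orb_def)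
  qed
  have clOrb': "mate G M x \<in> verts G - Orb" if "x \<in> verts G - Orb" for x
  proof -
    have "mate G M x \<in> verts G" "mate G M (mate G M x) = x" using mu that by auto
    then show ?thesis using clOrb(1)[of "mate G M x"] that by auto
  qed
  have OV: "Orb \<subseteq> verts G" using c(3) by (simp add: Orb_def)
  have "perfect_matching G ({} \<union> medge G M ` (verts G - Orb) \<union> medge G N ` Orb)"
    by (rule pm_glue[OF G M N, where VS = "{}"]) (use clOrb clOrb' OV in auto)
  moreover have "{} \<union> medge G M ` (verts G - Orb) \<union> medge G N ` Orb \<subseteq> M \<union> N"
    using medge(1)[OF M] medge(1)[OF N] OV by auto
  ultimately have "medge G M ` (verts G - Orb) \<union> medge G N ` Orb = M \<or> medge G M ` (verts G - Orb) \<union> medge G N ` Orb = N"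
    using irred by auto
  moreover have "v \<in> Orb" using c(1,4) by (auto simp: Orb_def)
  ultimately have eq: "medge G M ` (verts G - Orb) \<union> medge G N ` Orb = N"
    using medge(1)[OF N v] disj by blast
  have "verts G - Orb = {}"
  proof (rule ccontr)
    assume "verts G - Orb \<noteq> {}"
    then obtain x where x: "x \<in> verts G - Orb" by blast
    then have "medge G M x \<in> N" using eq by blast
    moreover have "medge G M x \<in> M" using medge(1)[OF M] x by blast
    ultimately show False using disj by blast
  qed
  then have "c ` {..<2 * m} = verts G" using OV by (auto simp: Orb_def)
  then have "ham_cycle G M N c (2 * m)"
  proof (unfold_locales, goal_cases)
    case (5) then show ?case using c(2) by (simp add: bij_betw_def)
  next
    case (8 i) then show ?case using c(5)[of "i div 2"] by auto
  next
    case (9 i) then show ?case using c(6)[of "i div 2"] by (auto elim!: oddE)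
  qed (use c G M N disj in auto)
  then show ?thesis using that c(4) by blast
qed

subsection \<open>Chords of a Hamiltonian cycle\<close>

text \<open>Bogdanov's argument: the vertex next to an end of a shortest chord would otherwise have a shorter one.\<close>

lemma chord_exists:
  fixes R :: "(nat \<times> nat) set"
  assumes R: "R \<subseteq> {(i, j). i < j \<and> j < n}" and all: "\<And>x. x < n \<Longrightarrow> \<exists>y. (x, y) \<in> R \<or> (y, x) \<in> R"
    and n: "0 < n"
  shows "(\<exists>i j. (i, j) \<in> R \<and> odd (j - i)) \<or>
    (\<exists>a b a' b'. a < b \<and> b < a' \<and> a' < b' \<and> (a, a') \<in> R \<and> (b, b') \<in> R \<and>
       even (a' - a) \<and> even (b' - b) \<and> odd (b - a))"
proof (rule ccontr)
  assume "\<not> ?thesis"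
  then have ev: "\<And>i j. (i, j) \<in> R \<Longrightarrow> even (j - i)"
    and nc: "\<And>a b a' b'. a < b \<Longrightarrow> b < a' \<Longrightarrow> a' < b' \<Longrightarrow> (a, a') \<in> R \<Longrightarrow> (b, b') \<in> R \<Longrightarrow> even (b - a)"
    by blast+
  obtain p where p: "p \<in> R" using all[OF n] by blast
  obtain q where q: "q \<in> R" "\<And>y. y \<in> R \<Longrightarrow> snd q - fst q \<le> snd y - fst y"
    using ex_has_least_nat[of "\<lambda>q. q \<in> R" p "\<lambda>q. snd q - fst q"] p by blast
  obtain i j where ij: "q = (i, j)" by (cases q)
  have lt: "i < j" "j < n" using q(1) R ij by auto
  have e: "even (j - i)" using ev q(1) ij by blast
  have i1: "i + 1 < j" using lt e by (metis Suc_eq_plus1 Suc_lessI diff_Suc_Suc even_Suc diff_self_eq_0 even_zero Suc_diff_le less_or_eq_imp_le)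
  obtain y where y: "(i + 1, y) \<in> R \<or> (y, i + 1) \<in> R" using all[of "i + 1"] i1 lt by auto
  then show False
  proof
    assume A: "(i + 1, y) \<in> R"
    then have "i + 1 < y" "even (y - (i + 1))" using R ev[OF A] by blast+
    moreover have "y \<noteq> j" using \<open>even (y - (i + 1))\<close> e lt i1 by (auto simp: even_diff_nat)
    moreover have "\<not> j < y" using nc[of i "i + 1" j y] A q(1) ij i1 by auto
    ultimately have "y - (i + 1) < j - i" by linarith
    then show False using q(2)[OF A] ij by simp
  next
    \<comment> \<open>This chord is even, so it starts to the left of \<open>i\<close>, at a
      position of the other parity, and crosses the shortest chord in the forbidden way.\<close>
    assume A: "(y, i + 1) \<in> R"
    then have "y < i + 1" "even (i + 1 - y)" using R ev[OF A] by blast+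
    then have "y < i" "odd (i - y)" using e lt by (auto simp: even_diff_nat less_Suc_eq)
    then show False using nc[of y i "i + 1" j] A q(1) ij i1 by auto
  qed
qed

text \<open>Turns the information that a matching avoids \<open>X\<close> into the emptiness of the
  arcs that were tiled by edges of \<open>X\<close>.\<close>

lemma (in ham_cycle) medge_image_empty:
  assumes "medge G X ` c ` I \<inter> X = {}" "perfect_matching G X" "I \<subseteq> {..<n}"
  shows "I = {}"
proof (rule ccontr)
  assume "I \<noteq> {}"
  then obtain i where "i \<in> I" by blast
  then show False using assms medge(1)[OF assms(2) c_in[of i]] by blast
qed

context ham_cycle
begin

text \<open>The matching built from the chord contains \<open>e\<close>, which is not in
  \<open>M\<close>, and so avoids \<open>M\<close>. The arcs tiled by \<open>M\<close> are then
  empty: the chord is parallel to an edge of \<open>N\<close>.\<close>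

lemma odd_chord_single:
  assumes B: "balanced G" and M1: "M \<in> pms1 G"
    and e: "e \<in> edges G" "ends G e = {c a, c b}" "e \<notin> M" and ab: "a < b" "b < n" "odd (b - a)"
  shows "(even a \<longrightarrow> a = 0 \<and> b = n - 1) \<and> (odd a \<longrightarrow> b = a + 1)"
proof -
  have no: "Q \<inter> M = {}" if "perfect_matching G Q" "e \<in> Q" for Q
    using pms1_unique[OF B M1 that(1)] that(2) e(3) by blast
  show ?thesis
  proof (intro conjI impI)
    assume "even a"
    from no[OF odd_chord_pm(1)[OF e(1,2) ab this]]
    have "medge G M ` c ` ({..<a} \<union> {b<..<n}) \<inter> M = {}" by blast
    then have *: "{..<a} \<union> {b<..<n} = {}" by (rule medge_image_empty[OF _ M]) (use ab in auto)
    then show "a = 0" by auto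
    show "b = n - 1" using * ab(2) by (cases "b + 1 < n") auto
  next
    assume "odd a"
    from no[OF odd_chord_pm(2)[OF e(1,2) ab this]]
    have "medge G M ` c ` {a<..<b} \<inter> M = {}" by blast
    then have "{a<..<b} = {}" by (rule medge_image_empty[OF _ M]) (use ab in auto)
    then show "b = a + 1" using ab by (metis Suc_eq_plus1 Suc_lessI empty_iff greaterThanLessThan_iff lessI)
  qed
qed

text \<open>By the same reasoning the two arcs tiled by \<open>M\<close> are empty, that is, the
  four ends of the crossing chords are joined in pairs by two edges of \<open>N\<close>.\<close>

lemma crossing_single:
  assumes B: "balanced G" and M1: "M \<in> pms1 G"
    and e: "e \<in> edges G" "ends G e = {c a, c a'}" "e \<notin> M" and f: "f \<in> edges G" "ends G f = {c b, c b'}"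
    and ab: "a < b" "b < a'" "a' < b'" "b' < n" "even (a' - a)" "even (b' - b)" "odd (b - a)"
  shows "(even a \<longrightarrow> a = 0 \<and> a' = b + 1 \<and> b' = n - 1) \<and> (odd a \<longrightarrow> b = a + 1 \<and> b' = a' + 1)"
proof -
  have no: "Q \<inter> M = {}" if "perfect_matching G Q" "e \<in> Q" for Q
    using pms1_unique[OF B M1 that(1)] that(2) e(3) by blast
  have gap: "y = x + 1" if "{x<..<y} = {}" "x < y" for x y :: nat
    using that by (metis Suc_eq_plus1 Suc_lessI empty_iff greaterThanLessThan_iff lessI)
  show ?thesis
  proof (intro conjI impI)
    assume "even a"
    from no[OF crossing_pm(1)[OF e(1,2) f ab this]]
    have "medge G M ` c ` ({..<a} \<union> {b<..<a'} \<union> {b'<..<n}) \<inter> M = {}" by blast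
    then have *: "{..<a} \<union> {b<..<a'} \<union> {b'<..<n} = {}" by (rule medge_image_empty[OF _ M]) (use ab in auto)
    then show "a = 0" by auto
    show "b' = n - 1" using * ab(4) by (cases "b' + 1 < n") auto
    show "a' = b + 1" using * gap ab(2) by blast
  next
    assume "odd a"
    from no[OF crossing_pm(2)[OF e(1,2) f ab this]]
    have "medge G M ` c ` ({a<..<b} \<union> {a'<..<b'}) \<inter> M = {}" by blast
    then have *: "{a<..<b} \<union> {a'<..<b'} = {}" by (rule medge_image_empty[OF _ M]) (use ab in auto)
    then show "b = a + 1" "b' = a' + 1" using gap ab by blast+
  qed
qed

lemma ends_pos:
  assumes "e \<in> edges G"
  obtains i j where "i < j" "j < n" "ends G e = {c i, c j}"
proof -
  obtain v w where vw: "ends G e = {v, w}" "v \<noteq> w" "v \<in> verts G" "w \<in> verts G" using graph_endsE[OF G assms] .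
  then obtain i j where ij: "i < n" "j < n" "v = c i" "w = c j" using c_ex by meson
  then have "i \<noteq> j" using vw(2) by auto
  then show ?thesis using that[of i j] that[of j i] ij vw(1) by (cases "i < j") (auto simp: insert_commute)
qed

lemma ends_M: "i < n \<Longrightarrow> even i \<Longrightarrow> ends G (medge G M (c i)) = {c i, c (i + 1)}"
  using mate(1)[OF G M c_in] mate_M by metis

lemma ends_N: "i + 1 < n \<Longrightarrow> odd i \<Longrightarrow> ends G (medge G N (c i)) = {c i, c (i + 1)}"
  using mate(1)[OF G N c_in[of i]] mate_N[of i] by simp

lemma ends_N_last: "ends G (medge G N (c (n - 1))) = {c (n - 1), c 0}"
  using mate(1)[OF G N c_in[of "n - 1"]] mate_N_last n_pos by simp

end

text \<open>A perfect matching inside \<open>M \<union> N\<close> either meets \<open>M\<close> and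
  equals it, or lies in \<open>N\<close> and equals \<open>N\<close>. This is the hypothesis under
  which \<open>M\<close> and \<open>N\<close> form a Hamiltonian cycle.\<close>

lemma pms1_irreducible:
  assumes B: "balanced G" and M: "M \<in> pms1 G" and N: "perfect_matching G N" and ne: "M \<noteq> N"
  shows "M \<inter> N = {}" "\<And>Q. perfect_matching G Q \<Longrightarrow> Q \<subseteq> M \<union> N \<Longrightarrow> Q = M \<or> Q = N"
proof -
  show "M \<inter> N = {}" using pms1_unique[OF B M N] ne by blast
  show "Q = M \<or> Q = N" if Q: "perfect_matching G Q" "Q \<subseteq> M \<union> N" for Q
  proof (cases "Q \<inter> M = {}")
    case True
    then have "Q \<subseteq> N" using Q by blast
    then show ?thesis using pm_eqI[OF balanced_graph[OF B] Q(1) N] by blast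
  next
    case False
    then show ?thesis using pms1_unique[OF B M Q(1)] by blast
  qed
qed

text \<open>The edges of \<open>edges G - M - N\<close> form the two diagonals of a 4-cycle; so \<open>G\<close> is
  \<open>K\<^sub>4\<close>, possibly with one perfect matching doubled.\<close>

lemma two_single_pms:
  fixes G :: "('v, 'e) multigraph"
  assumes B: "balanced G" and MN: "M \<in> pms1 G" "N \<in> pms1 G" "M \<noteq> N"
    and deg: "3 \<le> degree G" and card: "2 < card (verts G)" and v: "v \<in> verts G"
  obtains c :: "nat \<Rightarrow> 'v" and k Z Y where "ham_cycle G M N c 4" "c 0 = v" "k = degree G - 2" "k = 1 \<or> k = 2"
    "edges G = M \<union> N \<union> Z \<union> Y" "(M \<union> N) \<inter> (Z \<union> Y) = {}"
    "\<And>e. e \<in> Z \<Longrightarrow> ends G e = {c 0, c 2} \<and> pcount G e = k" "\<And>e. e \<in> Y \<Longrightarrow> ends G e = {c 1, c 3} \<and> pcount G e = k"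
    "card Z = k" "card Y = k"
proof -
  have G: "finite_loopless_graph G" using balanced_graph[OF B] .
  have M: "perfect_matching G M" and N: "perfect_matching G N" using MN by (auto simp: pms1_def)
  obtain c n where "ham_cycle G M N c n" and c0: "c 0 = v"
    using ham_cycle_exists[OF G M N pms1_irreducible[OF B MN(1) N MN(3)] v] .
  interpret ham_cycle G M N c n by fact
  have n4: "4 \<le> n" using card n_eq even_n by (auto elim!: evenE)
  define R where "R = {(i, j). i < j \<and> j < n \<and> (\<exists>e\<in>edges G - M - N. ends G e = {c i, c j})}"
  have noM: "Q \<inter> M = {}" "Q \<inter> N = {}" if "perfect_matching G Q" "e \<in> Q" "e \<in> edges G - M - N" for Q e
    using pms1_unique[OF B MN(1) that(1)] pms1_unique[OF B MN(2) that(1)] that(2,3) by blast+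
  have inc: "incident_edges G (c i) = {medge G M (c i), medge G N (c i)} \<union> {e \<in> edges G - M - N. c i \<in> ends G e}"
    if "i < n" for i
    using c_in[OF that] medge[OF M] medge[OF N] medge_eqI[OF M] medge_eqI[OF N] pm_subset[OF M] pm_subset[OF N]
    unfolding incident_edges_def by blast
  have fin: "finite {e \<in> edges G - M - N. P e}" for P using G by (simp add: finite_loopless_graph_def)
  have cinc: "card {e \<in> edges G - M - N. c i \<in> ends G e} = degree G - 2" if "i < n" for i
  proof -
    have "card (incident_edges G (c i)) = card {medge G M (c i), medge G N (c i)} + card {e \<in> edges G - M - N. c i \<in> ends G e}"
      unfolding inc[OF that] using medge(1)[OF M c_in[OF that]] medge(1)[OF N c_in[OF that]] fin
      by (intro card_Un_disjoint) auto
    moreover have "medge G M (c i) \<noteq> medge G N (c i)"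
      using medge(1)[OF M c_in[OF that]] medge(1)[OF N c_in[OF that]] disj by auto
    ultimately show ?thesis using card_incident[OF B c_in[OF that]] by simp
  qed
  have ex: "\<exists>y. (x, y) \<in> R \<or> (y, x) \<in> R" if x: "x < n" for x
  proof -
    have "card {e \<in> edges G - M - N. c x \<in> ends G e} \<noteq> 0" using cinc[OF x] deg by simp
    then have "{e \<in> edges G - M - N. c x \<in> ends G e} \<noteq> {}" by (metis card.empty)
    then obtain e where e: "e \<in> edges G - M - N" "c x \<in> ends G e" by blast
    obtain i j where ij: "i < j" "j < n" "ends G e = {c i, c j}" using ends_pos[of e] e(1) by blast
    then have "x = i \<or> x = j" using e(2) c_eq x by auto
    then show ?thesis using ij e(1) by (auto simp: R_def)
  qed
  \<comment> \<open>The matching obtained from an odd chord avoids both \<open>M\<close> and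
    \<open>N\<close>, so both arcs are empty. For even \<open>i\<close> this forces
    \<open>n = 2\<close>; for odd \<open>i\<close> position 0 lies in the outer arc.\<close>
  have odd: False if ijR: "(i, j) \<in> R" "odd (j - i)" for i j
  proof -
    obtain e where e: "i < j" "j < n" "e \<in> edges G - M - N" "ends G e = {c i, c j}" using ijR(1) by (auto simp: R_def)
    show False
    proof (cases "even i")
      case True
      have Q: "perfect_matching G ({e} \<union> medge G M ` c ` ({..<i} \<union> {j<..<n}) \<union> medge G N ` c ` {i<..<j})"
        using odd_chord_pm(1)[OF _ e(4,1,2) that(2) True] e(3) by blast
      have h: "medge G M ` c ` ({..<i} \<union> {j<..<n}) \<inter> M = {}" "medge G N ` c ` {i<..<j} \<inter> N = {}"
        using noM[OF Q _ e(3)] by blast+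
      have "{..<i} \<union> {j<..<n} = {}" by (rule medge_image_empty[OF h(1) M]) (use e(1,2) in auto)
      moreover have "{i<..<j} = {}" by (rule medge_image_empty[OF h(2) N]) (use e(1,2) in auto)
      ultimately have "{..<i} \<union> {j<..<n} = {}" "{i<..<j} = {}" .
      then have "i = 0" "\<not> j + 1 < n" "\<not> i + 1 < j" by auto
      then show False using n4 e(1,2) by linarith
    next
      case False
      have Q: "perfect_matching G ({e} \<union> medge G M ` c ` {i<..<j} \<union> medge G N ` c ` ({..<i} \<union> {j<..<n}))"
        using odd_chord_pm(2)[OF _ e(4,1,2) that(2) False] e(3) by blast
      have "medge G N ` c ` ({..<i} \<union> {j<..<n}) \<inter> N = {}" using noM[OF Q _ e(3)] by blast
      then have "{..<i} \<union> {j<..<n} = {}" by (rule medge_image_empty[OF _ N]) (use e(1,2) in auto)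
      then show False using False by (auto simp: lessThan_empty_iff)
    qed
  qed
  obtain a b a' b' where ab: "a < b" "b < a'" "a' < b'" "(a, a') \<in> R" "(b, b') \<in> R"
      "even (a' - a)" "even (b' - b)" "odd (b - a)"
  proof -
    have "R \<subseteq> {(i, j). i < j \<and> j < n}" "0 < n" using n4 by (auto simp: R_def)
    from chord_exists[OF this(1) _ this(2)] ex
    have "(\<exists>i j. (i, j) \<in> R \<and> odd (j - i)) \<or>
      (\<exists>a b a' b'. a < b \<and> b < a' \<and> a' < b' \<and> (a, a') \<in> R \<and> (b, b') \<in> R \<and>
        even (a' - a) \<and> even (b' - b) \<and> odd (b - a))" by simp
    then show ?thesis using odd that by (elim disjE exE conjE) blast+
  qed
  obtain e where e: "e \<in> edges G - M - N" "ends G e = {c a, c a'}" using ab(4) by (auto simp: R_def)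
  obtain f where f: "f \<in> edges G - M - N" "ends G f = {c b, c b'}" "b' < n" using ab(5) by (auto simp: R_def)
  \<comment> \<open>Again both \<open>M\<close> and \<open>N\<close> are avoided, so all four arcs
    are empty and the ends of the two chords are all the positions. An odd \<open>a\<close> is
    impossible because position 0 would lie in an arc.\<close>
  have "n = 4"
  proof (cases "even a")
    case True
    have Q: "perfect_matching G ({e, f} \<union> medge G M ` c ` ({..<a} \<union> {b<..<a'} \<union> {b'<..<n})
      \<union> medge G N ` c ` ({a<..<b} \<union> {a'<..<b'}))"
      using crossing_pm(1)[OF _ e(2) _ f(2) ab(1-3) f(3) ab(6-8) True] e f by blast
    have h: "medge G M ` c ` ({..<a} \<union> {b<..<a'} \<union> {b'<..<n}) \<inter> M = {}" "medge G N ` c ` ({a<..<b} \<union> {a'<..<b'}) \<inter> N = {}"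
      using noM[OF Q UnI1[OF UnI1[OF insertI1]] e(1)] by (simp_all only: Int_Un_distrib2 Un_empty)
    have "{..<a} \<union> {b<..<a'} \<union> {b'<..<n} = {}" by (rule medge_image_empty[OF h(1) M]) (use ab f(3) in auto)
    moreover have "{a<..<b} \<union> {a'<..<b'} = {}" by (rule medge_image_empty[OF h(2) N]) (use ab f(3) in auto)
    ultimately have "{..<a} \<union> {b<..<a'} \<union> {b'<..<n} = {}" "{a<..<b} \<union> {a'<..<b'} = {}" .
    then have "a = 0" "\<not> b + 1 < a'" "\<not> b' + 1 < n" "\<not> a + 1 < b" "\<not> a' + 1 < b'" by auto
    then show ?thesis using ab f(3) by linarith
  next
    case False
    have Q: "perfect_matching G ({e, f} \<union> medge G M ` c ` ({a<..<b} \<union> {a'<..<b'})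
      \<union> medge G N ` c ` ({..<a} \<union> {b<..<a'} \<union> {b'<..<n}))"
      using crossing_pm(2)[OF _ e(2) _ f(2) ab(1-3) f(3) ab(6-8) False] e f by blast
    have "medge G N ` c ` ({..<a} \<union> {b<..<a'} \<union> {b'<..<n}) \<inter> N = {}"
      using noM(2)[OF Q UnI1[OF UnI1[OF insertI1]] e(1)] by (simp only: Int_Un_distrib2 Un_empty)
    then have "{..<a} \<union> {b<..<a'} \<union> {b'<..<n} = {}"
      by (rule medge_image_empty[OF _ N]) (use ab f(3) in auto)
    then show ?thesis using False by (auto simp: lessThan_empty_iff)
  qed
  note n = this
  define Z where "Z = {e \<in> edges G - M - N. ends G e = {c 0, c 2}}"
  define Y where "Y = {e \<in> edges G - M - N. ends G e = {c 1, c 3}}"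
  have lt4: "x < 4 \<longleftrightarrow> x = 0 \<or> x = 1 \<or> x = 2 \<or> x = (3::nat)" for x by auto
  have ceq: "c 0 \<noteq> c 1" "c 0 \<noteq> c 2" "c 0 \<noteq> c 3" "c 1 \<noteq> c 2" "c 1 \<noteq> c 3" "c 2 \<noteq> c 3"
    "c 1 \<noteq> c 0" "c 2 \<noteq> c 0" "c 3 \<noteq> c 0" "c 2 \<noteq> c 1" "c 3 \<noteq> c 1" "c 3 \<noteq> c 2"
    using c_eq n by auto
  have V: "verts G = {c 0, c 1, c 2, c 3}"
    using bij n by (auto simp: bij_betw_def lt4 lessThan_def)
  have ZY: "e \<in> Z \<union> Y" if eMN: "e \<in> edges G - M - N" for e
  proof -
    obtain i j where ij: "i < j" "j < n" "ends G e = {c i, c j}" using ends_pos[of e] eMN by blast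
    then have "(i, j) \<in> R" using that by (auto simp: R_def)
    then have "even (j - i)" using odd by blast
    moreover have "i < 4" "j < 4" using ij n by auto
    ultimately have "i = 0 \<and> j = 2 \<or> i = 1 \<and> j = 3" using ij(1) unfolding lt4 by (elim disjE) simp_all
    then show ?thesis using ij that by (auto simp: Z_def Y_def)
  qed
  have Zc: "card Z = degree G - 2"
  proof -
    have "c 0 \<notin> ends G e" if "e \<in> Y" for e using that ceq by (auto simp: Y_def)
    moreover have "e \<in> edges G - M - N \<and> c 0 \<in> ends G e" if "e \<in> Z" for e using that by (auto simp: Z_def)
    ultimately have "{e \<in> edges G - M - N. c 0 \<in> ends G e} = Z" using ZY by blast
    then show ?thesis using cinc[of 0] n by simp
  qed
  have Yc: "card Y = degree G - 2"
  proof -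
    have "c 1 \<notin> ends G e" if "e \<in> Z" for e using that ceq by (auto simp: Z_def)
    moreover have "e \<in> edges G - M - N \<and> c 1 \<in> ends G e" if "e \<in> Y" for e using that by (auto simp: Y_def)
    ultimately have "{e \<in> edges G - M - N. c 1 \<in> ends G e} = Y" using ZY by blast
    then show ?thesis using cinc[of 1] n by simp
  qed
  have EM: "ends G (medge G M (c 0)) = {c 0, c 1}" "ends G (medge G M (c 2)) = {c 2, c 3}"
    "ends G (medge G N (c 1)) = {c 1, c 2}" "ends G (medge G N (c 3)) = {c 3, c 0}"
    using ends_M[of 0] ends_M[of 2] ends_N[of 1] ends_N_last n by (simp_all add: numeral_eq_Suc)
  have Mset: "M \<union> N = {medge G M (c 0), medge G M (c 2), medge G N (c 1), medge G N (c 3)}"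
  proof -
    have "medge G M (c 1) = medge G M (c 0)" "medge G M (c 3) = medge G M (c 2)"
      "medge G N (c 0) = medge G N (c 3)" "medge G N (c 2) = medge G N (c 1)"
      using EM medge_eqI[OF M] medge_eqI[OF N] medge(1)[OF M] medge(1)[OF N] V by auto
    then show ?thesis using pm_eq_medge[OF G M] pm_eq_medge[OF G N] V by auto
  qed
  have diag: "e \<in> edges G - M - N" if "e \<in> edges G" "ends G e = {c 0, c 2} \<or> ends G e = {c 1, c 3}" for e
  proof -
    have "e \<notin> M \<union> N"
    proof
      assume "e \<in> M \<union> N"
      then show False unfolding Mset using EM that(2) ceq by (auto simp: doubleton_eq_iff)
    qed
    then show ?thesis using that(1) by blast
  qed
  have pm: "perfect_matching G {e, f}" if "e \<in> Z" "f \<in> Y" for e f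
  proof -
    have 1: "ends G e = {c 0, c 2}" "ends G f = {c 1, c 3}" "e \<in> edges G" "f \<in> edges G"
      using that by (auto simp: Z_def Y_def)
    have "\<exists>!d. d \<in> {e, f} \<and> v \<in> ends G d" if "v \<in> verts G" for v
      using that 1 ceq unfolding V by auto
    then show ?thesis using 1 by (simp add: perfect_matching_def)
  qed
  \<comment> \<open>A perfect matching through one diagonal consists of it and any one of the
    parallel copies of the other diagonal.\<close>
  have pmZ: "{Q. perfect_matching G Q \<and> e \<in> Q} = (\<lambda>f. {e, f}) ` Y" if e: "e \<in> Z" for e
  proof
    show "(\<lambda>f. {e, f}) ` Y \<subseteq> {Q. perfect_matching G Q \<and> e \<in> Q}" using pm[OF e] by auto
    show "{Q. perfect_matching G Q \<and> e \<in> Q} \<subseteq> (\<lambda>f. {e, f}) ` Y"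
    proof clarify
      fix Q assume Q: "perfect_matching G Q" "e \<in> Q"
      have ee: "ends G e = {c 0, c 2}" using e by (simp add: Z_def)
      define f where "f = medge G Q (c 1)"
      have f: "f \<in> Q" "c 1 \<in> ends G f" "f \<in> edges G"
        using medge[OF Q(1) c_in[of 1]] pm_subset[OF Q(1)] n unfolding f_def by auto
      have "f \<noteq> e"
      proof
        assume "f = e"
        then have "c 1 \<in> {c 0, c 2}" using f(2) ee by simp
        then show False using ceq by simp
      qed
      moreover have "c 0 \<in> verts G" "c 2 \<in> verts G" using c_in n by simp_all
      ultimately have "ends G f \<inter> {c 0, c 2} = {}" using pm_unique[OF Q(1) _ f(1) Q(2)] ee by blast
      moreover have "ends G f \<subseteq> verts G" "card (ends G f) = 2" using G f(3) by (auto simp: finite_loopless_graph_def)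
      ultimately have sub: "ends G f \<subseteq> {c 1, c 3}" using V by blast
      have "ends G f = {c 1, c 3}"
        by (rule card_subset_eq[OF _ sub]) (use \<open>card (ends G f) = 2\<close> ceq in auto)
      then have fY: "f \<in> Y" using diag[OF f(3)] by (auto simp: Y_def)
      have "{e, f} = Q" using pm_eqI[OF G pm[OF e fY] Q(1)] f(1) Q(2) by blast
      then show "Q \<in> (\<lambda>f. {e, f}) ` Y" using fY by blast
    qed
  qed
  have pmY: "{Q. perfect_matching G Q \<and> f \<in> Q} = (\<lambda>e. {e, f}) ` Z" if f: "f \<in> Y" for f
  proof
    show "(\<lambda>e. {e, f}) ` Z \<subseteq> {Q. perfect_matching G Q \<and> f \<in> Q}" using pm f by auto
    show "{Q. perfect_matching G Q \<and> f \<in> Q} \<subseteq> (\<lambda>e. {e, f}) ` Z"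
    proof clarify
      fix Q assume Q: "perfect_matching G Q" "f \<in> Q"
      have ff: "ends G f = {c 1, c 3}" using f by (simp add: Y_def)
      define e where "e = medge G Q (c 0)"
      have e: "e \<in> Q" "c 0 \<in> ends G e" "e \<in> edges G"
        using medge[OF Q(1) c_in[of 0]] pm_subset[OF Q(1)] n unfolding e_def by auto
      have "e \<noteq> f"
      proof
        assume "e = f"
        then have "c 0 \<in> {c 1, c 3}" using e(2) ff by simp
        then show False using ceq by simp
      qed
      moreover have "c 1 \<in> verts G" "c 3 \<in> verts G" using c_in n by simp_all
      ultimately have "ends G e \<inter> {c 1, c 3} = {}" using pm_unique[OF Q(1) _ e(1) Q(2)] ff by blast
      moreover have "ends G e \<subseteq> verts G" "card (ends G e) = 2" using G e(3) by (auto simp: finite_loopless_graph_def)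
      ultimately have sub: "ends G e \<subseteq> {c 0, c 2}" using V by blast
      have "ends G e = {c 0, c 2}"
        by (rule card_subset_eq[OF _ sub]) (use \<open>card (ends G e) = 2\<close> ceq in auto)
      then have eZ: "e \<in> Z" using diag[OF e(3)] by (auto simp: Z_def)
      have "{e, f} = Q" using pm_eqI[OF G pm[OF eZ f] Q(1)] e(1) Q(2) by blast
      then show "Q \<in> (\<lambda>e. {e, f}) ` Z" using eZ by blast
    qed
  qed
  have pZ: "pcount G e = card Y" if "e \<in> Z" for e
  proof -
    have "inj_on (\<lambda>f. {e, f}) Y" by (rule inj_onI) (auto simp: doubleton_eq_iff)
    then show ?thesis unfolding pcount_def pmZ[OF that] by (rule card_image)
  qed
  have pY: "pcount G f = card Z" if "f \<in> Y" for f
  proof -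
    have "inj_on (\<lambda>e. {e, f}) Z" by (rule inj_onI) (auto simp: doubleton_eq_iff)
    then show ?thesis unfolding pcount_def pmY[OF that] by (rule card_image)
  qed
  define k where "k = degree G - 2"
  have "Z \<noteq> {}" using Zc deg by auto
  then obtain z where z: "z \<in> Z" by blast
  then have "pcount G z = 1 \<or> pcount G z = 2" using B by (auto simp: balanced_def Z_def)
  \<comment> \<open>A copy of one diagonal is completed by each of the \<open>k\<close> copies of
    the other, so it lies in \<open>k\<close> perfect matchings. The bound 2 on this number is what
    limits the degree to 4.\<close>
  then have k12: "k = 1 \<or> k = 2" using pZ[OF z] Yc k_def by simp
  show ?thesis
  proof (rule that[of c k Z Y])
    show "ham_cycle G M N c 4" using \<open>ham_cycle G M N c n\<close> n by simp
    show "edges G = M \<union> N \<union> Z \<union> Y" using ZY pm_subset[OF M] pm_subset[OF N] by (auto simp: Z_def Y_def)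
    show "(M \<union> N) \<inter> (Z \<union> Y) = {}" by (auto simp: Z_def Y_def)
  qed (use c0 k_def k12 pZ pY Zc Yc in \<open>auto simp: Z_def Y_def\<close>)
qed

subsection \<open>Isomorphisms and graphs given by lists\<close>

text \<open>The maps are kept explicit: in an iterated triangle replacement the image of the next
  vertex to be replaced has to be known, and new vertices are named after edges, so the edge map
  acts on vertices too.\<close>

definition iso_via :: "('v \<Rightarrow> 'w) \<Rightarrow> ('e \<Rightarrow> 'f) \<Rightarrow> ('v, 'e) multigraph \<Rightarrow> ('w, 'f) multigraph \<Rightarrow> bool" where
  "iso_via f g G H \<longleftrightarrow> bij_betw f (verts G) (verts H) \<and> bij_betw g (edges G) (edges H) \<and>
     (\<forall>e \<in> edges G. ends H (g e) = f ` ends G e)"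

lemma graph_iso_via: "graph_iso G H \<longleftrightarrow> (\<exists>f g. iso_via f g G H)"
  by (simp add: graph_iso_def iso_via_def)

text \<open>All that is needed to carry incidences along a bijection of the vertices. It holds for
  every list graph and survives triangle replacement.\<close>

definition wf_graph :: "('v, 'e) multigraph \<Rightarrow> bool" where
  "wf_graph G \<longleftrightarrow> (\<forall>e \<in> edges G. ends G e \<subseteq> verts G)"

lemma wf_graph_finite: "finite_loopless_graph G \<Longrightarrow> wf_graph G"
  by (simp add: wf_graph_def finite_loopless_graph_def)

lemma iso_via_sym:
  assumes "iso_via f g G H" "wf_graph G"
  shows "iso_via (inv_into (verts G) f) (inv_into (edges G) g) H G"
proof -
  have f: "bij_betw f (verts G) (verts H)" and g: "bij_betw g (edges G) (edges H)"
    and e: "\<And>e. e \<in> edges G \<Longrightarrow> ends H (g e) = f ` ends G e" using assms by (auto simp: iso_via_def)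
  have "ends G (inv_into (edges G) g e') = inv_into (verts G) f ` ends H e'" if e': "e' \<in> edges H" for e'
  proof -
    obtain d where d: "d \<in> edges G" "e' = g d" using g e' by (auto simp: bij_betw_def)
    have "inv_into (edges G) g e' = d" using g d by (simp add: bij_betw_def)
    moreover have "inv_into (verts G) f ` f ` ends G d = ends G d"
      using f d(1) assms(2) by (intro inv_into_image_cancel) (auto simp: bij_betw_def wf_graph_def)
    ultimately show ?thesis using e[OF d(1)] d(2) by simp
  qed
  then show ?thesis using f g by (simp add: iso_via_def bij_betw_inv_into)
qed

lemma iso_via_trans:
  assumes "iso_via f g G H" "iso_via f' g' H K"
  shows "iso_via (f' \<circ> f) (g' \<circ> g) G K"
proof -
  have "g e \<in> edges H" if "e \<in> edges G" for e using assms(1) that by (auto simp: iso_via_def bij_betw_def)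
  then show ?thesis using assms by (auto simp: iso_via_def image_comp intro: bij_betw_trans)
qed

lemma graph_iso_trans: "graph_iso G H \<Longrightarrow> graph_iso H K \<Longrightarrow> graph_iso G K"
  unfolding graph_iso_via using iso_via_trans by blast

lemma graph_iso_sym: "graph_iso G H \<Longrightarrow> wf_graph G \<Longrightarrow> graph_iso H G"
  unfolding graph_iso_via using iso_via_sym by blast

lemma iso_via_ends:
  assumes "iso_via f g G H" "wf_graph G" "e \<in> edges G" "v \<in> verts G"
  shows "f v \<in> ends H (g e) \<longleftrightarrow> v \<in> ends G e"
proof -
  have "inj_on f (verts G)" "ends G e \<subseteq> verts G" using assms by (auto simp: iso_via_def bij_betw_def wf_graph_def)
  then have "f v \<in> f ` ends G e \<longleftrightarrow> v \<in> ends G e" using assms(4) by (metis inj_on_image_mem_iff)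
  then show ?thesis using assms by (simp add: iso_via_def)
qed

lemma iso_via_pm:
  assumes iso: "iso_via f g G H" and wf: "wf_graph G" and M: "M \<subseteq> edges G"
  shows "perfect_matching H (g ` M) \<longleftrightarrow> perfect_matching G M"
proof -
  have injg: "inj_on g (edges G)" and gE: "g ` edges G = edges H" and fV: "verts H = f ` verts G"
    using iso by (auto simp: iso_via_def bij_betw_def)
  have "(\<exists>!e'. e' \<in> g ` M \<and> f v \<in> ends H e') \<longleftrightarrow> (\<exists>!e. e \<in> M \<and> v \<in> ends G e)" if v: "v \<in> verts G" for v
  proof -
    have eq: "f v \<in> ends H (g e) \<longleftrightarrow> v \<in> ends G e" if "e \<in> M" for e
      using iso_via_ends[OF iso wf _ v] that M by blast
    have inj: "e = d" if "g e = g d" "e \<in> M" "d \<in> M" for e d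
      using injg that M by (auto simp: inj_on_def)
    show ?thesis
    proof
      assume "\<exists>!e'. e' \<in> g ` M \<and> f v \<in> ends H e'"
      then obtain e' where e': "e' \<in> g ` M" "f v \<in> ends H e'" "\<And>d'. d' \<in> g ` M \<Longrightarrow> f v \<in> ends H d' \<Longrightarrow> d' = e'" by blast
      then obtain e where e: "e \<in> M" "e' = g e" by blast
      show "\<exists>!e. e \<in> M \<and> v \<in> ends G e"
      proof (rule ex1I[of _ e])
        show "e \<in> M \<and> v \<in> ends G e" using e e' eq by blast
        show "d = e" if "d \<in> M \<and> v \<in> ends G d" for d
          using e'(3)[of "g d"] that eq e inj by blast
      qed
    next
      assume "\<exists>!e. e \<in> M \<and> v \<in> ends G e"
      then obtain e where e: "e \<in> M" "v \<in> ends G e" "\<And>d. d \<in> M \<Longrightarrow> v \<in> ends G d \<Longrightarrow> d = e" by blast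
      show "\<exists>!e'. e' \<in> g ` M \<and> f v \<in> ends H e'"
      proof (rule ex1I[of _ "g e"])
        show "g e \<in> g ` M \<and> f v \<in> ends H (g e)" using e eq by blast
        show "d' = g e" if "d' \<in> g ` M \<and> f v \<in> ends H d'" for d'
          using that eq e(3) by blast
      qed
    qed
  qed
  moreover have "g ` M \<subseteq> edges H" using M gE by blast
  ultimately show ?thesis using M fV by (simp add: perfect_matching_def)
qed

lemma iso_via_pcount:
  assumes iso: "iso_via f g G H" and wf: "wf_graph G" and e: "e \<in> edges G"
  shows "pcount H (g e) = pcount G e"
proof -
  have injg: "inj_on g (edges G)" and gE: "g ` edges G = edges H"
    using iso by (auto simp: iso_via_def bij_betw_def)
  have "{M. perfect_matching H M \<and> g e \<in> M} = (`) g ` {M. perfect_matching G M \<and> e \<in> M}"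
  proof
    show "(`) g ` {M. perfect_matching G M \<and> e \<in> M} \<subseteq> {M. perfect_matching H M \<and> g e \<in> M}"
      using iso_via_pm[OF iso wf pm_subset] by blast
    show "{M. perfect_matching H M \<and> g e \<in> M} \<subseteq> (`) g ` {M. perfect_matching G M \<and> e \<in> M}"
    proof clarify
      fix M assume M: "perfect_matching H M" "g e \<in> M"
      define N where "N = {d \<in> edges G. g d \<in> M}"
      have N: "g ` N = M" "N \<subseteq> edges G" using pm_subset[OF M(1)] gE by (auto simp: N_def)
      moreover have "e \<in> N" using e M(2) by (simp add: N_def)
      ultimately show "M \<in> (`) g ` {M. perfect_matching G M \<and> e \<in> M}"
        using iso_via_pm[OF iso wf N(2)] M(1) by blast
    qed
  qed
  moreover have "inj_on ((`) g) {M. perfect_matching G M \<and> e \<in> M}"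
    by (rule inj_onI) (use inj_on_image_eq_iff[OF injg pm_subset pm_subset] in blast)
  ultimately show ?thesis by (simp add: pcount_def card_image)
qed

lemma iso_via_balanced:
  assumes iso: "iso_via f g G H" and G: "finite_loopless_graph G" and B: "balanced H"
  shows "balanced G"
proof -
  have wf: "wf_graph G" using wf_graph_finite[OF G] .
  have gE: "g ` edges G = edges H" and fV: "verts H = f ` verts G"
    using iso by (auto simp: iso_via_def bij_betw_def)
  obtain M where M: "perfect_matching H M" using B by (auto simp: balanced_def)
  define N where "N = {d \<in> edges G. g d \<in> M}"
  have N: "g ` N = M" "N \<subseteq> edges G" using pm_subset[OF M(1)] gE by (auto simp: N_def)
  have 1: "perfect_matching G N" using iso_via_pm[OF iso wf N(2)] M N(1) by simp
  have 2: "verts G \<noteq> {}" using B fV by (auto simp: balanced_def)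
  have 3: "pcount G e = 1 \<or> pcount G e = 2" if "e \<in> edges G" for e
  proof -
    have "g e \<in> edges H" using that gE by blast
    then show ?thesis using B iso_via_pcount[OF iso wf that] unfolding balanced_def by metis
  qed
  have 4: "pcount G e = pcount G d" if "perfect_matching G P" "e \<in> P" "d \<in> P" for P e d
  proof -
    have P: "P \<subseteq> edges G" using pm_subset that(1) .
    then have "perfect_matching H (g ` P)" using iso_via_pm[OF iso wf] that(1) by blast
    then have "pcount H (g e) = pcount H (g d)" using B that(2,3) unfolding balanced_def by blast
    moreover have "pcount H (g e) = pcount G e" "pcount H (g d) = pcount G d"
      using iso_via_pcount[OF iso wf] P that(2,3) by blast+
    ultimately show ?thesis by simp
  qed
  show ?thesis using G 1 2 3 4 unfolding balanced_def by blast
qed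

lemma graph_iso_balanced: "graph_iso G H \<Longrightarrow> finite_loopless_graph G \<Longrightarrow> balanced H \<Longrightarrow> balanced G"
  unfolding graph_iso_via using iso_via_balanced by blast

section \<open>List graphs and a test for isomorphism by evaluation\<close>

lemma list_graph_simps:
  "verts (graph_of_list L) = fst ` set L \<union> snd ` set L" "edges (graph_of_list L) = {..<length L}"
  "ends (graph_of_list L) i = {fst (L ! i), snd (L ! i)}"
  by (simp_all add: graph_of_list_def)

lemma wf_graph_of_list: "wf_graph (graph_of_list L)"
  by (auto simp: wf_graph_def list_graph_simps)

lemma finite_graph_of_list:
  assumes "\<forall>(a, b)\<in>set L. a \<noteq> b"
  shows "finite_loopless_graph (graph_of_list L)"
proof -
  have "card {fst (L ! i), snd (L ! i)} = 2" if "i < length L" for i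
    using bspec[OF assms nth_mem[OF that]] by (auto simp: case_prod_beta)
  then show ?thesis by (auto simp: finite_loopless_graph_def list_graph_simps)
qed

lemma iso_listI:
  assumes es: "distinct es" "set es = edges G" "length es = length L"
    and c: "bij_betw c (fst ` set L \<union> snd ` set L) (verts G)"
    and ends: "\<And>i. i < length L \<Longrightarrow> ends G (es ! i) = {c (fst (L ! i)), c (snd (L ! i))}"
  shows "graph_iso G (graph_of_list L)"
proof -
  have "bij_betw ((!) es) {..<length L} (edges G)"
    using bij_betw_nth[OF es(1) _ es(2)[symmetric], of "{..<length L}"] es(3) by simp
  then have "iso_via c ((!) es) (graph_of_list L) G"
    using c ends by (simp add: iso_via_def list_graph_simps)
  then show ?thesis using graph_iso_sym[OF _ wf_graph_of_list] graph_iso_via by blast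
qed

text \<open>Only the vertex map \<open>m\<close> has to be supplied. After renaming, edges are
  sorted pairs, so equality of multisets compares unordered edges with multiplicity. Counting the
  pairs that occur in either list suffices for this equality and can be evaluated.\<close>

definition iso_list_check :: "(nat \<times> nat) list \<Rightarrow> (nat \<times> nat) list \<Rightarrow> (nat \<times> nat) list \<Rightarrow> bool" where
  "iso_list_check m L L' \<longleftrightarrow>
     (let f = (\<lambda>x. the (map_of m x)); vs = remdups (map fst L @ map snd L);
          A = map (\<lambda>(a, b). (min (f a) (f b), max (f a) (f b))) L;
          B = map (\<lambda>(a, b). (min a b, max a b)) L'
      in distinct (map f vs) \<and> (\<forall>x\<in>set (A @ B). count_list A x = count_list B x))"

lemma iso_list_check:
  assumes "iso_list_check m L L'"
  shows "graph_iso (graph_of_list L) (graph_of_list L')"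
proof -
  define f where "f = (\<lambda>x. the (map_of m x))"
  define A where "A = map (\<lambda>(a, b). (min (f a) (f b), max (f a) (f b))) L"
  define B where "B = map (\<lambda>(a, b). (min a b, max a b)) L'"
  have chk: "distinct (map f (remdups (map fst L @ map snd L)))"
    "\<forall>x\<in>set (A @ B). count_list A x = count_list B x"
    using assms unfolding iso_list_check_def Let_def f_def A_def B_def by blast+
  have inj: "inj_on f (verts (graph_of_list L))" using chk(1) by (simp add: distinct_map list_graph_simps)
  have "count_list A x = count_list B x" for x
    using chk(2) by (cases "x \<in> set (A @ B)") (auto simp: count_notin)
  \<comment> \<open>Equal multisets differ by a permutation of positions, and this permutation is
    the edge map.\<close>
  then have "mset A = mset B" by (intro multiset_eqI) (simp add: count_mset)
  then obtain p where p: "p permutes {..<length B}" "permute_list p B = A"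
    by (rule mset_eq_permutation)
  have len: "length A = length B" using p(2) by (metis length_permute_list)
  then have len': "length L = length L'" by (simp add: A_def B_def)
  have AB: "A ! i = B ! p i" if "i < length L" for i
  proof -
    have "i < length B" using that len by (simp add: A_def)
    then show ?thesis using permute_list_nth[OF p(1)] p(2) by simp
  qed
  have pl: "p i < length L" if "i < length L" for i
    using permutes_in_image[OF p(1), of i] that len' by (simp add: B_def)
  have ends: "ends (graph_of_list L') (p i) = f ` ends (graph_of_list L) i" if i: "i < length L" for i
  proof -
    have mm: "{min x y, max x y} = {x, y}" for x y :: nat by (auto simp: min_def max_def)
    have "A ! i = (min (f (fst (L ! i))) (f (snd (L ! i))), max (f (fst (L ! i))) (f (snd (L ! i))))"
      using i by (simp add: A_def case_prod_beta)
    moreover have "B ! p i = (min (fst (L' ! p i)) (snd (L' ! p i)), max (fst (L' ! p i)) (snd (L' ! p i)))"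
      using pl[OF i] len' by (simp add: B_def case_prod_beta)
    ultimately have "min (f (fst (L ! i))) (f (snd (L ! i))) = min (fst (L' ! p i)) (snd (L' ! p i))"
      "max (f (fst (L ! i))) (f (snd (L ! i))) = max (fst (L' ! p i)) (snd (L' ! p i))"
      using AB[OF i] by simp_all
    then have "{f (fst (L ! i)), f (snd (L ! i))} = {fst (L' ! p i), snd (L' ! p i)}"
      using mm[of "f (fst (L ! i))" "f (snd (L ! i))"] mm[of "fst (L' ! p i)" "snd (L' ! p i)"] by simp
    then show ?thesis by (simp add: list_graph_simps)
  qed
  have bp: "bij_betw p {..<length L} {..<length L'}"
    using permutes_imp_bij[OF p(1)] len' by (simp add: B_def)
  have vert: "verts (graph_of_list K) = (\<Union>i<length K. ends (graph_of_list K) i)" for K :: "(nat \<times> nat) list"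
  proof -
    have "set K = (!) K ` {..<length K}" by (auto simp: set_conv_nth)
    then have "verts (graph_of_list K) = fst ` (!) K ` {..<length K} \<union> snd ` (!) K ` {..<length K}"
      by (simp only: list_graph_simps)
    then show ?thesis by (auto simp: list_graph_simps)
  qed
  have "f ` verts (graph_of_list L) = (\<Union>i<length L. ends (graph_of_list L') (p i))"
    using ends unfolding vert by (simp add: image_UN)
  also have "\<dots> = (\<Union>i\<in>p ` {..<length L}. ends (graph_of_list L') i)" by simp
  also have "\<dots> = verts (graph_of_list L')" unfolding vert using bp by (simp add: bij_betw_def)
  finally have "iso_via f p (graph_of_list L) (graph_of_list L')"
    using inj bp ends unfolding iso_via_def bij_betw_def by (simp add: list_graph_simps(2))
  then show ?thesis unfolding graph_iso_via by blast
qed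

section \<open>Enumeration of the perfect matchings of a list graph\<close>

text \<open>The first argument lists the edges, each preceded by its name.\<close>

function pm_list :: "(nat \<times> nat \<times> nat) list \<Rightarrow> nat list \<Rightarrow> nat list list" where
  "pm_list D [] = [[]]"
| "pm_list D (v # vs) = concat (map (\<lambda>(i, a, b).
     if (a = v \<or> b = v) \<and> (if a = v then b else a) \<in> set vs
     then map ((#) i) (pm_list D (remove1 (if a = v then b else a) vs)) else []) D)"
  by pat_completeness auto
termination
  by (relation "measure (\<lambda>(D, vs). length vs)") (auto simp: length_remove1)

text \<open>Perfect matchings of the subgraph induced by \<open>W\<close>, stated over index sets so
  that the recursion on the list of unmatched vertices can be followed.\<close>

definition pm_on :: "(nat \<times> nat) list \<Rightarrow> nat set \<Rightarrow> nat set \<Rightarrow> bool" where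
  "pm_on L W M \<longleftrightarrow> M \<subseteq> {..<length L} \<and> (\<forall>i\<in>M. fst (L ! i) \<in> W \<and> snd (L ! i) \<in> W) \<and>
     (\<forall>v\<in>W. \<exists>!i. i \<in> M \<and> (v = fst (L ! i) \<or> v = snd (L ! i)))"

text \<open>The first vertex is matched by exactly one edge; deleting both ends of that edge leaves
  a perfect matching of the remaining vertices, and conversely.\<close>

lemma pm_list:
  assumes L: "\<forall>(a, b)\<in>set L. a \<noteq> b"
  shows "distinct vs \<Longrightarrow> set ` set (pm_list (zip [0..<length L] L) vs) = {M. pm_on L (set vs) M}"
proof (induction "length vs" arbitrary: vs rule: less_induct)
  case less
  show ?case
  proof (cases vs)
    case Nil
    then show ?thesis by (auto simp: pm_on_def)
  next
    case (Cons v us)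
    define other where "other = (\<lambda>i. if fst (L ! i) = v then snd (L ! i) else fst (L ! i))"
    define W where "W = (\<lambda>i. set us - {other i})"
    have ne: "fst (L ! i) \<noteq> snd (L ! i)" if "i < length L" for i
      using bspec[OF L nth_mem[OF that]] by (simp add: case_prod_beta)
    have v: "v \<notin> set us" "distinct us" using less.prems Cons by auto
    have IH: "set ` set (pm_list (zip [0..<length L] L) (remove1 w us)) = {M. pm_on L (set us - {w}) M}" for w
    proof -
      have "length (remove1 w us) < length vs" using Cons by (simp add: length_remove1 less_Suc_eq_le)
      from less.hyps[OF this] show ?thesis using v by (simp add: set_remove1_eq)
    qed
    have "set ` set (pm_list (zip [0..<length L] L) vs) =
      (\<Union>i\<in>{i. i < length L \<and> (fst (L ! i) = v \<or> snd (L ! i) = v) \<and> other i \<in> set us}.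
         insert i ` set ` set (pm_list (zip [0..<length L] L) (remove1 (other i) us)))"
    proof -
      have z: "set (zip [0..<length L] L) = (\<lambda>i. (i, fst (L ! i), snd (L ! i))) ` {..<length L}"
        by (force simp: set_zip)
      define A where "A = (\<lambda>i. (#) i ` set (pm_list (zip [0..<length L] L) (remove1 (other i) us)))"
      define F where "F = (\<lambda>(i, a, b). if (a = v \<or> b = v) \<and> (if a = v then b else a) \<in> set us
        then map ((#) i) (pm_list (zip [0..<length L] L) (remove1 (if a = v then b else a) us)) else [])"
      have "set (pm_list (zip [0..<length L] L) vs) = (\<Union>x\<in>set (zip [0..<length L] L). set (F x))"
        unfolding Cons pm_list.simps F_def[symmetric] by simp
      also have "\<dots> = (\<Union>i<length L. set (F (i, fst (L ! i), snd (L ! i))))" unfolding z by simp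
      also have "\<dots> = (\<Union>i<length L. if (fst (L ! i) = v \<or> snd (L ! i) = v) \<and> other i \<in> set us then A i else {})"
        by (simp only: F_def A_def other_def prod.case if_distrib[of set] set_map set_simps)
      also have "\<dots> = (\<Union>i\<in>{i. i < length L \<and> (fst (L ! i) = v \<or> snd (L ! i) = v) \<and> other i \<in> set us}. A i)"
        by (auto split: if_splits)
      finally show ?thesis by (simp add: A_def image_UN image_image)
    qed
    also have "\<dots> = {M. pm_on L (set vs) M}" unfolding IH
    proof (intro equalityI subsetI)
      fix M assume "M \<in> (\<Union>i\<in>{i. i < length L \<and> (fst (L ! i) = v \<or> snd (L ! i) = v) \<and> other i \<in> set us}.
         insert i ` {M. pm_on L (set us - {other i}) M})"
      then obtain i N where i: "i < length L" "fst (L ! i) = v \<or> snd (L ! i) = v" "other i \<in> set us"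
        and N: "pm_on L (W i) N" "M = insert i N" by (auto simp: W_def)
      have e: "{fst (L ! i), snd (L ! i)} = {v, other i}" "other i \<noteq> v" using i(2,3) v by (auto simp: other_def)
      have vs: "set vs = insert v (insert (other i) (W i))" "v \<notin> W i" "other i \<notin> W i"
        using i(3) v Cons by (auto simp: W_def)
      have iN: "\<not> (x = fst (L ! j) \<or> x = snd (L ! j))" if "j \<in> N" "x \<in> {v, other i}" for j x
        using N(1) that vs(2,3) by (auto simp: pm_on_def)
      have ex: "\<exists>!j. j \<in> M \<and> (x = fst (L ! j) \<or> x = snd (L ! j))" if x: "x \<in> set vs" for x
      proof (cases "x \<in> W i")
        case True
        then have "\<exists>!j. j \<in> N \<and> (x = fst (L ! j) \<or> x = snd (L ! j))" using N(1) by (simp add: pm_on_def)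
        moreover have "x \<notin> {fst (L ! i), snd (L ! i)}" unfolding e(1) using True vs(2,3) by auto
        then have "\<not> (x = fst (L ! i) \<or> x = snd (L ! i))" by simp
        ultimately show ?thesis unfolding N(2) by blast
      next
        case False
        then have "x \<in> {v, other i}" using x vs(1) by blast
        moreover from this have "x = fst (L ! i) \<or> x = snd (L ! i)" using e(1) by blast
        ultimately show ?thesis unfolding N(2) using iN by blast
      qed
      have "fst (L ! i) \<in> set vs \<and> snd (L ! i) \<in> set vs" using e(1) vs(1) by blast
      moreover have "\<forall>j\<in>N. fst (L ! j) \<in> set vs \<and> snd (L ! j) \<in> set vs" "N \<subseteq> {..<length L}"
        using N(1) vs(1) by (auto simp: pm_on_def)
      ultimately show "M \<in> {M. pm_on L (set vs) M}" using ex i(1) N(2) by (simp add: pm_on_def)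
    next
      fix M assume "M \<in> {M. pm_on L (set vs) M}"
      then have M: "M \<subseteq> {..<length L}" "\<forall>i\<in>M. fst (L ! i) \<in> set vs \<and> snd (L ! i) \<in> set vs"
        "\<And>x. x \<in> set vs \<Longrightarrow> \<exists>!i. i \<in> M \<and> (x = fst (L ! i) \<or> x = snd (L ! i))" by (auto simp: pm_on_def)
      obtain i where i: "i \<in> M" "v = fst (L ! i) \<or> v = snd (L ! i)" using M(3)[of v] Cons by auto
      have il: "i < length L" using i M(1) by auto
      have o: "other i \<in> set us" using i M(2) ne[OF il] Cons by (auto simp: other_def)
      have e: "{fst (L ! i), snd (L ! i)} = {v, other i}" using i(2) by (auto simp: other_def)
      have vs: "set vs = insert v (insert (other i) (W i))" "v \<notin> W i" "other i \<notin> W i"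
        using o v Cons by (auto simp: W_def)
      have u: "j = i" if "j \<in> M" "x \<in> {v, other i}" "x = fst (L ! j) \<or> x = snd (L ! j)" for j x
      proof -
        have "x \<in> set vs" "x = fst (L ! i) \<or> x = snd (L ! i)" using that(2) vs(1) e by blast+
        then show ?thesis using M(3)[of x] that i(1) by blast
      qed
      have "pm_on L (W i) (M - {i})" unfolding pm_on_def
      proof (intro conjI ballI)
        show "M - {i} \<subseteq> {..<length L}" using M(1) by blast
        fix j assume j: "j \<in> M - {i}"
        then have "fst (L ! j) \<in> set vs" "snd (L ! j) \<in> set vs" using M(2) by auto
        moreover have "fst (L ! j) \<notin> {v, other i}" "snd (L ! j) \<notin> {v, other i}" using u j by blast+
        ultimately show "fst (L ! j) \<in> W i" "snd (L ! j) \<in> W i" using vs(1) by auto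
      next
        fix x assume x: "x \<in> W i"
        then have "x \<notin> {fst (L ! i), snd (L ! i)}" unfolding e using vs(2,3) by auto
        then have "x \<noteq> fst (L ! i) \<and> x \<noteq> snd (L ! i)" by simp
        moreover have "\<exists>!j. j \<in> M \<and> (x = fst (L ! j) \<or> x = snd (L ! j))" using M(3)[of x] x vs(1) by blast
        ultimately show "\<exists>!j. j \<in> M - {i} \<and> (x = fst (L ! j) \<or> x = snd (L ! j))" by blast
      qed
      moreover have "M = insert i (M - {i})" using i(1) by blast
      ultimately show "M \<in> (\<Union>i\<in>{i. i < length L \<and> (fst (L ! i) = v \<or> snd (L ! i) = v) \<and> other i \<in> set us}.
         insert i ` {M. pm_on L (set us - {other i}) M})"
        using il i(2) o unfolding W_def by blast
    qed
    finally show ?thesis .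
  qed
qed

text \<open>Each index list is replaced by its characteristic vector, a canonical representative of
  the set, so that counting distinct vectors counts perfect matchings. The entry
  \<open>cnt ! i\<close> is the number of those through edge \<open>i\<close>.\<close>

definition balanced_list :: "(nat \<times> nat) list \<Rightarrow> bool" where
  "balanced_list L \<longleftrightarrow>
     (let P = pm_list (zip [0..<length L] L) (remdups (map fst L @ map snd L));
          cnt = map (\<lambda>i. length (remdups (map (\<lambda>p. map (\<lambda>j. j \<in> set p) [0..<length L])
                  (filter (\<lambda>p. i \<in> set p) P)))) [0..<length L]
      in L \<noteq> [] \<and> P \<noteq> [] \<and> (\<forall>k\<in>set cnt. k = 1 \<or> k = 2) \<and>
         (\<forall>p\<in>set P. \<forall>i\<in>set p. \<forall>j\<in>set p. cnt ! i = cnt ! j))"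

lemma balanced_list:
  assumes L: "\<forall>(a, b)\<in>set L. a \<noteq> b"
  shows "balanced (graph_of_list L) \<longleftrightarrow> balanced_list L"
proof -
  let ?G = "graph_of_list L"
  define vs where "vs = remdups (map fst L @ map snd L)"
  define P where "P = pm_list (zip [0..<length L] L) vs"
  define cnt where "cnt = map (\<lambda>i. length (remdups (map (\<lambda>p. map (\<lambda>j. j \<in> set p) [0..<length L])
                  (filter (\<lambda>p. i \<in> set p) P)))) [0..<length L]"
  have vs: "distinct vs" "set vs = verts ?G" by (auto simp: vs_def list_graph_simps)
  have pm: "perfect_matching ?G M \<longleftrightarrow> pm_on L (set vs) M" for M
    unfolding perfect_matching_def pm_on_def list_graph_simps vs(2)
    by (auto simp: subset_iff)
  have PM: "{M. perfect_matching ?G M} = set ` set P"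
    using pm_list[OF L vs(1)] by (simp add: P_def pm)
  have cnt: "cnt ! i = pcount ?G i" if i: "i < length L" for i
  proof -
    define S where "S = set ` {p \<in> set P. i \<in> set p}"
    have "{M. perfect_matching ?G M \<and> i \<in> M} = S" using PM by (auto simp: S_def)
    moreover have "card S = card ((\<lambda>M. map (\<lambda>j. j \<in> M) [0..<length L]) ` S)"
    proof (rule card_image[symmetric], rule inj_onI)
      fix M N assume MN: "M \<in> S" "N \<in> S" "map (\<lambda>j. j \<in> M) [0..<length L] = map (\<lambda>j. j \<in> N) [0..<length L]"
      have "M \<in> {M. perfect_matching ?G M}" "N \<in> {M. perfect_matching ?G M}"
        using MN(1,2) unfolding S_def PM by blast+
      then have "M \<subseteq> {..<length L}" "N \<subseteq> {..<length L}" using pm_subset[of ?G] by (auto simp: list_graph_simps)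
      moreover have "j \<in> M \<longleftrightarrow> j \<in> N" if "j < length L" for j
      proof -
        have "map (\<lambda>j. j \<in> M) [0..<length L] ! j = map (\<lambda>j. j \<in> N) [0..<length L] ! j" by (simp only: MN(3))
        then show ?thesis using that by simp
      qed
      ultimately show "M = N" by blast
    qed
    moreover have "(\<lambda>M. map (\<lambda>j. j \<in> M) [0..<length L]) ` S =
      set (map (\<lambda>p. map (\<lambda>j. j \<in> set p) [0..<length L]) (filter (\<lambda>p. i \<in> set p) P))"
      by (auto simp: S_def)
    ultimately show ?thesis using i unfolding cnt_def pcount_def
      by (simp only: length_remdups_card_conv nth_map length_upt nth_upt) simp
  qed
  have len: "length cnt = length L" by (simp add: cnt_def)
  have "balanced_list L \<longleftrightarrow> L \<noteq> [] \<and> P \<noteq> [] \<and> (\<forall>k\<in>set cnt. k = 1 \<or> k = 2) \<and>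
         (\<forall>p\<in>set P. \<forall>i\<in>set p. \<forall>j\<in>set p. cnt ! i = cnt ! j)"
    unfolding balanced_list_def Let_def cnt_def P_def vs_def ..
  also have "\<dots> \<longleftrightarrow> balanced ?G"
  proof -
    have 1: "verts ?G \<noteq> {} \<longleftrightarrow> L \<noteq> []" by (simp add: list_graph_simps)
    have 2: "(\<exists>M. perfect_matching ?G M) \<longleftrightarrow> P \<noteq> []"
    proof -
      have "(\<exists>M. perfect_matching ?G M) \<longleftrightarrow> {M. perfect_matching ?G M} \<noteq> {}" by blast
      then show ?thesis unfolding PM by simp
    qed
    have 3: "(\<forall>k\<in>set cnt. k = 1 \<or> k = 2) \<longleftrightarrow> (\<forall>e\<in>edges ?G. pcount ?G e = 1 \<or> pcount ?G e = 2)"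
    proof -
      have "set cnt = (!) cnt ` {..<length L}" using len by (auto simp: set_conv_nth)
      also have "\<dots> = pcount ?G ` {..<length L}" using cnt by auto
      finally show ?thesis by (simp add: list_graph_simps)
    qed
    have "i < length L" if "p \<in> set P" "i \<in> set p" for p i
    proof -
      have "set p \<in> {M. perfect_matching ?G M}" using that(1) unfolding PM by blast
      then show ?thesis using pm_subset[of ?G] that(2) by (auto simp: list_graph_simps)
    qed
    then have 4: "(\<forall>p\<in>set P. \<forall>i\<in>set p. \<forall>j\<in>set p. cnt ! i = cnt ! j) \<longleftrightarrow>
        (\<forall>p\<in>set P. \<forall>i\<in>set p. \<forall>j\<in>set p. pcount ?G i = pcount ?G j)" using cnt by auto
    have 5: "(\<forall>p\<in>set P. \<forall>i\<in>set p. \<forall>j\<in>set p. pcount ?G i = pcount ?G j) \<longleftrightarrow>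
       (\<forall>M\<in>{M. perfect_matching ?G M}. \<forall>i\<in>M. \<forall>j\<in>M. pcount ?G i = pcount ?G j)" unfolding PM by simp
    show ?thesis unfolding balanced_def 1 2 3[symmetric] 4 5 using finite_graph_of_list[OF L] by auto
  qed
  finally show ?thesis by simp
qed

section \<open>Triangle replacement in isomorphic graphs and in list graphs\<close>

lemma tri_iso:
  assumes iso: "iso_via f g G H" and wf: "wf_graph G" and u: "u \<in> verts G"
  shows "iso_via (map_sum f g) (map_sum g g) (triangle_replacement G u) (triangle_replacement H (f u))"
proof -
  have f: "bij_betw f (verts G) (verts H)" and g: "bij_betw g (edges G) (edges H)"
    and e: "\<And>e. e \<in> edges G \<Longrightarrow> ends H (g e) = f ` ends G e" using iso by (auto simp: iso_via_def)
  have inc: "g ` incident_edges G u = incident_edges H (f u)"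
  proof -
    have "d \<in> g ` incident_edges G u" if d: "d \<in> edges H" "f u \<in> ends H d" for d
    proof -
      obtain d' where "d' \<in> edges G" "d = g d'" using d(1) g by (auto simp: bij_betw_def)
      then show ?thesis using iso_via_ends[OF iso wf _ u] d(2) by (auto simp: incident_edges_def)
    qed
    moreover have "g d \<in> incident_edges H (f u)" if "d \<in> incident_edges G u" for d
      using iso_via_ends[OF iso wf _ u] that g by (auto simp: incident_edges_def bij_betw_def)
    ultimately show ?thesis by (auto simp: incident_edges_def)
  qed
  have injf: "inj_on f (verts G)" and injg: "inj_on g (edges G)" using f g by (auto simp: bij_betw_def)
  have subI: "incident_edges G u \<subseteq> edges G" by (auto simp: incident_edges_def)
  have fu: "f ` (verts G - {u}) = verts H - {f u}" using f u by (auto simp: bij_betw_def inj_on_def)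
  let ?T = "triangle_replacement G u" and ?U = "triangle_replacement H (f u)"
  have T: "verts ?T = Inl ` (verts G - {u}) \<union> Inr ` incident_edges G u"
    "edges ?T = Inl ` edges G \<union> Inr ` incident_edges G u"
    "\<And>d. ends ?T (Inl d) = (if u \<in> ends G d then Inl ` (ends G d - {u}) \<union> {Inr d} else Inl ` ends G d)"
    "\<And>d. ends ?T (Inr d) = Inr ` (incident_edges G u - {d})"
    by (simp_all add: triangle_replacement_def)
  have U: "verts ?U = Inl ` (verts H - {f u}) \<union> Inr ` incident_edges H (f u)"
    "edges ?U = Inl ` edges H \<union> Inr ` incident_edges H (f u)"
    "\<And>d. ends ?U (Inl d) = (if f u \<in> ends H d then Inl ` (ends H d - {f u}) \<union> {Inr d} else Inl ` ends H d)"
    "\<And>d. ends ?U (Inr d) = Inr ` (incident_edges H (f u) - {d})"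
    by (simp_all add: triangle_replacement_def)
  have ms: "map_sum h k ` (Inl ` A \<union> Inr ` B) = Inl ` h ` A \<union> Inr ` k ` B"
    for h :: "'x \<Rightarrow> 'y" and k :: "'z \<Rightarrow> 'w" and A B
    by (simp add: image_Un image_image)
  have 1: "map_sum f g ` verts ?T = verts ?U" unfolding T U ms fu inc ..
  have gE: "g ` edges G = edges H" using g by (simp add: bij_betw_def)
  have 2: "map_sum g g ` edges ?T = edges ?U" unfolding T U ms gE inc ..
  have inj: "inj_on (map_sum h k) (Inl ` A \<union> Inr ` B)" if "inj_on h A" "inj_on k B"
    for h :: "'x \<Rightarrow> 'y" and k :: "'z \<Rightarrow> 'w" and A B
    by (rule inj_onI) (use that in \<open>auto dest: inj_onD\<close>)
  have 3: "inj_on (map_sum f g) (verts ?T)" unfolding T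
    by (rule inj) (use inj_on_subset[OF injf] inj_on_subset[OF injg subI] in auto)
  have 4: "inj_on (map_sum g g) (edges ?T)" unfolding T
    by (rule inj[OF injg inj_on_subset[OF injg subI]])
  have 5: "ends ?U (map_sum g g x) = map_sum f g ` ends ?T x" if x: "x \<in> edges ?T" for x
  proof (cases x)
    case (Inl d)
    then have d: "d \<in> edges G" using x T(2) by auto
    then have dv: "ends G d \<subseteq> verts G" using wf by (simp add: wf_graph_def)
    have fd: "f ` (ends G d - {u}) = f ` ends G d - {f u}"
      using inj_on_image_set_diff[OF injf, of "ends G d" "{u}"] dv u by auto
    have iff: "f u \<in> f ` ends G d \<longleftrightarrow> u \<in> ends G d" using iso_via_ends[OF iso wf d u] e[OF d] by simp
    show ?thesis unfolding Inl map_sum.simps T(3) U(3) e[OF d] iff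
      by (cases "u \<in> ends G d") (simp_all add: image_image fd[symmetric])
  next
    case (Inr d)
    then have d: "d \<in> incident_edges G u" using x T(2) by auto
    have gd: "g ` (incident_edges G u - {d}) = incident_edges H (f u) - {g d}"
      unfolding inc[symmetric] using inj_on_image_set_diff[OF injg, of "incident_edges G u" "{d}"] d subI by auto
    then show ?thesis unfolding Inr map_sum.simps T(4) U(4) by (simp add: image_image gd[symmetric])
  qed
  show ?thesis using 1 2 3 4 5 by (simp add: iso_via_def bij_betw_def)
qed

lemma wf_triangle_replacement:
  assumes "wf_graph G" shows "wf_graph (triangle_replacement G u)"
proof -
  have "ends (triangle_replacement G u) x \<subseteq> verts (triangle_replacement G u)"
    if x: "x \<in> edges (triangle_replacement G u)" for x
  proof (cases x)
    case (Inl e)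
    then have e: "e \<in> edges G" using x by (auto simp: triangle_replacement_def incident_edges_def)
    then have "ends G e \<subseteq> verts G" using assms by (simp add: wf_graph_def)
    then show ?thesis using Inl e
      by (cases "u \<in> ends G e") (auto simp: triangle_replacement_def incident_edges_def image_iff)
  qed (auto simp: triangle_replacement_def)
  then show ?thesis by (simp add: wf_graph_def)
qed

text \<open>The bound \<open>k\<close> exceeds all old vertices, so \<open>k + i\<close> is a fresh
  name for the triangle vertex on edge \<open>i\<close>. The appended pairs are the sides opposite
  to the vertices of \<open>I ! 0\<close>, \<open>I ! 1\<close> and \<open>I ! 2\<close>, in this
  order.\<close>

definition tri_list :: "(nat \<times> nat) list \<Rightarrow> nat \<Rightarrow> nat \<Rightarrow> (nat \<times> nat) list" where
  "tri_list L k u =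
     (let I = filter (\<lambda>i. u = fst (L ! i) \<or> u = snd (L ! i)) [0..<length L]
      in map (\<lambda>i. (if fst (L ! i) = u then k + i else fst (L ! i), if snd (L ! i) = u then k + i else snd (L ! i))) [0..<length L]
        @ [(k + I ! 1, k + I ! 2), (k + I ! 0, k + I ! 2), (k + I ! 0, k + I ! 1)])"

lemma tri_list:
  assumes L: "\<forall>(a, b)\<in>set L. a \<noteq> b \<and> a < k \<and> b < k"
    and I: "length (filter (\<lambda>i. u = fst (L ! i) \<or> u = snd (L ! i)) [0..<length L]) = 3"
  shows "\<exists>g. iso_via (case_sum id (\<lambda>i. k + i)) g (triangle_replacement (graph_of_list L) u) (graph_of_list (tri_list L k u))"
proof -
  define J where "J = filter (\<lambda>i. u = fst (L ! i) \<or> u = snd (L ! i)) [0..<length L]"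
  define a b c where "a = J ! 0" and "b = J ! 1" and "c = J ! 2"
  have "length J = 3" using I by (simp add: J_def)
  then have J: "J = [a, b, c]" by (auto simp: a_def b_def c_def numeral_eq_Suc length_Suc_conv)
  have Jd: "distinct J" "set J = {i. i < length L \<and> (u = fst (L ! i) \<or> u = snd (L ! i))}" by (auto simp: J_def)
  then have abc: "a \<noteq> b" "a \<noteq> c" "b \<noteq> c" "{i. i < length L \<and> (u = fst (L ! i) \<or> u = snd (L ! i))} = {a, b, c}"
    using J by auto
  have inc: "incident_edges (graph_of_list L) u = {a, b, c}"
    using abc(4) by (auto simp: incident_edges_def list_graph_simps)
  have len: "a < length L" "b < length L" "c < length L" using abc(4) by auto
  define T where "T = tri_list L k u"
  have T: "T = map (\<lambda>i. (if fst (L ! i) = u then k + i else fst (L ! i), if snd (L ! i) = u then k + i else snd (L ! i))) [0..<length L]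
        @ [(k + b, k + c), (k + a, k + c), (k + a, k + b)]"
    unfolding T_def tri_list_def J_def[symmetric] J by simp
  let ?R = "triangle_replacement (graph_of_list L) u" and ?n = "length L"
  let ?f = "case_sum id (\<lambda>i. k + i)"
  \<comment> \<open>Old edges keep their index; the side named after an edge goes to the appended
    position that holds the side opposite to it.\<close>
  define g where "g = (\<lambda>x. case x of Inl i \<Rightarrow> i | Inr i \<Rightarrow> if i = a then ?n else if i = b then ?n + 1 else ?n + 2)"
  have ne: "fst (L ! i) \<noteq> snd (L ! i)" "fst (L ! i) < k" "snd (L ! i) < k" if "i < ?n" for i
    using bspec[OF L nth_mem[OF that]] by (auto simp: case_prod_beta)
  have R: "verts ?R = Inl ` (verts (graph_of_list L) - {u}) \<union> Inr ` {a, b, c}"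
    "edges ?R = Inl ` {..<?n} \<union> Inr ` {a, b, c}"
    "\<And>d. ends ?R (Inl d) = (if u \<in> ends (graph_of_list L) d then Inl ` (ends (graph_of_list L) d - {u}) \<union> {Inr d}
        else Inl ` ends (graph_of_list L) d)"
    "\<And>d. ends ?R (Inr d) = Inr ` ({a, b, c} - {d})"
    by (simp_all add: triangle_replacement_def inc list_graph_simps(2))
  have lenT: "length T = ?n + 3" by (simp add: T)
  have gb: "bij_betw g (edges ?R) (edges (graph_of_list T))"
  proof -
    have "inj_on g (edges ?R)" unfolding R g_def using abc by (auto simp: inj_on_def split: if_splits)
    moreover have "g ` edges ?R = {..<?n} \<union> {?n, ?n + 1, ?n + 2}"
      unfolding R image_Un image_image using abc by (auto simp: g_def)
    moreover have "{..<?n} \<union> {?n, ?n + 1, ?n + 2} = {..<?n + 3}" by auto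
    ultimately show ?thesis by (simp add: bij_betw_def list_graph_simps lenT)
  qed
  have Tn: "T ! i = (if fst (L ! i) = u then k + i else fst (L ! i), if snd (L ! i) = u then k + i else snd (L ! i))"
    if "i < ?n" for i using that by (simp add: T nth_append)
  have T3: "T ! ?n = (k + b, k + c)" "T ! (?n + 1) = (k + a, k + c)" "T ! (?n + 2) = (k + a, k + b)"
    by (simp_all add: T nth_append)
  have ends: "ends (graph_of_list T) (g e) = ?f ` ends ?R e" if e: "e \<in> edges ?R" for e
  proof (cases e)
    case (Inl i)
    then have i: "i < ?n" using e by (auto simp: R)
    consider "u = fst (L ! i)" | "u = snd (L ! i)" | "u \<noteq> fst (L ! i)" "u \<noteq> snd (L ! i)" by blast
    then show ?thesis
      unfolding Inl R(3) list_graph_simps g_def sum.case Tn[OF i] fst_conv snd_conv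
      by cases (use ne(1)[OF i] in \<open>simp_all add: insert_Diff_if insert_commute\<close>)
  next
    case (Inr i)
    have "i = a \<or> i = b \<or> i = c" using Inr e by (auto simp: R)
    then have "(i = a \<and> {a, b, c} - {i} = {b, c}) \<or> (i = b \<and> {a, b, c} - {i} = {a, c}) \<or> (i = c \<and> {a, b, c} - {i} = {a, b})"
      using abc(1-3) by blast
    then show ?thesis
    proof (elim disjE conjE)
      assume i: "i = a" and d: "{a, b, c} - {i} = {b, c}"
      show ?thesis unfolding Inr R(4) list_graph_simps g_def sum.case d using i T3 by simp
    next
      assume i: "i = b" and d: "{a, b, c} - {i} = {a, c}"
      show ?thesis unfolding Inr R(4) list_graph_simps g_def sum.case d using i abc(1) T3 by simp
    next
      assume i: "i = c" and d: "{a, b, c} - {i} = {a, b}"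
      show ?thesis unfolding Inr R(4) list_graph_simps g_def sum.case d using i abc(2,3) T3 by simp
    qed
  qed
  have injf: "inj_on ?f (verts ?R)"
    unfolding R list_graph_simps using L by (auto simp: inj_on_def)
  have vert: "verts (graph_of_list K) = (\<Union>i\<in>edges (graph_of_list K). ends (graph_of_list K) i)" for K :: "(nat \<times> nat) list"
  proof -
    have "set K = (!) K ` {..<length K}" by (auto simp: set_conv_nth)
    then have "verts (graph_of_list K) = fst ` (!) K ` {..<length K} \<union> snd ` (!) K ` {..<length K}"
      by (simp only: list_graph_simps)
    then show ?thesis by (auto simp: list_graph_simps)
  qed
  \<comment> \<open>The vertices of a list graph are exactly the ends of its edges. To obtain the
    vertex bijection from the edges, the replaced graph must be shown to have no isolated vertices
    either.\<close>
  have vR: "verts ?R = (\<Union>e\<in>edges ?R. ends ?R e)"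
  proof (intro equalityI subsetI)
    fix x assume x: "x \<in> verts ?R"
    show "x \<in> (\<Union>e\<in>edges ?R. ends ?R e)"
    proof (cases x)
      case (Inl v)
      then have "v \<in> verts (graph_of_list L)" "v \<noteq> u" using x by (auto simp: R)
      then obtain i where "i < ?n" "v \<in> ends (graph_of_list L) i" unfolding vert[of L] by (auto simp: list_graph_simps(2))
      then have "Inl i \<in> edges ?R" "x \<in> ends ?R (Inl i)" using Inl \<open>v \<noteq> u\<close> by (auto simp: R)
      then show ?thesis by blast
    next
      case (Inr v)
      then have v: "v \<in> {a, b, c}" using x by (auto simp: R)
      then have "u \<in> ends (graph_of_list L) v" using inc by (auto simp: incident_edges_def)
      then have "Inl v \<in> edges ?R" "x \<in> ends ?R (Inl v)" using Inr v len by (auto simp: R)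
      then show ?thesis by blast
    qed
  qed (use wf_triangle_replacement[OF wf_graph_of_list[of L], of u] in \<open>auto simp: wf_graph_def\<close>)
  have "?f ` verts ?R = (\<Union>e\<in>edges ?R. ends (graph_of_list T) (g e))"
    unfolding vR image_UN using ends by simp
  also have "\<dots> = verts (graph_of_list T)" proof -
    have "edges (graph_of_list T) = g ` edges ?R" using gb by (simp add: bij_betw_def)
    then show ?thesis unfolding vert[of T] by simp
  qed
  finally have "iso_via ?f g ?R (graph_of_list T)"
    using gb injf ends by (auto simp: iso_via_def bij_betw_def)
  then show ?thesis unfolding T_def by blast
qed

section \<open>The graphs of the theorem as lists\<close>

definition K33_list :: "(nat \<times> nat) list" where
  "K33_list = List.product [0, 1, 2] [3, 4, 5]"
definition C1_list :: "(nat \<times> nat) list" where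
  "C1_list = [(1, 2), (1, 2), (2, 3), (1, 4), (3, 5), (3, 6), (4, 5), (5, 6), (4, 6)]"
definition T3_list :: "(nat \<times> nat) list" where
  "T3_list = [(0, 2), (0, 3), (0, 4), (0, 5), (1, 2), (1, 3), (1, 4), (1, 5),
      (2, 3), (2, 3), (4, 5), (4, 5)]"
text \<open>The second argument of \<open>tri_list\<close> is one more than the largest vertex so
  far. Since \<open>K33_list\<close> has the edges 0, 1, 2 at vertex 0, then 3, 4, 5 at 1 and 6, 7,
  8 at 2, the triangles replacing these vertices in the last three lists are
  \<open>{6, 7, 8}\<close>, \<open>{12, 13, 14}\<close> and \<open>{21, 22, 23}\<close>.\<close>

definition T2_list :: "(nat \<times> nat) list" where
  "T2_list = tri_list C1_list 7 1"
definition T4_list :: "(nat \<times> nat) list" where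
  "T4_list = tri_list K33_list 6 0"
definition T5_list :: "(nat \<times> nat) list" where
  "T5_list = tri_list T4_list 9 1"
definition T6_list :: "(nat \<times> nat) list" where
  "T6_list = tri_list T5_list 15 2"

text \<open>The vertex map is given explicitly because its value at the next vertex to be replaced
  must be computed; the edge map may remain anonymous.\<close>

lemma tri_iso_list:
  assumes iso: "iso_via f g G (graph_of_list L)" and wf: "wf_graph G" and u: "u \<in> verts G"
    and L: "\<forall>(a, b)\<in>set L. a \<noteq> b \<and> a < k \<and> b < k"
    and I: "length (filter (\<lambda>i. f u = fst (L ! i) \<or> f u = snd (L ! i)) [0..<length L]) = 3"
  shows "\<exists>h. iso_via (case_sum f (\<lambda>e. k + g e)) h (triangle_replacement G u) (graph_of_list (tri_list L k (f u)))"
proof -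
  obtain h where "iso_via (case_sum id (\<lambda>i. k + i)) h (triangle_replacement (graph_of_list L) (f u)) (graph_of_list (tri_list L k (f u)))"
    using tri_list[OF L I] by blast
  from iso_via_trans[OF tri_iso[OF iso wf u] this]
  have "iso_via (case_sum id (\<lambda>i. k + i) \<circ> map_sum f g) (h \<circ> map_sum g g) (triangle_replacement G u) (graph_of_list (tri_list L k (f u)))" .
  moreover have "case_sum id (\<lambda>i. k + i) \<circ> map_sum f g = case_sum f (\<lambda>e. k + g e)"
    by (rule ext) (auto split: sum.split)
  ultimately show ?thesis by metis
qed

lemma iso_via_refl: "iso_via id id G G"
  by (simp add: iso_via_def bij_betw_def)

lemma K33_eq: "K33 = graph_of_list K33_list"
  by (simp add: K33_def K33_list_def)

lemma C_triangle_1_eq: "C_triangle_1 = graph_of_list C1_list"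
  by (simp add: C_triangle_1_def C1_list_def)

lemma T3_eq: "T3 = graph_of_list T3_list"
  by (simp add: T3_def T3_list_def)

lemma T2_iso: "graph_iso T2 (graph_of_list T2_list)"
proof -
  have "\<exists>h. iso_via (case_sum id (\<lambda>e. 7 + id e)) h (triangle_replacement (graph_of_list C1_list) 1) (graph_of_list (tri_list C1_list 7 (id 1)))"
    by (rule tri_iso_list[OF iso_via_refl wf_graph_of_list]) (simp add: list_graph_simps C1_list_def, code_simp+)
  then show ?thesis unfolding T2_def T2_list_def C_triangle_1_eq graph_iso_via by auto
qed

text \<open>Besides the isomorphism it records where the two vertices go at which \<open>T5\<close>
  and \<open>T6\<close> are formed.\<close>

lemma T4_iso_via: "\<exists>f g. iso_via f g T4 (graph_of_list T4_list) \<and> f (Inl 1) = 1 \<and> f (Inl 2) = 2"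
proof -
  have "\<exists>h. iso_via (case_sum id (\<lambda>e. 6 + id e)) h (triangle_replacement (graph_of_list K33_list) 0) (graph_of_list (tri_list K33_list 6 (id 0)))"
    by (rule tri_iso_list[OF iso_via_refl wf_graph_of_list]) (simp add: list_graph_simps K33_list_def, code_simp+)
  then show ?thesis unfolding T4_def T4_list_def K33_eq by (auto intro!: exI)
qed

lemma T4_wf: "wf_graph T4"
  unfolding T4_def K33_eq by (intro wf_triangle_replacement wf_graph_of_list)

lemma T5_wf: "wf_graph T5"
  unfolding T5_def by (intro wf_triangle_replacement T4_wf)

lemma T5_iso_via: "\<exists>f g. iso_via f g T5 (graph_of_list T5_list) \<and> f (Inl (Inl 2)) = 2"
proof -
  obtain f g where fg: "iso_via f g T4 (graph_of_list T4_list)" "f (Inl 1) = 1" "f (Inl 2) = 2"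
    using T4_iso_via by blast
  have "\<exists>h. iso_via (case_sum f (\<lambda>e. 9 + g e)) h (triangle_replacement T4 (Inl 1)) (graph_of_list (tri_list T4_list 9 (f (Inl 1))))"
    by (rule tri_iso_list[OF fg(1) T4_wf])
      (simp add: T4_def triangle_replacement_def K33_eq list_graph_simps K33_list_def, code_simp, simp only: fg, code_simp)
  then show ?thesis unfolding T5_def T5_list_def fg(2) using fg(3) by (metis sum.case(1))
qed

lemma T6_iso: "graph_iso T6 (graph_of_list T6_list)"
proof -
  obtain f g where fg: "iso_via f g T5 (graph_of_list T5_list)" "f (Inl (Inl 2)) = 2"
    using T5_iso_via by blast
  have "\<exists>h. iso_via (case_sum f (\<lambda>e. 15 + g e)) h (triangle_replacement T5 (Inl (Inl 2))) (graph_of_list (tri_list T5_list 15 (f (Inl (Inl 2)))))"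
    by (rule tri_iso_list[OF fg(1) T5_wf])
      (simp add: T5_def T4_def triangle_replacement_def K33_eq list_graph_simps K33_list_def, code_simp, simp only: fg, code_simp)
  then show ?thesis unfolding T6_def T6_list_def fg(2) graph_iso_via by blast
qed

lemma T4_iso: "graph_iso T4 (graph_of_list T4_list)" and T5_iso: "graph_iso T5 (graph_of_list T5_list)"
  using T4_iso_via T5_iso_via unfolding graph_iso_via by blast+

lemma balanced_lists:
  "balanced_list C1_list" "balanced_list T2_list" "balanced_list T3_list"
  "balanced_list T4_list" "balanced_list T5_list" "balanced_list T6_list"
  by code_simp+

subsection \<open>Cubic graphs with one perfect matching of single edges\<close>

text \<open>\<open>l\<close> is the involution exchanging the ends of each chord of an \<open>n\<close>-cycle whose chords form
  a perfect matching.  A set of positions is good if it consists of the ends of an odd chord or of two crossing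
  even chords of opposite parity.\<close>

definition good_chords :: "nat \<Rightarrow> (nat \<Rightarrow> nat) \<Rightarrow> nat set \<Rightarrow> bool" where
  "good_chords n l Z \<longleftrightarrow>
     (\<exists>a. a < l a \<and> l a < n \<and> odd (l a + a) \<and> Z = {a, l a}) \<or>
     (\<exists>a b. a < b \<and> b < l a \<and> l a < l b \<and> l b < n \<and> even (l a + a) \<and> even (l b + b) \<and> odd (a + b) \<and>
        Z = {a, b, l a, l b})"

text \<open>The purely arithmetical content of a cubic graph with a Hamiltonian cycle
  \<open>M \<union> N\<close> in which \<open>M\<close> consists of single edges. The rules
  \<open>P1\<close> and \<open>P2\<close> are the conclusions of \<open>odd_chord_single\<close> and
  \<open>crossing_single\<close>.\<close>

locale chord_involution =
  fixes n :: nat and l :: "nat \<Rightarrow> nat"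
  assumes l: "\<And>i. i < n \<Longrightarrow> l i < n" "\<And>i. i < n \<Longrightarrow> l i \<noteq> i" "\<And>i. i < n \<Longrightarrow> l (l i) = i"
    and P1: "\<And>a. a < l a \<Longrightarrow> l a < n \<Longrightarrow> odd (l a + a) \<Longrightarrow> (even a \<longrightarrow> a = 0 \<and> l a = n - 1) \<and> (odd a \<longrightarrow> l a = a + 1)"
    and P2: "\<And>a b. a < b \<Longrightarrow> b < l a \<Longrightarrow> l a < l b \<Longrightarrow> l b < n \<Longrightarrow> even (l a + a) \<Longrightarrow> even (l b + b) \<Longrightarrow> odd (a + b)
       \<Longrightarrow> (even a \<longrightarrow> a = 0 \<and> l a = b + 1 \<and> l b = n - 1) \<and> (odd a \<longrightarrow> b = a + 1 \<and> l b = l a + 1)"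
begin

lemma good_closed: "good_chords n l Z \<Longrightarrow> x \<in> Z \<Longrightarrow> l x \<in> Z"
proof -
  assume "good_chords n l Z" "x \<in> Z"
  then show "l x \<in> Z" unfolding good_chords_def
  proof (elim disjE exE conjE)
    fix a assume a: "a < l a" "l a < n" "Z = {a, l a}" "x \<in> Z"
    then have "l (l a) = a" using l(3)[of a] by simp
    then show ?thesis using a(3,4) by auto
  next
    fix a b assume a: "a < b" "b < l a" "l a < l b" "l b < n" "Z = {a, b, l a, l b}" "x \<in> Z"
    then have "l (l a) = a" "l (l b) = b" using l(3)[of a] l(3)[of b] by simp_all
    then show ?thesis using a(5,6) by auto
  qed
qed

lemma good_crossing:
  assumes "a < b" "b < l a" "l a < l b" "l b < n" "even (l a + a)" "even (l b + b)" "odd (a + b)"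
  shows "good_chords n l {a, b, l a, l b}"
  unfolding good_chords_def using assms by blast

lemma good_odd:
  assumes "a < l a" "l a < n" "odd (l a + a)"
  shows "good_chords n l {a, l a}"
  unfolding good_chords_def using assms by blast

text \<open>The shortest-chord argument restricted to chords outside \<open>Z\<close>. If every good
  set lay in \<open>Z\<close>, a shortest chord \<open>(i, j)\<close> outside \<open>Z\<close> would
  be even, and all positions between \<open>i\<close> and \<open>j\<close> of the other parity would
  belong to \<open>Z\<close>. A good set is too small and, by \<open>P1\<close> and
  \<open>P2\<close>, too rigid for this.\<close>

lemma another_good:
  assumes Z: "Z = {} \<or> good_chords n l Z" and nZ: "x0 < n" "x0 \<notin> Z"
  obtains Z' where "good_chords n l Z'" "\<not> Z' \<subseteq> Z"
proof (rule ccontr)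
  assume "\<not> thesis"
  then have all: "\<And>Z'. good_chords n l Z' \<Longrightarrow> Z' \<subseteq> Z" using that by blast
  have cl: "l x \<in> Z" if "x \<in> Z" for x using good_closed Z that by blast
  define S where "S = {i. i < l i \<and> l i < n \<and> i \<notin> Z}"
  have "x0 \<in> S \<or> l x0 \<in> S"
    using l[OF nZ(1)] nZ cl[of "l x0"] by (auto simp: S_def)
  then obtain s where "s \<in> S" by blast
  then obtain i where i: "i \<in> S" "\<And>k. k \<in> S \<Longrightarrow> l i - i \<le> l k - k"
    using ex_has_least_nat[of "\<lambda>k. k \<in> S" s "\<lambda>k. l k - k"] by blast
  define j where "j = l i"
  have ij: "i < j" "j < n" "i \<notin> Z" "l i = j" "l j = i" using i(1) l(3)[of i] by (auto simp: S_def j_def)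
  have ev: "even (j + i)"
  proof (rule ccontr)
    assume "odd (j + i)"
    then have "good_chords n l {i, l i}" using good_odd[of i] ij by simp
    then show False using all ij(3) by blast
  qed
  \<comment> \<open>Otherwise the chord at \<open>x\<close> would cross \<open>(i, j)\<close> and
    form with it a good set containing \<open>i\<close>, which is not in \<open>Z\<close>.\<close>
  have inside: "i < l x \<and> l x < j" if x: "i < x" "x < j" "odd (x + i)" "even (l x + x)" for x
  proof -
    have lx: "l x < n" "l (l x) = x" "l x \<noteq> x" using l[of x] x ij by auto
    have par: "odd (l x + i)" using x by auto
    then have ne: "l x \<noteq> i" "l x \<noteq> j" using ev by auto
    have "\<not> j < l x"
    proof
      assume "j < l x"
      then have "good_chords n l {i, x, l i, l x}"
        using x ij lx ev by (intro good_crossing) (auto simp: add.commute)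
      then show False using all ij(3) by blast
    qed
    moreover have "\<not> l x < i"
    proof
      assume "l x < i"
      then have "good_chords n l {l x, i, l (l x), l i}"
        using x ij lx ev par by (intro good_crossing) (auto simp: add.commute)
      then show False using all ij(3) by blast
    qed
    ultimately show ?thesis using ne by linarith
  qed
  \<comment> \<open>Outside \<open>Z\<close> the chord at \<open>x\<close> would be even and, lying
    strictly between \<open>i\<close> and \<open>j\<close>, shorter than the shortest one.\<close>
  have inZ: "x \<in> Z" if x: "i < x" "x < j" "odd (x + i)" for x
  proof (rule ccontr)
    assume nx: "x \<notin> Z"
    have lx: "l x < n" "l (l x) = x" "l x \<noteq> x" using l[of x] x ij by auto
    have nlx: "l x \<notin> Z" using cl[of "l x"] lx nx by auto
    have e: "even (l x + x)"
    proof (rule ccontr)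
      assume o: "odd (l x + x)"
      show False
      proof (cases "x < l x")
        case True
        then show False using all[OF good_odd[of x]] o lx nx by blast
      next
        case False
        then show False using all[OF good_odd[of "l x"]] o lx nx nlx x ij by (simp add: add.commute)
      qed
    qed
    have ins: "i < l x" "l x < j" using inside[OF x e] by auto
    show False
    proof (cases "x < l x")
      case True
      then have "x \<in> S" using lx nx by (simp add: S_def)
      then show False using i(2)[of x] ins x True ij by (simp add: j_def[symmetric])
    next
      case False
      then have "l x \<in> S" using lx nlx x ij by (simp add: S_def)
      then show False using i(2)[of "l x"] ins x False lx ij by (simp add: j_def[symmetric])
    qed
  qed
  have i1: "i + 1 < j" using ij(1) ev by (metis Suc_eq_plus1 Suc_lessI add_Suc even_Suc odd_add)
  then have Z1: "i + 1 \<in> Z" "j - 1 \<in> Z" using inZ[of "i + 1"] inZ[of "j - 1"] ev ij by auto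
  then have "good_chords n l Z" using Z by blast
  then consider a where "a < l a" "l a < n" "odd (l a + a)" "Z = {a, l a}"
    | a b where "a < b" "b < l a" "l a < l b" "l b < n" "even (l a + a)" "even (l b + b)" "odd (a + b)" "Z = {a, b, l a, l b}"
    unfolding good_chords_def by blast
  then show False
  proof cases
    case 1
    \<comment> \<open>The positions \<open>i + 1\<close> and \<open>j - 1\<close> have the same
      parity, the ends of an odd chord do not. Hence they are the same end and
      \<open>j = i + 2\<close>; \<open>P1\<close> then makes \<open>i\<close> or \<open>j\<close>
      its partner, although these two are partners of each other.\<close>
    have "i + 1 = a \<and> j - 1 = a \<or> i + 1 = l a \<and> j - 1 = l a"
    proof -
      have "i + 1 + (j - 1) = j + i" using ij(1) by simp
      then have e: "even (i + 1 + (j - 1))" using ev by simp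
      have "i + 1 = a \<or> i + 1 = l a" "j - 1 = a \<or> j - 1 = l a" using Z1 1(4) by auto
      then show ?thesis using e 1(3) by (metis add.commute)
    qed
    then have "a = i + 1 \<and> j = i + 2 \<or> l a = i + 1 \<and> j = i + 2" using i1 by auto
    then show False
    proof
      assume h: "a = i + 1 \<and> j = i + 2"
      have "l a = n - 1 \<and> a = 0 \<or> l a = a + 1" using P1[OF 1(1-3)] by blast
      then have "l a = j" using h by auto
      then show False using l(3)[of a] ij h 1 by auto
    next
      assume h: "l a = i + 1 \<and> j = i + 2"
      have "l a = n - 1 \<or> l a = a + 1" using P1[OF 1(1-3)] by blast
      then have "a = i" using h ij by auto
      then show False using h ij by auto
    qed
  next
    case 2
    have ll: "l (l a) = a" "l (l b) = b" using l(3) 2 by auto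
    \<comment> \<open>Here \<open>p\<close> is the left end, among those of the two crossing chords,
      whose parity differs from that of \<open>i\<close>. Its chord lies between \<open>i\<close>
      and \<open>j\<close>, and its two ends are the only positions there of that parity; this fixes
      the length of \<open>(i, j)\<close> as 4.\<close>
    have la: "p = i + 1 \<and> l p = i + 3 \<and> j = i + 4"
      if p: "p = a \<or> p = b" "odd (p + i)" "i + 1 = p \<or> i + 1 = l p" "p < l p" "even (l p + p)" and q: "q = a \<or> q = b" "even (q + i)" "even (l q + q)" "Z = {p, q, l p, l q}" for p q
    proof -
      have "i + 1 = p"
      proof (rule ccontr)
        assume "i + 1 \<noteq> p"
        then have "i + 1 = l p" using p by blast
        then have "i < l (i + 1)" using inside[of "i + 1"] i1 p ll by (auto simp: add.commute)
        then show False using \<open>i + 1 = l p\<close> p ll by auto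
      qed
      then have ins: "l p < j" using inside[of p] i1 p by auto
      have inpl: "x = p \<or> x = l p" if "i < x" "x < j" "odd (x + i)" for x
        using inZ[OF that] q(4) q(2,3) that(3) by auto
      have "l p \<noteq> p + 1" using p(5) by auto
      then have "i + 3 < j" using ins \<open>i + 1 = p\<close> p(4) by linarith
      then have "i + 3 = l p" using inpl[of "i + 3"] \<open>i + 1 = p\<close> by auto
      moreover have "j - 1 = p \<or> j - 1 = l p" using inpl[of "j - 1"] i1 ev by auto
      ultimately show ?thesis using \<open>i + 1 = p\<close> \<open>i + 3 < j\<close> by auto
    qed
    show False
    proof (cases "odd (a + i)")
      case True
      have "even (b + i)" "even (l b + i)" "odd (i + 1 + i)" using 2(5-7) True by auto
      then have "i + 1 = a \<or> i + 1 = l a" using Z1(1) unfolding 2(8) by (metis insertE singletonD)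
      then have h: "a = i + 1" "l a = i + 3" "j = i + 4" using la[of a b] 2 True by auto
      have "b = i + 2" using 2 h by auto
      have "l b = n - 1 \<and> a = 0 \<or> l b = l a + 1" using P2[OF 2(1-7)] by blast
      then have "l b = j" using h by auto
      then show False using ll ij \<open>b = i + 2\<close> by auto
    next
      case False
      then have ob: "odd (b + i)" using 2(7) by auto
      have "even (a + i)" "even (l a + i)" "odd (i + 1 + i)" using 2(5-7) False by auto
      then have "i + 1 = b \<or> i + 1 = l b" using Z1(1) unfolding 2(8) by (metis insertE singletonD)
      then have h: "b = i + 1" "l b = i + 3" "j = i + 4" using la[of b a] 2 ob False by (auto simp: insert_commute)
      have "l b = n - 1 \<or> b = a + 1" using P2[OF 2(1-7)] by blast
      then have "a = i" using h ij by auto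
      then show False using ij 2(8) by blast
    qed
  qed
qed

text \<open>The first good set is found from the empty one. It has at most four elements and so
  misses a position, which allows a second good set to be found.\<close>

lemma good_cover:
  assumes n: "6 \<le> n"
    and R: "\<And>Z Z'. good_chords n l Z \<Longrightarrow> good_chords n l Z' \<Longrightarrow> Z \<noteq> Z' \<Longrightarrow> Z \<inter> Z' = {} \<and> Z \<union> Z' = {..<n}"
  obtains Z Z' where "good_chords n l Z" "good_chords n l Z'" "Z \<inter> Z' = {}" "Z \<union> Z' = {..<n}"
proof -
  obtain Z where Z: "good_chords n l Z" using another_good[of "{}" 0] n by auto
  have "\<not> {..<n} \<subseteq> Z"
  proof
    assume "{..<n} \<subseteq> Z"
    moreover have "finite Z \<and> card Z \<le> 4" using Z unfolding good_chords_def
      by (elim disjE exE conjE) (simp_all add: card_insert_if)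
    ultimately show False using card_mono[of Z "{..<n}"] n by auto
  qed
  then obtain x0 where "x0 < n" "x0 \<notin> Z" by auto
  then obtain Z' where Z': "good_chords n l Z'" "\<not> Z' \<subseteq> Z" using another_good[of Z x0] Z by blast
  then show ?thesis using R[OF Z Z'(1)] that Z by blast
qed

text \<open>Good sets have 2 or 4 elements, so \<open>n\<close> is 6 or 8: one odd chord and a
  crossing pair, or two crossing pairs. \<open>P1\<close> leaves three places for the odd chord and
  the even chords are then forced; for \<open>n = 8\<close> the rule \<open>P2\<close> is applied to
  the pair containing position 0.\<close>

lemma good_config:
  assumes n: "6 \<le> n" "even n"
    and Z: "good_chords n l Z" "good_chords n l Z'" "Z \<inter> Z' = {}" "Z \<union> Z' = {..<n}"
  shows "n = 6 \<and> (l 0 = 5 \<and> l 1 = 3 \<and> l 2 = 4 \<or> l 1 = 2 \<and> l 3 = 5 \<and> l 0 = 4 \<or> l 3 = 4 \<and> l 0 = 2 \<and> l 1 = 5) \<or>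
    n = 8 \<and> (l 0 = 2 \<and> l 1 = 7 \<and> l 4 = 6 \<and> l 3 = 5 \<or> l 0 = 6 \<and> l 5 = 7 \<and> l 2 = 4 \<and> l 1 = 3)"
proof -
  have fin: "finite Y \<and> (card Y = 2 \<and> (\<exists>a. a < l a \<and> l a < n \<and> odd (l a + a) \<and> Y = {a, l a}) \<or>
      card Y = 4 \<and> (\<forall>x\<in>Y. even (l x + x)) \<and> (\<forall>x\<in>Y. \<exists>a b. a < b \<and> b < l a \<and> l a < l b \<and> l b < n \<and> even (l a + a) \<and> even (l b + b) \<and> odd (a + b) \<and> x \<in> {a, b, l a, l b}))"
    if "good_chords n l Y" for Y
    using that unfolding good_chords_def
  proof (elim disjE exE conjE)
    fix a assume "a < l a" "l a < n" "odd (l a + a)" "Y = {a, l a}"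
    then show ?thesis by (intro conjI disjI1 exI[of _ a]) auto
  next
    fix a b assume h: "a < b" "b < l a" "l a < l b" "l b < n" "even (l a + a)" "even (l b + b)" "odd (a + b)" "Y = {a, b, l a, l b}"
    have "l (l a) = a" "l (l b) = b" using h l(3) by auto
    then have "\<forall>x\<in>Y. even (l x + x)" using h by (auto simp: add.commute)
    moreover have "card Y = 4" using h by auto
    ultimately show ?thesis using h by blast
  qed
  have card: "card Z + card Z' = n" using card_Un_disjoint[of Z Z'] fin[OF Z(1)] fin[OF Z(2)] Z(3,4) by simp
  have lt6: "x < 6 \<longleftrightarrow> x = 0 \<or> x = 1 \<or> x = 2 \<or> x = 3 \<or> x = 4 \<or> x = (5::nat)" for x by auto
  have lt8: "x < 8 \<longleftrightarrow> x = 0 \<or> x = 1 \<or> x = 2 \<or> x = 3 \<or> x = 4 \<or> x = 5 \<or> x = 6 \<or> x = (7::nat)" for x by auto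
  have six: "n = 6 \<and> (l 0 = 5 \<and> l 1 = 3 \<and> l 2 = 4 \<or> l 1 = 2 \<and> l 3 = 5 \<and> l 0 = 4 \<or> l 3 = 4 \<and> l 0 = 2 \<and> l 1 = 5)"
    if "n = 6" "a < l a" "l a < n" "odd (l a + a)" and ev: "\<And>x. x < n \<Longrightarrow> x \<noteq> a \<Longrightarrow> x \<noteq> l a \<Longrightarrow> even (l x + x)" for a
  proof -
    have "a = 0 \<and> l a = 5 \<or> a = 1 \<and> l a = 2 \<or> a = 3 \<and> l a = 4"
    proof -
      have "a < 6" using that(1-3) by simp
      then show ?thesis using P1[OF that(2-4)] that(1-3) unfolding lt6 by (elim disjE) simp_all
    qed
    then show ?thesis
    proof (elim disjE conjE)
      assume a: "a = 0" "l a = 5"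
      have 1: "even (l 1 + 1)" "l 1 < 6" "l 1 \<noteq> 1" "l (l 1) = 1" using ev[of 1] l[of 1] a that(1) by auto
      have 2: "even (l 2 + 2)" "l 2 < 6" "l 2 \<noteq> 2" "l (l 2) = 2" using ev[of 2] l[of 2] a that(1) by auto
      have "l 5 = 0" using l(3)[of 0] a that(1) by auto
      then have "l 1 = 3" "l 2 = 4" using 1 2 a unfolding lt6 by auto
      then show ?thesis using a that(1) by auto
    next
      assume a: "a = 1" "l a = 2"
      have 1: "even (l 3 + 3)" "l 3 < 6" "l 3 \<noteq> 3" "l (l 3) = 3" using ev[of 3] l[of 3] a that(1) by auto
      have 2: "even (l 0 + 0)" "l 0 < 6" "l 0 \<noteq> 0" "l (l 0) = 0" using ev[of 0] l[of 0] a that(1) by auto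
      have "l 2 = 1" using l(3)[of 1] a that(1) by auto
      then have "l 3 = 5" "l 0 = 4" using 1 2 a unfolding lt6 by auto
      then show ?thesis using a that(1) by auto
    next
      assume a: "a = 3" "l a = 4"
      have 1: "even (l 1 + 1)" "l 1 < 6" "l 1 \<noteq> 1" "l (l 1) = 1" using ev[of 1] l[of 1] a that(1) by auto
      have 2: "even (l 0 + 0)" "l 0 < 6" "l 0 \<noteq> 0" "l (l 0) = 0" using ev[of 0] l[of 0] a that(1) by auto
      have "l 4 = 3" using l(3)[of 3] a that(1) by auto
      then have "l 1 = 5" "l 0 = 2" using 1 2 a unfolding lt6 by auto
      then show ?thesis using a that(1) by auto
    qed
  qed
  have eight: "n = 8 \<and> (l 0 = 2 \<and> l 1 = 7 \<and> l 4 = 6 \<and> l 3 = 5 \<or> l 0 = 6 \<and> l 5 = 7 \<and> l 2 = 4 \<and> l 1 = 3)"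
    if n8: "n = 8" and ev: "\<And>x. x < n \<Longrightarrow> even (l x + x)"
      and cr: "\<And>x. x < n \<Longrightarrow> \<exists>a b. a < b \<and> b < l a \<and> l a < l b \<and> l b < n \<and> even (l a + a) \<and> even (l b + b) \<and> odd (a + b) \<and> x \<in> {a, b, l a, l b}"
  proof -
    obtain a b where ab: "a < b" "b < l a" "l a < l b" "l b < n" "even (l a + a)" "even (l b + b)" "odd (a + b)" "0 \<in> {a, b, l a, l b}"
      using cr[of 0] n8 by auto
    then have a0: "a = 0" by auto
    then have b: "l 0 = b + 1" "l b = 7" using P2[OF ab(1-7)] n8 by auto
    have "l 0 < 8" "even (l 0)" "b + 1 < 7" using ev[of 0] n8 l(1)[of 0] b ab a0 by auto
    then have "l 0 = 2 \<or> l 0 = 4 \<or> l 0 = 6" using b unfolding lt8 by auto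
    then show ?thesis
    proof (elim disjE)
      assume h: "l 0 = 2"
      then have b1: "l 1 = 7" using b by auto
      have inv: "l 2 = 0" "l 7 = 1" using l(3)[of 0] l(3)[of 1] h b1 n8 by auto
      have 1: "even (l 3 + 3)" "l 3 < 8" "l 3 \<noteq> 3" "l (l 3) = 3" using ev[of 3] l[of 3] n8 by auto
      have 2: "even (l 4 + 4)" "l 4 < 8" "l 4 \<noteq> 4" "l (l 4) = 4" using ev[of 4] l[of 4] n8 by auto
      have "l 3 = 5" "l 4 = 6" using 1 2 inv h b1 unfolding lt8 by auto
      then show ?thesis using h b1 n8 by auto
    next
      assume h: "l 0 = 6"
      then have b1: "l 5 = 7" using b by auto
      have inv: "l 6 = 0" "l 7 = 5" using l(3)[of 0] l(3)[of 5] h b1 n8 by auto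
      have 1: "even (l 1 + 1)" "l 1 < 8" "l 1 \<noteq> 1" "l (l 1) = 1" using ev[of 1] l[of 1] n8 by auto
      have 2: "even (l 2 + 2)" "l 2 < 8" "l 2 \<noteq> 2" "l (l 2) = 2" using ev[of 2] l[of 2] n8 by auto
      have "l 1 = 3" "l 2 = 4" using 1 2 inv h b1 unfolding lt8 by auto
      then show ?thesis using h b1 n8 by auto
    next
      assume h: "l 0 = 4"
      then have b1: "l 3 = 7" using b by auto
      have inv: "l 4 = 0" "l 7 = 3" using l(3)[of 0] l(3)[of 3] h b1 n8 by auto
      have 1: "even (l 1 + 1)" "l 1 < 8" "l 1 \<noteq> 1" "l (l 1) = 1" using ev[of 1] l[of 1] n8 by auto
      have "l 1 = 5" using 1 inv h b1 unfolding lt8 by auto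
      \<comment> \<open>The chords at 0 and 1 cross each other too, and for them \<open>P2\<close>
        would demand the ends 2 and 7.\<close>
      then show ?thesis using P2[of 0 1] h n8 by auto
    qed
  qed
  have mem: "x \<in> Z \<or> x \<in> Z'" if "x < n" for x using Z(4) that by blast
  have sub: "x < n" if "x \<in> Z \<or> x \<in> Z'" for x using Z(4) that by blast
  consider "card Z = 2" "card Z' = 4" | "card Z = 4" "card Z' = 2" | "card Z = 4" "card Z' = 4"
    using fin[OF Z(1)] fin[OF Z(2)] card n by fastforce
  then show ?thesis
  proof cases
    case 1
    then obtain a where a: "a < l a" "l a < n" "odd (l a + a)" "Z = {a, l a}" using fin[OF Z(1)] by auto
    have "even (l x + x)" if "x < n" "x \<noteq> a" "x \<noteq> l a" for x
      using mem[OF that(1)] that a(4) fin[OF Z(2)] 1 by auto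
    then show ?thesis using six[OF _ a(1-3)] card 1 by simp
  next
    case 2
    then obtain a where a: "a < l a" "l a < n" "odd (l a + a)" "Z' = {a, l a}" using fin[OF Z(2)] by auto
    have "even (l x + x)" if "x < n" "x \<noteq> a" "x \<noteq> l a" for x
      using mem[OF that(1)] that a(4) fin[OF Z(1)] 2 by auto
    then show ?thesis using six[OF _ a(1-3)] card 2 by simp
  next
    case 3
    have "even (l x + x)" if "x < n" for x
      using mem[OF that(1)] fin[OF Z(1)] fin[OF Z(2)] 3 by auto
    moreover have "\<exists>a b. a < b \<and> b < l a \<and> l a < l b \<and> l b < n \<and> even (l a + a) \<and> even (l b + b) \<and> odd (a + b) \<and> x \<in> {a, b, l a, l b}"
      if "x < n" for x using mem[OF that(1)] fin[OF Z(1)] fin[OF Z(2)] 3 by auto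
    ultimately show ?thesis using eight card 3 by simp
  qed
qed

end

subsection \<open>A Tutte--Berge theorem\<close>

definition matching_in :: "('v, 'e) multigraph \<Rightarrow> 'v set \<Rightarrow> 'e set \<Rightarrow> bool" where
  "matching_in G W A \<longleftrightarrow> A \<subseteq> edges G \<and> (\<forall>e\<in>A. ends G e \<subseteq> W) \<and>
     (\<forall>e\<in>A. \<forall>f\<in>A. e \<noteq> f \<longrightarrow> ends G e \<inter> ends G f = {})"

definition covered :: "('v, 'e) multigraph \<Rightarrow> 'e set \<Rightarrow> 'v set" where
  "covered G A = (\<Union>e\<in>A. ends G e)"

definition matching_number :: "('v, 'e) multigraph \<Rightarrow> 'v set \<Rightarrow> nat" where
  "matching_number G W = Max (card ` {A. matching_in G W A})"

context
  fixes G :: "('v, 'e) multigraph"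
  assumes G: "finite_loopless_graph G"
begin

lemma finite_matchings: "finite {A. matching_in G W A}"
proof -
  have "finite (Pow (edges G))" using G by (simp add: finite_loopless_graph_def)
  then show ?thesis by (rule rev_finite_subset) (auto simp: matching_in_def)
qed

lemma matching_in_empty: "matching_in G W {}"
  by (simp add: matching_in_def)

lemma matching_number_ge: "matching_in G W A \<Longrightarrow> card A \<le> matching_number G W"
  unfolding matching_number_def using finite_matchings by (intro Max_ge) auto

lemma matching_number_attained: "\<exists>A. matching_in G W A \<and> card A = matching_number G W"
proof -
  have "matching_number G W \<in> card ` {A. matching_in G W A}"
    unfolding matching_number_def using finite_matchings matching_in_empty by (intro Max_in) auto
  then show ?thesis by auto
qed

lemma matching_finite: "matching_in G W A \<Longrightarrow> finite A"
  using G finite_subset by (auto simp: matching_in_def finite_loopless_graph_def)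

lemma card_covered:
  assumes "matching_in G W A" shows "card (covered G A) = 2 * card A"
proof -
  have c2: "card (ends G e) = 2" if "e \<in> A" for e
    using that assms G by (auto simp: matching_in_def finite_loopless_graph_def)
  have "card (covered G A) = (\<Sum>e\<in>A. card (ends G e))" unfolding covered_def
  proof (rule card_UN_disjoint[OF matching_finite[OF assms]])
    show "\<forall>i\<in>A. finite (ends G i)" using c2 by (metis card.infinite zero_neq_numeral)
    show "\<forall>i\<in>A. \<forall>j\<in>A. i \<noteq> j \<longrightarrow> ends G i \<inter> ends G j = {}" using assms by (simp add: matching_in_def)
  qed
  also have "\<dots> = (\<Sum>e\<in>A. 2)" using c2 by (intro sum.cong) auto
  finally show ?thesis by simp
qed

lemma covered_subset: "matching_in G W A \<Longrightarrow> covered G A \<subseteq> W"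
  by (auto simp: matching_in_def covered_def)

lemma matching_insert:
  assumes "matching_in G W A" "e \<in> edges G" "ends G e \<subseteq> W" "ends G e \<inter> covered G A = {}"
  shows "matching_in G W (insert e A)" "card (insert e A) = Suc (card A)"
proof -
  show "matching_in G W (insert e A)" using assms unfolding matching_in_def covered_def by blast
  obtain x where "x \<in> ends G e" using graph_endsE[OF G assms(2)] by blast
  then have "e \<notin> A" using assms(4) by (auto simp: covered_def)
  then show "card (insert e A) = Suc (card A)" using matching_finite[OF assms(1)] by simp
qed

definition max_matching :: "'v set \<Rightarrow> 'e set \<Rightarrow> bool" where
  "max_matching W A \<longleftrightarrow> matching_in G W A \<and> card A = matching_number G W"

text \<open>Gallai's lemma, by Schrijver's exchange argument: choose \<open>B\<close> missing \<open>t\<close> with largest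
  intersection with \<open>A\<close>.\<close>

lemma gallai_trans:
  assumes W: "finite W" and A: "max_matching W A" "u \<notin> covered G A" "v \<notin> covered G A"
    and uv: "u \<in> W" "v \<in> W" "u \<noteq> v" and t: "t \<in> W" "t \<noteq> u" "t \<noteq> v"
    and miss: "\<exists>B. max_matching W B \<and> t \<notin> covered G B"
    and ut: "\<And>B. max_matching W B \<Longrightarrow> u \<in> covered G B \<or> t \<in> covered G B"
    and vt: "\<And>B. max_matching W B \<Longrightarrow> v \<in> covered G B \<or> t \<in> covered G B"
  shows False
proof -
  define T where "T = {B. max_matching W B \<and> t \<notin> covered G B}"
  have finT: "finite T" using finite_matchings[of W] by (rule rev_finite_subset) (auto simp: T_def max_matching_def)
  have "T \<noteq> {}" using miss by (auto simp: T_def)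
  define m where "m = Max ((\<lambda>B. card (A \<inter> B)) ` T)"
  have "m \<in> (\<lambda>B. card (A \<inter> B)) ` T" unfolding m_def using finT \<open>T \<noteq> {}\<close> by (intro Max_in) auto
  then obtain B where B: "B \<in> T" "card (A \<inter> B) = m" by auto
  have mB: "card (A \<inter> B') \<le> card (A \<inter> B)" if "B' \<in> T" for B'
    unfolding B(2) m_def using finT that by (intro Max_ge) auto
  have Bm: "matching_in G W B" "card B = matching_number G W" "t \<notin> covered G B"
    using B(1) by (auto simp: T_def max_matching_def)
  have Am: "matching_in G W A" "card A = matching_number G W" using A(1) by (auto simp: max_matching_def)
  have fA: "finite (covered G A)" "finite (covered G B)"
    using covered_subset[OF Am(1)] covered_subset[OF Bm(1)] W finite_subset by blast+
  have uvB: "u \<in> covered G B" "v \<in> covered G B"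
    using ut[of B] vt[of B] B(1) by (auto simp: T_def)
  have "card (covered G A) = card (covered G B)" using card_covered[OF Am(1)] card_covered[OF Bm(1)] Am Bm by simp
  then have eq: "card (covered G A - covered G B) = card (covered G B - covered G A)"
    using card_Diff_subset_Int[of "covered G A" "covered G B"] card_Diff_subset_Int[of "covered G B" "covered G A"] fA
    by (simp add: Int_commute)
  \<comment> \<open>Both matchings cover equally many vertices, and \<open>u\<close>,
    \<open>v\<close> are covered by \<open>B\<close> alone; so at least two vertices are covered by
    \<open>A\<close> alone, and one of them differs from \<open>t\<close>.\<close>
  have "{u, v} \<subseteq> covered G B - covered G A" using uvB A(2,3) by blast
  then have "card {u, v} \<le> card (covered G B - covered G A)" using fA by (intro card_mono) auto
  then have "2 \<le> card (covered G A - covered G B)" using eq uv(3) by simp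
  then have "\<not> covered G A - covered G B \<subseteq> {t}" using card_mono[of "{t}" "covered G A - covered G B"] by fastforce
  then obtain x where x: "x \<in> covered G A" "x \<notin> covered G B" "x \<noteq> t" by blast
  then obtain e where e: "e \<in> A" "x \<in> ends G e" by (auto simp: covered_def)
  have eE: "e \<in> edges G" "ends G e \<subseteq> W" using e Am(1) by (auto simp: matching_in_def)
  obtain y where y: "ends G e = {x, y}" "x \<noteq> y" using graph_ends_otherE[OF G eE(1) e(2)] by metis
  have yB: "y \<in> covered G B"
  proof (rule ccontr)
    assume "y \<notin> covered G B"
    then have "ends G e \<inter> covered G B = {}" using y(1) x(2) by auto
    then show False using matching_insert[OF Bm(1) eE] matching_number_ge[of W "insert e B"] Bm(2) by simp
  qed
  then obtain f where f: "f \<in> B" "y \<in> ends G f" by (auto simp: covered_def)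
  have fe: "f \<noteq> e" using x(2) e(2) f(1) by (auto simp: covered_def)
  have fA': "f \<notin> A" using Am(1) e(1) fe f(2) y(1) by (auto simp: matching_in_def)
  \<comment> \<open>Exchanging \<open>f\<close> for \<open>e\<close> keeps the size and still misses
    \<open>t\<close>, but gains an edge of \<open>A\<close> without losing one, against the choice
    of \<open>B\<close>.\<close>
  define B' where "B' = insert e (B - {f})"
  have dB: "matching_in G W (B - {f})" using Bm(1) by (auto simp: matching_in_def)
  have yc: "y \<notin> covered G (B - {f})"
    using Bm(1) f unfolding matching_in_def covered_def by blast
  have "ends G e \<inter> covered G (B - {f}) = {}" using y(1) yc x(2) by (auto simp: covered_def)
  from matching_insert[OF dB eE this]
  have B'm: "matching_in G W B'" "card B' = Suc (card (B - {f}))" by (auto simp: B'_def)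
  have "card B' = card B" using B'm(2) f(1) matching_finite[OF Bm(1)] by (simp add: card_gt_0_iff) (metis Suc_pred card_gt_0_iff empty_iff)
  moreover have "t \<notin> covered G B'"
    using Bm(3) y(1) x(3) yB by (auto simp: covered_def B'_def)
  ultimately have "B' \<in> T" using B'm(1) Bm(2) by (simp add: T_def max_matching_def)
  from mB[OF this] have "card (A \<inter> B') \<le> card (A \<inter> B)" .
  moreover have "e \<notin> B" using x(2) e(2) by (auto simp: covered_def)
  then have "A \<inter> B \<subset> A \<inter> B'" using e(1) fA' by (auto simp: B'_def)
  then have "card (A \<inter> B) < card (A \<inter> B')" using matching_finite[OF Am(1)] by (intro psubset_card_mono) auto
  ultimately show False by simp
qed

text \<open>Two vertices are related if no maximum matching misses both; \<open>gallai_trans\<close>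
  makes this an equivalence relation. Its classes take the place of components, so no connectivity
  has to be discussed: adjacent vertices are related by maximality, and each class is odd because a
  maximum matching missing one of its vertices covers all the others by edges inside the
  class.\<close>

lemma gallai_partition:
  assumes W: "finite W" and miss: "\<And>w. w \<in> W \<Longrightarrow> \<exists>B. max_matching W B \<and> w \<notin> covered G B"
  shows "\<exists>P. \<Union>P = W \<and> disjoint P \<and> (\<forall>K\<in>P. odd (card K)) \<and>
    (\<forall>e\<in>edges G. ends G e \<subseteq> W \<longrightarrow> (\<exists>K\<in>P. ends G e \<subseteq> K)) \<and>
    card P + 2 * matching_number G W = card W"
proof -
  define R where "R = {(x, y). x \<in> W \<and> y \<in> W \<and> (x = y \<or> (\<forall>B. max_matching W B \<longrightarrow> x \<in> covered G B \<or> y \<in> covered G B))}"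
  have eqv: "equiv W R"
  proof (rule equivI)
    show "refl_on W R" by (auto simp: R_def refl_on_def)
    show "R \<subseteq> W \<times> W" by (auto simp: R_def)
    show "sym R" by (auto simp: R_def sym_def)
    show "trans R"
    proof (rule transI)
      fix u t v assume h: "(u, t) \<in> R" "(t, v) \<in> R"
      show "(u, v) \<in> R"
      proof (cases "u = t \<or> t = v \<or> u = v")
        case True
        then show ?thesis using h by (auto simp: R_def)
      next
        case False
        have "u \<in> covered G A \<or> v \<in> covered G A" if "max_matching W A" for A
          using gallai_trans[OF W that, of u v t] False h miss[of t] by (auto simp: R_def)
        then show ?thesis using h by (auto simp: R_def)
      qed
    qed
  qed
  define P where "P = W // R"
  have U: "\<Union>P = W" using Union_quotient[OF eqv] by (simp add: P_def)
  have dj: "disjoint P" using quotient_disj[OF eqv] by (auto simp: P_def disjoint_def)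
  have PK: "y \<in> K" if "K \<in> P" "x \<in> K" "(x, y) \<in> R" for K x y
    using that eqv unfolding P_def by (metis in_quotient_imp_closed)
  have PR: "(x, y) \<in> R" if "K \<in> P" "x \<in> K" "y \<in> K" for K x y
    using that quotient_eq_iff[OF eqv, of K K x y] by (simp add: P_def)
  have adj: "(x, y) \<in> R" if e: "e \<in> edges G" "ends G e \<subseteq> W" "x \<in> ends G e" "y \<in> ends G e" for e x y
  proof (cases "x = y")
    case False
    have exy: "ends G e = {x, y}" using graph_ends_otherE[OF G e(1,3)] e(4) False by (metis insertE singletonD)
    have "x \<in> covered G B \<or> y \<in> covered G B" if B: "max_matching W B" for B
    proof (rule ccontr)
      assume "\<not> ?thesis"
      then have d: "ends G e \<inter> covered G B = {}" using exy by auto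
      have "matching_in G W B" "card B = matching_number G W" using B by (auto simp: max_matching_def)
      then show False using matching_insert[OF _ e(1,2) d] matching_number_ge[of W "insert e B"] by simp
    qed
    then show ?thesis using e by (auto simp: R_def)
  qed (use e in \<open>auto simp: R_def\<close>)
  have edge: "\<exists>K\<in>P. ends G e \<subseteq> K" if e: "e \<in> edges G" "ends G e \<subseteq> W" for e
  proof -
    obtain x y where xy: "ends G e = {x, y}" using graph_endsE[OF G e(1)] by metis
    then obtain K where K: "K \<in> P" "x \<in> K" using e(2) U by blast
    have "y \<in> K" by (rule PK[OF K adj[OF e]]) (use xy in auto)
    then show ?thesis using K xy by (intro bexI[of _ K]) auto
  qed
  have finK: "finite K" if "K \<in> P" for K
  proof -
    have "K \<subseteq> W" using that U by blast
    then show ?thesis using W by (rule finite_subset)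
  qed
  have even_in: "even (card (K \<inter> covered G A))" if K: "K \<in> P" and A: "matching_in G W A" for K A
  proof -
    define AK where "AK = {e \<in> A. ends G e \<subseteq> K}"
    have "matching_in G K AK" using A by (auto simp: matching_in_def AK_def)
    moreover have "covered G AK = K \<inter> covered G A"
    proof
      show "K \<inter> covered G A \<subseteq> covered G AK"
      proof
        fix x assume x: "x \<in> K \<inter> covered G A"
        then obtain e where e: "e \<in> A" "x \<in> ends G e" by (auto simp: covered_def)
        then have "e \<in> edges G" "ends G e \<subseteq> W" using A by (auto simp: matching_in_def)
        then have "ends G e \<subseteq> K" using adj[OF _ _ e(2)] PK[OF K] x by blast
        then show "x \<in> covered G AK" using e by (auto simp: covered_def AK_def)
      qed
    qed (auto simp: covered_def AK_def)
    ultimately show ?thesis using card_covered[of K AK] by simp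
  qed
  have one: "K \<inter> covered G A = K - {x}" if K: "K \<in> P" and A: "max_matching W A" and x: "x \<in> K" "x \<notin> covered G A" for K A x
  proof -
    have "y \<in> covered G A" if "y \<in> K" "y \<noteq> x" for y
      using PR[OF K x(1) that(1)] A x(2) that(2) by (auto simp: R_def)
    then show ?thesis using x by blast
  qed
  have oddK: "odd (card K)" if K: "K \<in> P" for K
  proof -
    obtain x where x: "x \<in> K" using K eqv unfolding P_def by (metis ex_in_conv in_quotient_imp_non_empty)
    then obtain A where A: "max_matching W A" "x \<notin> covered G A" using miss[of x] U K by blast
    have "even (card (K - {x}))" using even_in[OF K, of A] one[OF K A(1) x A(2)] A(1) by (simp add: max_matching_def)
    moreover have "card K = Suc (card (K - {x}))" using card.remove[OF finK[OF K] x] .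
    ultimately show ?thesis by simp
  qed
  obtain A where A: "max_matching W A" using matching_number_attained unfolding max_matching_def by blast
  then have Am: "matching_in G W A" "card A = matching_number G W" by (auto simp: max_matching_def)
  define f where "f = (\<lambda>x. R `` {x})"
  have fin: "f x \<in> P" "x \<in> f x" if "x \<in> W" for x
  proof -
    have "(x, x) \<in> R" using that by (simp add: R_def)
    then show "x \<in> f x" by (simp add: f_def)
    show "f x \<in> P" unfolding f_def P_def using that by (rule quotientI)
  qed
  \<comment> \<open>A maximum matching misses exactly one vertex of each class: at least one since
    the class is odd, at most one by the relation. Counting classes therefore counts missed
    vertices.\<close>
  have "bij_betw f (W - covered G A) P"
  proof (rule bij_betwI')
    fix x y assume xy: "x \<in> W - covered G A" "y \<in> W - covered G A"
    show "(f x = f y) = (x = y)"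
    proof
      assume "f x = f y"
      then have "(x, y) \<in> R" using xy eqv unfolding f_def by (metis DiffD1 eq_equiv_class)
      then show "x = y" using xy A by (auto simp: R_def)
    qed simp
  next
    fix x assume "x \<in> W - covered G A"
    then show "f x \<in> P" using fin by blast
  next
    fix K assume K: "K \<in> P"
    have "K \<inter> covered G A \<noteq> K" using even_in[OF K Am(1)] oddK[OF K] by metis
    then obtain x where x: "x \<in> K" "x \<notin> covered G A" by blast
    then have "x \<in> W" using K U by blast
    moreover have "K = f x"
    proof -
      have "K \<inter> f x \<noteq> {}" using x fin[OF \<open>x \<in> W\<close>] by blast
      then show ?thesis using quotient_disj[OF eqv] K fin[OF \<open>x \<in> W\<close>] unfolding P_def by blast
    qed
    ultimately show "\<exists>x\<in>W - covered G A. K = f x" using x by blast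
  qed
  then have "card P = card (W - covered G A)" using bij_betw_same_card by metis
  also have "\<dots> = card W - 2 * card A"
    using card_Diff_subset[of "covered G A" W] covered_subset[OF Am(1)] W card_covered[OF Am(1)] finite_subset by metis
  finally have "card P + 2 * matching_number G W = card W"
    using card_mono[OF W covered_subset[OF Am(1)]] card_covered[OF Am(1)] Am(2) by simp
  then show ?thesis using U dj oddK edge by blast
qed

text \<open>A vertex covered by every maximum matching is moved to \<open>S\<close>, which lowers
  the matching number by one; both sides of the formula adjust equally. When no such vertex is left,
  Gallai's partition applies with \<open>S\<close> empty.\<close>

lemma tutte_berge:
  "finite W \<Longrightarrow> \<exists>S P. S \<subseteq> W \<and> \<Union>P = W - S \<and> disjoint P \<and> (\<forall>K\<in>P. odd (card K)) \<and>
    (\<forall>e\<in>edges G. ends G e \<subseteq> W - S \<longrightarrow> (\<exists>K\<in>P. ends G e \<subseteq> K)) \<and>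
    card P + 2 * matching_number G W = card S + card W"
proof (induction "card W" arbitrary: W rule: less_induct)
  case less
  show ?case
  proof (cases "\<forall>w\<in>W. \<exists>B. max_matching W B \<and> w \<notin> covered G B")
    case True
    have "\<exists>P. \<Union>P = W \<and> disjoint P \<and> (\<forall>K\<in>P. odd (card K)) \<and>
      (\<forall>e\<in>edges G. ends G e \<subseteq> W \<longrightarrow> (\<exists>K\<in>P. ends G e \<subseteq> K)) \<and> card P + 2 * matching_number G W = card W"
      by (rule gallai_partition[OF less.prems]) (rule bspec[OF True])
    then obtain P where "\<Union>P = W \<and> disjoint P \<and> (\<forall>K\<in>P. odd (card K)) \<and>
      (\<forall>e\<in>edges G. ends G e \<subseteq> W \<longrightarrow> (\<exists>K\<in>P. ends G e \<subseteq> K)) \<and> card P + 2 * matching_number G W = card W"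
      by (elim exE) (rule that)
    then show ?thesis by (intro exI[of _ "{}"] exI[of _ P]) simp
  next
    case False
    then obtain w where w: "w \<in> W" "\<And>B. max_matching W B \<Longrightarrow> w \<in> covered G B" by blast
    define U where "U = W - {w}"
    have U: "finite U" "card W = Suc (card U)" using less.prems card.remove[OF less.prems w(1)] by (auto simp: U_def)
    have nu: "matching_number G W = Suc (matching_number G U)"
    proof (rule antisym)
      obtain A where A: "matching_in G W A" "card A = matching_number G W" using matching_number_attained by blast
      then have "w \<in> covered G A" using w(2) by (simp add: max_matching_def)
      then obtain e where e: "e \<in> A" "w \<in> ends G e" by (auto simp: covered_def)
      have "matching_in G U (A - {e})" using A(1) e unfolding matching_in_def U_def by blast
      then have "card (A - {e}) \<le> matching_number G U" by (rule matching_number_ge)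
      then show "matching_number G W \<le> Suc (matching_number G U)"
        using card.remove[OF matching_finite[OF A(1)] e(1)] A(2) by simp
    next
      obtain A where A: "matching_in G U A" "card A = matching_number G U" using matching_number_attained by blast
      have AW: "matching_in G W A" using A(1) by (auto simp: matching_in_def U_def)
      have "w \<notin> covered G A" using covered_subset[OF A(1)] by (auto simp: U_def)
      then have "\<not> max_matching W A" using w(2) by blast
      then have "card A \<noteq> matching_number G W" using AW by (simp add: max_matching_def)
      then show "Suc (matching_number G U) \<le> matching_number G W" using matching_number_ge[OF AW] A(2) by simp
    qed
    obtain S P where SP: "S \<subseteq> U" "\<Union>P = U - S" "disjoint P" "\<forall>K\<in>P. odd (card K)"
      "\<forall>e\<in>edges G. ends G e \<subseteq> U - S \<longrightarrow> (\<exists>K\<in>P. ends G e \<subseteq> K)"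
      "card P + 2 * matching_number G U = card S + card U"
      using less.hyps[of U] U by auto
    have "card (insert w S) = Suc (card S)" using SP(1) U(1) finite_subset by (subst card_insert_disjoint) (auto simp: U_def)
    then have c: "card P + 2 * matching_number G W = card (insert w S) + card W" using SP(6) U(2) nu by simp
    have eq: "W - insert w S = U - S" by (auto simp: U_def)
    have "insert w S \<subseteq> W" using SP(1) w(1) by (auto simp: U_def)
    then show ?thesis using SP(2-5) c unfolding eq[symmetric] by metis
  qed
qed

lemma odd_partition_if_no_perfect_matching:
  assumes W: "finite W" "even (card W)" and no: "\<And>A. matching_in G W A \<Longrightarrow> covered G A \<noteq> W"
  obtains S P where "S \<subseteq> W" "\<Union>P = W - S" "disjoint P" "\<And>K. K \<in> P \<Longrightarrow> odd (card K)"
    "\<And>e. e \<in> edges G \<Longrightarrow> ends G e \<subseteq> W - S \<Longrightarrow> \<exists>K\<in>P. ends G e \<subseteq> K" "card S + 2 \<le> card P"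
proof -
  obtain S P where SP: "S \<subseteq> W \<and> \<Union>P = W - S \<and> disjoint P \<and> (\<forall>K\<in>P. odd (card K)) \<and>
    (\<forall>e\<in>edges G. ends G e \<subseteq> W - S \<longrightarrow> (\<exists>K\<in>P. ends G e \<subseteq> K)) \<and>
    card P + 2 * matching_number G W = card S + card W" using tutte_berge[OF W(1)] by blast
  obtain A where A: "matching_in G W A" "card A = matching_number G W" using matching_number_attained by blast
  have "card (covered G A) < card W"
    using covered_subset[OF A(1)] no[OF A(1)] W(1) by (intro psubset_card_mono) auto
  then have "2 * matching_number G W < card W" using card_covered[OF A(1)] A(2) by simp
  \<comment> \<open>A maximum matching leaves an even number of vertices uncovered, so a positive
    deficiency is at least 2.\<close>
  then have "2 * matching_number G W + 2 \<le> card W" using W(2) by (auto elim!: evenE)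
  then have "card S + 2 \<le> card P" using SP by linarith
  show ?thesis by (rule that[of S P]) (use SP \<open>card S + 2 \<le> card P\<close> in simp_all)
qed

end

subsection \<open>Cubic graphs with a Hamiltonian cycle\<close>

lemma third_edge:
  assumes "finite I" "card I = 3" "a \<in> I" "b \<in> I" "a \<noteq> b" "r \<in> I" "s \<in> I" "r \<notin> {a, b}" "s \<notin> {a, b}"
  shows "r = s"
proof -
  have "card (I - {a, b}) = 1" using assms by (subst card_Diff_subset) auto
  moreover have "r \<in> I - {a, b}" "s \<in> I - {a, b}" using assms by auto
  ultimately show ?thesis by (metis card_1_singletonE singletonD)
qed

lemma finite_incident: "finite_loopless_graph G \<Longrightarrow> finite (incident_edges G v)"
  by (simp add: incident_edges_def finite_loopless_graph_def)

lemma medge_incident: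
  assumes "perfect_matching G M" "v \<in> verts G"
  shows "medge G M v \<in> incident_edges G v"
  using medge[OF assms] medge_edges[OF assms] by (simp add: incident_edges_def)

lemma cubic_complement_pm:
  assumes G: "finite_loopless_graph G" and M: "perfect_matching G M" and N: "perfect_matching G N" and "M \<inter> N = {}"
    and deg: "\<And>v. v \<in> verts G \<Longrightarrow> card (incident_edges G v) = 3"
  shows "perfect_matching G (edges G - M - N)"
proof -
  have "\<exists>!e. e \<in> edges G - M - N \<and> v \<in> ends G e" if v: "v \<in> verts G" for v
  proof -
    have ne: "medge G M v \<noteq> medge G N v" using medge(1)[OF M v] medge(1)[OF N v] assms(4) by auto
    have eq: "{e \<in> edges G - M - N. v \<in> ends G e} = incident_edges G v - {medge G M v, medge G N v}"
      using medge_eqI[OF M v] medge_eqI[OF N v] medge(1)[OF M v] medge(1)[OF N v] by (auto simp: incident_edges_def)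
    have "card {e \<in> edges G - M - N. v \<in> ends G e} = 1"
      unfolding eq using deg[OF v] ne medge_incident[OF M v] medge_incident[OF N v] finite_incident[OF G]
      by (subst card_Diff_subset) auto
    then obtain e where e: "{e \<in> edges G - M - N. v \<in> ends G e} = {e}" by (rule card_1_singletonE)
    have "d \<in> edges G - M - N \<and> v \<in> ends G d \<longleftrightarrow> d = e" for d
      using arg_cong[OF e, of "\<lambda>S. d \<in> S"] by simp
    then show ?thesis by simp
  qed
  then show ?thesis by (auto simp: perfect_matching_def)
qed

locale ham_cubic = ham_cycle +
  fixes L
  assumes L: "perfect_matching G L" and LE: "edges G = M \<union> N \<union> L" and Ld: "L \<inter> (M \<union> N) = {}"
begin

definition l :: "nat \<Rightarrow> nat" where "l i = the_inv_into {..<n} c (mate G L (c i))"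

lemma l_props:
  assumes "i < n" shows "l i < n" "c (l i) = mate G L (c i)" "l i \<noteq> i" "l (l i) = i"
proof -
  have inj: "inj_on c {..<n}" and im: "c ` {..<n} = verts G" using bij by (auto simp: bij_betw_def)
  have v: "mate G L (c j) \<in> c ` {..<n}" if "j < n" for j unfolding im using mate(3)[OF G L c_in[OF that]] .
  have cl: "c (l j) = mate G L (c j)" if "j < n" for j unfolding l_def by (rule f_the_inv_into_f[OF inj v[OF that]])
  have ll: "l j < n" if "j < n" for j unfolding l_def using the_inv_into_into[OF inj v[OF that] subset_refl] by simp
  show "l i < n" "c (l i) = mate G L (c i)" using cl ll assms by auto
  show "l i \<noteq> i" using mate(2)[OF G L c_in[OF assms]] cl[OF assms] by auto
  have "c (l (l i)) = c i" using cl[OF ll[OF assms]] cl[OF assms] medge_mate(2)[OF G L c_in[OF assms]] by simp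
  then show "l (l i) = i" using c_eq[OF ll[OF ll[OF assms]] assms] by simp
qed

lemma ends_L: "i < n \<Longrightarrow> ends G (medge G L (c i)) = {c i, c (l i)}"
  using mate(1)[OF G L c_in] l_props(2) by simp

lemma medge_L_l: "i < n \<Longrightarrow> medge G L (c (l i)) = medge G L (c i)"
  using l_props(2) medge_mate(1)[OF G L c_in] by simp

lemma medge_L: "i < n \<Longrightarrow> medge G L (c i) \<in> edges G - M - N" "i < n \<Longrightarrow> medge G L (c i) \<in> L"
  using medge(1)[OF L c_in] LE Ld by blast+

lemma medge_L_eq: "i < n \<Longrightarrow> j < n \<Longrightarrow> medge G L (c i) = medge G L (c j) \<Longrightarrow> i = j \<or> i = l j"
  using ends_L[of i] ends_L[of j] c_eq l_props(1) by (auto simp: doubleton_eq_iff)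

lemma medge_cover:
  assumes X: "perfect_matching G X" and I: "I \<subseteq> {..<n}"
    and cov: "\<And>i. i < n \<Longrightarrow> \<exists>j\<in>I. c i = c j \<or> c i = mate G X (c j)"
  shows "medge G X ` c ` I = X"
proof
  show "medge G X ` c ` I \<subseteq> X" using medge(1)[OF X c_in] I by auto
  show "X \<subseteq> medge G X ` c ` I"
  proof
    fix e assume "e \<in> X"
    then obtain v where v: "v \<in> verts G" "e = medge G X v" using pm_eq_medge[OF G X] by blast
    then obtain i where i: "i < n" "v = c i" using c_ex by blast
    obtain j where j: "j \<in> I" "c i = c j \<or> c i = mate G X (c j)" using cov[OF i(1)] by blast
    have "medge G X (c i) = medge G X (c j)" using j I medge_mate(1)[OF G X c_in[of j]] by auto
    then show "e \<in> medge G X ` c ` I" using v i j by blast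
  qed
qed

text \<open>Presents the graph in cycle coordinates, with \<open>A\<close> holding one end of each
  chord. Recognising the graph is thereby reduced to the values of \<open>l\<close>.\<close>

lemma iso_list:
  assumes m: "n = 2 * m" and A: "length A = m" "set A \<subseteq> {..<n}" "set A \<union> l ` set A = {..<n}"
  shows "graph_iso G (graph_of_list (map (\<lambda>i. (2 * i, 2 * i + 1)) [0..<m] @
    map (\<lambda>i. (2 * i + 1, (2 * i + 2) mod n)) [0..<m] @ map (\<lambda>a. (a, l a)) A))" (is "graph_iso G (graph_of_list ?K)")
proof -
  define es where "es = map (\<lambda>i. medge G M (c (2 * i))) [0..<m] @ map (\<lambda>i. medge G N (c (2 * i + 1))) [0..<m] @ map (\<lambda>a. medge G L (c a)) A"
  have M': "medge G M ` c ` ((\<lambda>i. 2 * i) ` {..<m}) = M"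
  proof (rule medge_cover[OF M])
    fix i assume i: "i < n"
    show "\<exists>j\<in>(\<lambda>i. 2 * i) ` {..<m}. c i = c j \<or> c i = mate G M (c j)"
    proof (cases "even i")
      case True
      then show ?thesis using i m by (intro bexI[of _ i]) (auto elim!: evenE)
    next
      case False
      then have "c i = mate G M (c (i - 1))" using mate_M[of "i - 1"] i by (auto elim!: oddE)
      then show ?thesis using False i m by (intro bexI[of _ "i - 1"]) (auto elim!: oddE)
    qed
  qed (use m in auto)
  have N': "medge G N ` c ` ((\<lambda>i. 2 * i + 1) ` {..<m}) = N"
  proof (rule medge_cover[OF N])
    fix i assume i: "i < n"
    show "\<exists>j\<in>(\<lambda>i. 2 * i + 1) ` {..<m}. c i = c j \<or> c i = mate G N (c j)"
    proof (cases "odd i")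
      case True
      then show ?thesis using i m by (intro bexI[of _ i]) (auto elim!: oddE)
    next
      case False
      show ?thesis
      proof (cases "i = 0")
        case True
        have "n - 1 \<in> (\<lambda>i. 2 * i + 1) ` {..<m}" using n_pos m by (intro image_eqI[of _ _ "m - 1"]) auto
        then show ?thesis using mate_N_last True by metis
      next
        case f: False
        then have "c i = mate G N (c (i - 1))" using mate_N[of "i - 1"] i False by auto
        moreover have "i - 1 \<in> (\<lambda>i. 2 * i + 1) ` {..<m}"
          using False f i m by (intro image_eqI[of _ _ "i div 2 - 1"]) (auto elim!: evenE)
        ultimately show ?thesis by blast
      qed
    qed
  qed (use m in auto)
  have L': "medge G L ` c ` set A = L"
  proof (rule medge_cover[OF L A(2)])
    fix i assume "i < n"
    then have "i \<in> set A \<or> i \<in> l ` set A" using A(3) by blast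
    then show "\<exists>j\<in>set A. c i = c j \<or> c i = mate G L (c j)" using l_props(2) A(2) by auto
  qed
  have set_es: "set es = edges G"
  proof -
    have "set es = medge G M ` c ` ((\<lambda>i. 2 * i) ` {..<m}) \<union> medge G N ` c ` ((\<lambda>i. 2 * i + 1) ` {..<m}) \<union> medge G L ` c ` set A"
      unfolding es_def set_append set_map image_image atLeast_upt[symmetric] Un_assoc ..
    then show ?thesis unfolding M' N' L' LE .
  qed
  have len: "length es = 3 * m" using A(1) by (simp add: es_def)
  have cm: "card X = m" if "perfect_matching G X" for X
    using card_verts_pm[OF G that] n_eq m by simp
  have "card (edges G) = card M + card N + card L"
  proof -
    have fin: "finite M" "finite N" "finite L" using pm_finite[OF G] M N L by auto
    have "card (M \<union> N \<union> L) = card (M \<union> N) + card L" using fin Ld by (intro card_Un_disjoint) auto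
    also have "card (M \<union> N) = card M + card N" using fin disj by (intro card_Un_disjoint) auto
    finally show ?thesis unfolding LE .
  qed
  \<comment> \<open>The list \<open>es\<close> has length \<open>3 * m\<close> and enumerates three
    disjoint matchings of size \<open>m\<close>, so it has no repetitions.\<close>
  then have "card (set es) = length es" using cm[OF M] cm[OF N] cm[OF L] len set_es by simp
  then have dist: "distinct es" by (rule card_distinct)
  have lenK: "length ?K = 3 * m" using A(1) by simp
  have vK: "fst ` set ?K \<union> snd ` set ?K = {..<n}"
  proof
    have "x \<in> fst ` set ?K \<union> snd ` set ?K" if "x < n" for x
    proof -
      define y where "y = x div 2"
      have p: "(2 * y, 2 * y + 1) \<in> set ?K" using that m by (auto simp: y_def)
      have h: "2 * y \<in> fst ` set ?K" "2 * y + 1 \<in> snd ` set ?K"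
        using image_eqI[OF _ p, of "2 * y" fst] image_eqI[OF _ p, of "2 * y + 1" snd] by simp_all
      have "x = 2 * y \<or> x = 2 * y + 1" unfolding y_def by presburger
      then show ?thesis
      proof
        assume "x = 2 * y"
        show ?thesis unfolding \<open>x = 2 * y\<close> by (rule UnI1[OF h(1)])
      next
        assume "x = 2 * y + 1"
        show ?thesis unfolding \<open>x = 2 * y + 1\<close> by (rule UnI2[OF h(2)])
      qed
    qed
    then show "{..<n} \<subseteq> fst ` set ?K \<union> snd ` set ?K" by blast
    show "fst ` set ?K \<union> snd ` set ?K \<subseteq> {..<n}" using m A(2) l_props(1) n_pos by auto
  qed
  show ?thesis
  proof (rule iso_listI[OF dist set_es])
    show "length es = length ?K" using len lenK by simp
    show "bij_betw c (fst ` set ?K \<union> snd ` set ?K) (verts G)" unfolding vK by (rule bij)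
    fix i assume i: "i < length ?K"
    consider "i < m" | j where "i = m + j" "j < m" | j where "i = m + (m + j)" "j < m"
    proof -
      have "i < 3 * m" using i lenK by simp
      then have "i < m \<or> i = m + (i - m) \<and> i - m < m \<or> i = m + (m + (i - 2 * m)) \<and> i - 2 * m < m" by linarith
      then show ?thesis using that by blast
    qed
    then show "ends G (es ! i) = {c (fst (?K ! i)), c (snd (?K ! i))}"
    proof cases
      case 1
      then show ?thesis using ends_M[of "2 * i"] m by (simp add: es_def nth_append)
    next
      case 2
      have "ends G (medge G N (c (2 * j + 1))) = {c (2 * j + 1), c ((2 * j + 2) mod n)}"
      proof (cases "2 * j + 2 < n")
        case True
        then show ?thesis using ends_N[of "2 * j + 1"] by simp
      next
        case False
        then have "2 * j + 2 = n" using 2 m by simp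
        then show ?thesis using ends_N_last by (metis Suc_1 add_Suc_right add_diff_cancel_right' diff_Suc_1 mod_self plus_1_eq_Suc add.commute)
      qed
      then show ?thesis using 2 by (simp add: es_def nth_append)
    next
      case 3
      have "A ! j \<in> set A" using A(1) 3 by simp
      then have "A ! j < n" using A(2) by auto
      then show ?thesis using ends_L[of "A ! j"] 3 A(1) by (simp add: es_def nth_append)
    qed
  qed
qed

end

lemma balanced_cubic_incident: "balanced G \<Longrightarrow> degree G = 3 \<Longrightarrow> v \<in> verts G \<Longrightarrow> card (incident_edges G v) = 3"
  using card_incident by metis

lemma cubic_ham_cubic:
  assumes B: "balanced G" "degree G = 3" and H: "ham_cycle G M N c n"
  shows "ham_cubic G M N c n (edges G - M - N)"
proof -
  interpret ham_cycle G M N c n by fact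
  show ?thesis
  proof
    show "perfect_matching G (edges G - M - N)"
      using cubic_complement_pm[OF G M N disj balanced_cubic_incident[OF B]] .
    show "edges G = M \<union> N \<union> (edges G - M - N)" using pm_subset[OF M] pm_subset[OF N] by blast
    show "(edges G - M - N) \<inter> (M \<union> N) = {}" by blast
  qed
qed

text \<open>There are five perfect matchings: \<open>M\<close>, \<open>N\<close>, the chords
  \<open>L\<close>, and two more. Each good set of chords yields a perfect matching whose chords are
  exactly those, and every chord is a double edge already used by \<open>L\<close>. So there are
  just two good sets, they partition the positions, and \<open>good_config\<close> lists what
  remains.\<close>

lemma cubic_one_single_pm:
  fixes G :: "('v, 'e) multigraph"
  assumes B: "balanced G" and deg: "degree G = 3" and one: "card (pms1 G) = 1" and n6: "6 \<le> card (verts G)"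
  shows "graph_iso G (graph_of_list C1_list) \<or> graph_iso G (graph_of_list T2_list)"
proof -
  have G: "finite_loopless_graph G" using balanced_graph[OF B] .
  obtain M where M1: "pms1 G = {M}" using one by (rule card_1_singletonE)
  then have Mp: "M \<in> pms1 G" "perfect_matching G M" by (auto simp: pms1_def)
  have c2: "card (pms2 G) = 4" using pms2_card[OF B] deg one by simp
  then obtain N where N2: "N \<in> pms2 G" by (metis card.empty equals0I zero_neq_numeral)
  then have Np: "perfect_matching G N" by (simp add: pms2_def)
  have "M \<noteq> N" using Mp(1) N2 pms12_disjoint[OF B] by blast
  obtain v where v: "v \<in> verts G" using B by (auto simp: balanced_def)
  obtain c n where H: "ham_cycle G M N c n"
    using ham_cycle_exists[OF G Mp(2) Np pms1_irreducible[OF B Mp(1) Np \<open>M \<noteq> N\<close>] v] by blast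
  define L where "L = edges G - M - N"
  have "ham_cubic G M N c n L" using cubic_ham_cubic[OF B deg H] by (simp add: L_def)
  then interpret ham_cubic G M N c n L .
  have n: "6 \<le> n" using n6 n_eq by simp
  \<comment> \<open>If a chord were single, \<open>L\<close> would consist of single edges and equal
    \<open>M\<close>, from which it is disjoint.\<close>
  have pc2: "pcount G (medge G L (c x)) = 2" if x: "x < n" for x
  proof -
    have "medge G L (c x) \<notin> singles G"
    proof
      assume "medge G L (c x) \<in> singles G"
      then have "L \<in> pms1 G" using singles_in_pms1[OF B _ L medge_L(2)[OF x]] by blast
      then have "L = M" using M1 by blast
      then show False using medge_L[OF x] by blast
    qed
    then show ?thesis using card_pms_at_edge[OF _ B] medge_L(1)[OF x] by blast
  qed
  interpret chord_involution n l
  proof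
    fix i assume "i < n"
    then show "l i < n" "l i \<noteq> i" "l (l i) = i" using l_props by auto
  next
    fix a assume a: "a < l a" "l a < n" "odd (l a + a)"
    then have an: "a < n" by simp
    have "odd (l a - a)" using a by (simp add: even_diff_nat)
    then show "(even a \<longrightarrow> a = 0 \<and> l a = n - 1) \<and> (odd a \<longrightarrow> l a = a + 1)"
      using odd_chord_single[OF B Mp(1) _ ends_L[OF an] _ a(1,2)] medge_L(1)[OF an] by blast
  next
    fix a b assume ab: "a < b" "b < l a" "l a < l b" "l b < n" "even (l a + a)" "even (l b + b)" "odd (a + b)"
    then have an: "a < n" "b < n" by auto
    have "even (l a - a)" "even (l b - b)" "odd (b - a)" using ab by (auto simp: even_diff_nat)
    then show "(even a \<longrightarrow> a = 0 \<and> l a = b + 1 \<and> l b = n - 1) \<and> (odd a \<longrightarrow> b = a + 1 \<and> l b = l a + 1)"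
      using crossing_single[OF B Mp(1) _ ends_L[OF an(1)] _ _ ends_L[OF an(2)] ab(1-4)] medge_L(1)[OF an(1)] medge_L(1)[OF an(2)] by blast
  qed
  have ex: "\<exists>Q. perfect_matching G Q \<and> medge G L ` c ` Z \<subseteq> Q \<and> Q \<subseteq> M \<union> N \<union> medge G L ` c ` Z" if "good_chords n l Z" for Z
  proof -
    have sub: "medge G M ` c ` I \<subseteq> M" "medge G N ` c ` I \<subseteq> N" if "I \<subseteq> {..<n}" for I
      using medge(1)[OF Mp(2) c_in] medge(1)[OF Np c_in] that by blast+
    have subM: "{e} \<union> medge G M ` c ` I \<union> medge G N ` c ` J \<subseteq> M \<union> N \<union> {e}"
      if "I \<subseteq> {..<n}" "J \<subseteq> {..<n}" for I J e using sub(1)[OF that(1)] sub(2)[OF that(2)] by blast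
    have subM2: "{e, f} \<union> medge G M ` c ` I \<union> medge G N ` c ` J \<subseteq> M \<union> N \<union> {e, f}"
      if "I \<subseteq> {..<n}" "J \<subseteq> {..<n}" for I J e f using sub(1)[OF that(1)] sub(2)[OF that(2)] by blast
    from that show ?thesis unfolding good_chords_def
    proof (elim disjE exE conjE)
      fix a assume a: "a < l a" "l a < n" "odd (l a + a)" "Z = {a, l a}"
      define e where "e = medge G L (c a)"
      have an: "a < n" using a by simp
      have e: "e \<in> edges G" "ends G e = {c a, c (l a)}" using medge_L(1)[OF an] ends_L[OF an] by (auto simp: e_def)
      have Ze: "medge G L ` c ` Z = {e}" using medge_L_l[OF an] by (simp add: a(4) e_def)
      have od: "odd (l a - a)" using a by (simp add: even_diff_nat)
      obtain I J where IJ: "perfect_matching G ({e} \<union> medge G M ` c ` I \<union> medge G N ` c ` J)" "I \<subseteq> {..<n}" "J \<subseteq> {..<n}"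
      proof (cases "even a")
        case True
        show ?thesis by (rule that[OF odd_chord_pm(1)[OF e a(1,2) od True]]) (use a in auto)
      next
        case False
        show ?thesis by (rule that[OF odd_chord_pm(2)[OF e a(1,2) od False]]) (use a in auto)
      qed
      show ?thesis unfolding Ze using IJ(1) subM[OF IJ(2,3)] by blast
    next
      fix a b assume a: "a < b" "b < l a" "l a < l b" "l b < n" "even (l a + a)" "even (l b + b)" "odd (a + b)" "Z = {a, b, l a, l b}"
      define e f where "e = medge G L (c a)" and "f = medge G L (c b)"
      have an: "a < n" "b < n" using a by auto
      have e: "e \<in> edges G" "ends G e = {c a, c (l a)}" using medge_L(1)[OF an(1)] ends_L[OF an(1)] by (auto simp: e_def)
      have f: "f \<in> edges G" "ends G f = {c b, c (l b)}" using medge_L(1)[OF an(2)] ends_L[OF an(2)] by (auto simp: f_def)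
      have Ze: "medge G L ` c ` Z = {e, f}" using medge_L_l[OF an(1)] medge_L_l[OF an(2)] by (auto simp add: a(8) e_def f_def)
      have od: "even (l a - a)" "even (l b - b)" "odd (b - a)" using a by (auto simp: even_diff_nat)
      obtain I J where IJ: "perfect_matching G ({e, f} \<union> medge G M ` c ` I \<union> medge G N ` c ` J)" "I \<subseteq> {..<n}" "J \<subseteq> {..<n}"
      proof (cases "even a")
        case True
        show ?thesis by (rule that[OF crossing_pm(1)[OF e f a(1-4) od True]]) (use a in auto)
      next
        case False
        show ?thesis by (rule that[OF crossing_pm(2)[OF e f a(1-4) od False]]) (use a in auto)
      qed
      show ?thesis unfolding Ze using IJ(1) subM2[OF IJ(2,3)] by blast
    qed
  qed
  have goodn: "Z \<subseteq> {..<n}" "finite Z" "card Z \<le> 4" "Z \<noteq> {}" if "good_chords n l Z" for Z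
    using that unfolding good_chords_def
    by (elim disjE exE conjE; auto simp: card_insert_if)+
  have memQ: "medge G L (c x) \<in> Q \<longleftrightarrow> x \<in> Z"
    if Z: "good_chords n l Z" and Q: "medge G L ` c ` Z \<subseteq> Q" "Q \<subseteq> M \<union> N \<union> medge G L ` c ` Z" and x: "x < n" for Z Q x
  proof
    assume "medge G L (c x) \<in> Q"
    then obtain y where y: "y \<in> Z" "medge G L (c x) = medge G L (c y)" using Q(2) medge_L(1)[OF x] by blast
    then have "x = y \<or> x = l y" using medge_L_eq[OF x] goodn(1)[OF Z] by blast
    then show "x \<in> Z" using good_closed[OF Z] y(1) by blast
  qed (use Q(1) in blast)
  \<comment> \<open>The matchings \<open>Q\<close> and \<open>Q'\<close> of two different good sets
    complete the list of all five. Since a chord lies in \<open>L\<close> and in exactly one further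
    perfect matching, it belongs to exactly one of them.\<close>
  have R: "Z \<inter> Z' = {} \<and> Z \<union> Z' = {..<n}" if Z: "good_chords n l Z" "good_chords n l Z'" "Z \<noteq> Z'" for Z Z'
  proof -
    obtain Q where Q: "perfect_matching G Q" "medge G L ` c ` Z \<subseteq> Q" "Q \<subseteq> M \<union> N \<union> medge G L ` c ` Z" using ex[OF Z(1)] by blast
    obtain Q' where Q': "perfect_matching G Q'" "medge G L ` c ` Z' \<subseteq> Q'" "Q' \<subseteq> M \<union> N \<union> medge G L ` c ` Z'" using ex[OF Z(2)] by blast
    note q = memQ[OF Z(1) Q(2,3)] and q' = memQ[OF Z(2) Q'(2,3)]
    have neL: "P \<noteq> L \<and> P \<noteq> M \<and> P \<noteq> N" if Y: "good_chords n l Y" and P: "\<And>x. x < n \<Longrightarrow> medge G L (c x) \<in> P \<longleftrightarrow> x \<in> Y" for Y P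
    proof -
      have "\<not> {..<n} \<subseteq> Y" using card_mono[OF goodn(2)[OF Y], of "{..<n}"] goodn(3)[OF Y] n by auto
      then obtain x where "x < n" "x \<notin> Y" by auto
      then have "P \<noteq> L" using P[of x] medge_L(2)[of x] by auto
      obtain y where y: "y \<in> Y" using goodn(4)[OF Y] by blast
      then have "y < n" using goodn(1)[OF Y] by blast
      then have "P \<noteq> M \<and> P \<noteq> N" using P[of y] y medge_L(1)[of y] by auto
      then show ?thesis using \<open>P \<noteq> L\<close> by blast
    qed
    have "Q \<noteq> Q'" using q q' goodn(1)[OF Z(1)] goodn(1)[OF Z(2)] Z(3) by blast
    moreover have "L \<noteq> M" "L \<noteq> N" using medge_L[of 0] n by auto
    moreover have nq: "Q \<noteq> L \<and> Q \<noteq> M \<and> Q \<noteq> N" "Q' \<noteq> L \<and> Q' \<noteq> M \<and> Q' \<noteq> N"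
      by (rule neL[OF Z(1) q]; assumption) (rule neL[OF Z(2) q']; assumption)
    ultimately have c5: "card {M, N, L, Q, Q'} = 5" using \<open>M \<noteq> N\<close> by (simp add: card_insert_if) blast
    have sub: "{M, N, L, Q, Q'} \<subseteq> {P. perfect_matching G P}" using Mp Np L Q(1) Q'(1) by auto
    have "card {P. perfect_matching G P} = 5" using card_eq_pms12[OF B] one c2 by simp
    then have all: "{P. perfect_matching G P} = {M, N, L, Q, Q'}"
      using card_subset_eq[OF finite_pms(1)[OF G] sub] c5 by simp
    have "(x \<in> Z) \<noteq> (x \<in> Z')" if x: "x < n" for x
    proof -
      define e where "e = medge G L (c x)"
      have e: "e \<notin> M" "e \<notin> N" "e \<in> L" using medge_L[OF x] by (auto simp: e_def)
      have eq: "{P. perfect_matching G P \<and> e \<in> P} = {P \<in> {M, N, L, Q, Q'}. e \<in> P}" using all by blast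
      have c2: "card {P \<in> {M, N, L, Q, Q'}. e \<in> P} = 2" using pc2[OF x] unfolding pcount_def e_def[symmetric] eq .
      show ?thesis
      proof (cases "x \<in> Z"; cases "x \<in> Z'")
        assume "x \<in> Z" "x \<in> Z'"
        then have "{P \<in> {M, N, L, Q, Q'}. e \<in> P} = {L, Q, Q'}" using q[OF x] q'[OF x] e by (auto simp: e_def)
        moreover have "card {L, Q, Q'} = 3" using \<open>Q \<noteq> Q'\<close> nq by (simp add: card_insert_if) blast
        ultimately show ?thesis using c2 by simp
      next
        assume "x \<notin> Z" "x \<notin> Z'"
        then have "{P \<in> {M, N, L, Q, Q'}. e \<in> P} = {L}" using q[OF x] q'[OF x] e by (auto simp: e_def)
        then show ?thesis using c2 by simp
      qed auto
    qed
    then have x: "\<And>x. x < n \<Longrightarrow> (x \<in> Z) = (x \<notin> Z')" by blast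
    show ?thesis
    proof (intro conjI equalityI subsetI)
      fix y assume "y \<in> Z \<inter> Z'"
      then show "y \<in> {}" using goodn(1)[OF Z(1)] x[of y] by auto
    next
      fix y assume "y \<in> Z \<union> Z'"
      then show "y \<in> {..<n}" using goodn(1)[OF Z(1)] goodn(1)[OF Z(2)] by auto
    next
      fix y assume "y \<in> {..<n}"
      then show "y \<in> Z \<union> Z'" using x[of y] by auto
    qed auto
  qed
  obtain Z Z' where ZZ: "good_chords n l Z" "good_chords n l Z'" "Z \<inter> Z' = {}" "Z \<union> Z' = {..<n}"
    using good_cover[OF n R] by blast
  have fin: "graph_iso G (graph_of_list K)"
    if "n = 2 * m" "length A = m" "set A \<subseteq> {..<n}" "set A \<union> l ` set A = {..<n}"
      "map (\<lambda>a. (a, l a)) A = C" "n = k"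
      "iso_list_check p (map (\<lambda>i. (2 * i, 2 * i + 1)) [0..<m] @ map (\<lambda>i. (2 * i + 1, (2 * i + 2) mod k)) [0..<m] @ C) K"
    for m A p K C k
  proof (rule graph_iso_trans[OF _ iso_list_check[OF that(7)]])
    show "graph_iso G (graph_of_list (map (\<lambda>i. (2 * i, 2 * i + 1)) [0..<m] @
      map (\<lambda>i. (2 * i + 1, (2 * i + 2) mod k)) [0..<m] @ C))"
      unfolding that(5)[symmetric] that(6)[symmetric] by (rule iso_list[OF that(1-4)])
  qed
  have lt: "{..<6} = {0, 1, 2, 3, 4, 5 :: nat}" "{..<8} = {0, 1, 2, 3, 4, 5, 6, 7 :: nat}" by auto
  from good_config[OF n even_n ZZ] show ?thesis
  proof (elim disjE conjE)
    assume h: "n = 6" "l 0 = 5" "l 1 = 3" "l 2 = 4"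
    have chk: "iso_list_check [(0, 1), (1, 4), (2, 5), (3, 6), (4, 3), (5, 2)]
      (map (\<lambda>i. (2 * i, 2 * i + 1)) [0..<3] @ map (\<lambda>i. (2 * i + 1, (2 * i + 2) mod 6)) [0..<3] @ [(0, 5), (1, 3), (2, 4)]) C1_list"
      by code_simp
    have "graph_iso G (graph_of_list C1_list)"
      by (rule fin[OF _ _ _ _ _ h(1) chk, of "[0, 1, 2]"]) (use h lt in auto)
    then show ?thesis by blast
  next
    assume h: "n = 6" "l 1 = 2" "l 3 = 5" "l 0 = 4"
    have chk: "iso_list_check [(0, 3), (1, 2), (2, 1), (3, 4), (4, 5), (5, 6)]
      (map (\<lambda>i. (2 * i, 2 * i + 1)) [0..<3] @ map (\<lambda>i. (2 * i + 1, (2 * i + 2) mod 6)) [0..<3] @ [(1, 2), (3, 5), (0, 4)]) C1_list"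
      by code_simp
    have "graph_iso G (graph_of_list C1_list)"
      by (rule fin[OF _ _ _ _ _ h(1) chk, of "[1, 3, 0]"]) (use h lt in auto)
    then show ?thesis by blast
  next
    assume h: "n = 6" "l 3 = 4" "l 0 = 2" "l 1 = 5"
    have chk: "iso_list_check [(0, 5), (1, 6), (2, 3), (3, 2), (4, 1), (5, 4)]
      (map (\<lambda>i. (2 * i, 2 * i + 1)) [0..<3] @ map (\<lambda>i. (2 * i + 1, (2 * i + 2) mod 6)) [0..<3] @ [(3, 4), (0, 2), (1, 5)]) C1_list"
      by code_simp
    have "graph_iso G (graph_of_list C1_list)"
      by (rule fin[OF _ _ _ _ _ h(1) chk, of "[3, 0, 1]"]) (use h lt in auto)
    then show ?thesis by blast
  next
    assume h: "n = 8" "l 0 = 2" "l 1 = 7" "l 4 = 6" "l 3 = 5"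
    have chk: "iso_list_check [(0, 5), (1, 6), (2, 3), (3, 2), (4, 7), (5, 8), (6, 10), (7, 4)]
      (map (\<lambda>i. (2 * i, 2 * i + 1)) [0..<4] @ map (\<lambda>i. (2 * i + 1, (2 * i + 2) mod 8)) [0..<4] @ [(0, 2), (1, 7), (4, 6), (3, 5)]) T2_list"
      by code_simp
    have "graph_iso G (graph_of_list T2_list)"
      by (rule fin[OF _ _ _ _ _ h(1) chk, of "[0, 1, 4, 3]"]) (use h lt in auto)
    then show ?thesis by blast
  next
    assume h: "n = 8" "l 0 = 6" "l 5 = 7" "l 2 = 4" "l 1 = 3"
    have chk: "iso_list_check [(0, 2), (1, 3), (2, 5), (3, 6), (4, 4), (5, 10), (6, 7), (7, 8)]
      (map (\<lambda>i. (2 * i, 2 * i + 1)) [0..<4] @ map (\<lambda>i. (2 * i + 1, (2 * i + 2) mod 8)) [0..<4] @ [(0, 6), (5, 7), (2, 4), (1, 3)]) T2_list"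
      by code_simp
    have "graph_iso G (graph_of_list T2_list)"
      by (rule fin[OF _ _ _ _ _ h(1) chk, of "[0, 5, 2, 1]"]) (use h lt in auto)
    then show ?thesis by blast
  qed
qed

subsection \<open>Cubic graphs without single edges\<close>

lemma singles_empty:
  assumes B: "balanced G" and no: "pms1 G = {}" shows "singles G = {}"
proof (rule ccontr)
  assume "singles G \<noteq> {}"
  then obtain d where d: "d \<in> singles G" by blast
  then obtain P where "perfect_matching G P" "d \<in> P" using edge_in_pm[OF B, of d] by (auto simp: singles_def)
  then show False using singles_in_pms1[OF B d] no by blast
qed

text \<open>Exchanging parallel edges \<open>e\<close> and \<open>f\<close> pairs the two matchings
  through \<open>e\<close> with two through \<open>f\<close>. Each other edge of such a matching is
  thereby already used twice, so the two matchings through the third edge at \<open>v\<close> must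
  use the one remaining edge at every vertex, and they coincide.\<close>

lemma doubles_simple:
  assumes B: "balanced G" and deg: "degree G = 3" and no: "pms1 G = {}"
    and e: "e \<in> edges G" and f: "f \<in> edges G" and ef: "e \<noteq> f"
  shows "ends G e \<noteq> ends G f"
proof
  assume par: "ends G e = ends G f"
  have G: "finite_loopless_graph G" using balanced_graph[OF B] .
  obtain u v where uv: "ends G e = {u, v}" "u \<noteq> v" "u \<in> verts G" "v \<in> verts G" using graph_endsE[OF G e] .
  have sing: "singles G = {}" using singles_empty[OF B no] .
  have pc: "card {P. perfect_matching G P \<and> d \<in> P} = 2" if "d \<in> edges G" for d
    using card_pms_at_edge[OF that B] sing by (simp add: pcount_def)
  have inc3: "card (incident_edges G x) = 3" if "x \<in> verts G" for x using card_incident[OF B that] deg by simp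
  have fin: "finite (incident_edges G x)" for x using finite_incident[OF G] .
  define sw where "sw P = insert f (P - {e})" for P
  have sw: "perfect_matching G (sw P)" if P: "perfect_matching G P" "e \<in> P" for P
  proof -
    have ex: "\<exists>!d. d \<in> sw P \<and> x \<in> ends G d" if x: "x \<in> verts G" for x
    proof (cases "x \<in> {u, v}")
      case True
      have "d = e" if "d \<in> P" "x \<in> ends G d" for d
        using pm_unique[OF P(1) x that(1) P(2) that(2)] True uv(1) by blast
      then show ?thesis using True par uv(1) by (intro ex1I[of _ f]) (auto simp: sw_def)
    next
      case False
      then have nx: "x \<notin> ends G f" "x \<notin> ends G e" using par uv(1) by auto
      show ?thesis
      proof (rule ex1I[of _ "medge G P x"])
        have "medge G P x \<noteq> e" using medge(2)[OF P(1) x] nx(2) by auto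
        then show "medge G P x \<in> sw P \<and> x \<in> ends G (medge G P x)"
          using medge[OF P(1) x] by (simp add: sw_def)
        show "d = medge G P x" if d: "d \<in> sw P \<and> x \<in> ends G d" for d
        proof -
          have "d \<noteq> f" using d nx(1) by auto
          then have "d \<in> P" using d by (simp add: sw_def)
          then show ?thesis using medge_eqI[OF P(1) x] d by simp
        qed
      qed
    qed
    have "sw P \<subseteq> edges G" using pm_subset[OF P(1)] f by (auto simp: sw_def)
    then show ?thesis using ex by (simp add: perfect_matching_def)
  qed
  obtain P1 P2 where P12: "{P. perfect_matching G P \<and> e \<in> P} = {P1, P2}" "P1 \<noteq> P2"
    using pc[OF e] by (meson card_2_iff)
  have P: "perfect_matching G P" "e \<in> P" if "P = P1 \<or> P = P2" for P
  proof -
    have "P \<in> {P1, P2}" using that by simp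
    then show "perfect_matching G P" "e \<in> P" unfolding P12(1)[symmetric] by simp_all
  qed
  have ve: "e \<in> incident_edges G v" "f \<in> incident_edges G v" using uv(1) par e f by (auto simp: incident_edges_def)
  have ue: "e \<in> incident_edges G u" "f \<in> incident_edges G u" using uv(1) par e f by (auto simp: incident_edges_def)
  \<comment> \<open>The third edge at \<open>v\<close> lies in two perfect matchings, both of which
    avoid \<open>e\<close> and \<open>f\<close>.\<close>
  have "\<not> incident_edges G v \<subseteq> {e, f}" using card_mono[of "{e, f}" "incident_edges G v"] inc3[OF uv(4)] ef by auto
  then obtain h where h: "h \<in> incident_edges G v" "h \<notin> {e, f}" by blast
  then have hv: "h \<in> edges G" "v \<in> ends G h" by (auto simp: incident_edges_def)
  obtain R1 R2 where R12: "{P. perfect_matching G P \<and> h \<in> P} = {R1, R2}" "R1 \<noteq> R2"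
    using pc[OF hv(1)] by (meson card_2_iff)
  have R: "perfect_matching G R" "h \<in> R" if "R = R1 \<or> R = R2" for R
  proof -
    have "R \<in> {R1, R2}" using that by simp
    then show "perfect_matching G R" "h \<in> R" unfolding R12(1)[symmetric] by simp_all
  qed
  have vef: "v \<in> ends G e" "v \<in> ends G f" using uv(1) par by auto
  have Rno: "e \<notin> R" "f \<notin> R" if R': "R = R1 \<or> R = R2" for R
    using pm_unique[OF R(1)[OF R'] uv(4) R(2)[OF R'] _ hv(2)] vef h(2) by blast+
  have others: "{Q. perfect_matching G Q \<and> g \<in> Q} = {P, sw P}" if P': "P = P1 \<or> P = P2" and g: "g \<in> P" "g \<noteq> e" for P g
  proof -
    have gE: "g \<in> edges G" using pm_subset[OF P(1)[OF P']] g(1) by blast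
    have ne: "P \<noteq> sw P" using P(2)[OF P'] ef by (auto simp: sw_def)
    have sub: "{P, sw P} \<subseteq> {Q. perfect_matching G Q \<and> g \<in> Q}" using P[OF P'] sw[OF P[OF P']] g by (auto simp: sw_def)
    have "{P, sw P} = {Q. perfect_matching G Q \<and> g \<in> Q}"
      by (rule card_subset_eq[OF finite_pms(2)[OF G] sub]) (use pc[OF gE] ne in simp)
    then show ?thesis by simp
  qed
  have RP: "g \<notin> R" if R': "R = R1 \<or> R = R2" and P': "P = P1 \<or> P = P2" and g: "g \<in> P" for R P g
  proof (cases "g = e")
    case True
    then show ?thesis using Rno(1)[OF R'] by simp
  next
    case False
    show ?thesis
    proof
      assume "g \<in> R"
      then have "R \<in> {P, sw P}" using others[OF P' g False] R(1)[OF R'] by blast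
      then show False using Rno[OF R'] P(2)[OF P'] by (auto simp: sw_def)
    qed
  qed
  have PP: "g = e" if g: "g \<in> P1" "g \<in> P2" for g
  proof (rule ccontr)
    assume "g \<noteq> e"
    then have "P2 \<in> {P1, sw P1}" using others[of P1 g] g P[of P2] by blast
    then show False using P12(2) P[of P2] ef by (auto simp: sw_def)
  qed
  \<comment> \<open>At \<open>u\<close> and \<open>v\<close> the excluded edges are \<open>e\<close>
    and \<open>f\<close>; at any other vertex they are the edges of \<open>P1\<close> and
    \<open>P2\<close>, which differ because these matchings share only \<open>e\<close>. The third
    edge is left to both \<open>R1\<close> and \<open>R2\<close>.\<close>
  have eq: "medge G R1 x = medge G R2 x" if x: "x \<in> verts G" for x
  proof (cases "x \<in> {u, v}")
    case True
    have "medge G R x \<notin> {e, f}" if "R = R1 \<or> R = R2" for R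
      using Rno[OF that] medge(1)[OF R(1)[OF that] x] by auto
    moreover have "e \<in> incident_edges G x" "f \<in> incident_edges G x" using True ve ue by auto
    ultimately show ?thesis
      using third_edge[OF fin inc3[OF x] _ _ ef medge_incident[OF R(1) x] medge_incident[OF R(1) x], of R1 R2] by blast
  next
    case False
    let ?p = "medge G P1 x" and ?q = "medge G P2 x"
    have "?p \<noteq> ?q"
    proof
      assume "?p = ?q"
      then have "?p = e" using PP medge(1)[OF P(1)[of P1] x] medge(1)[OF P(1)[of P2] x] by simp
      then show False using medge(2)[OF P(1)[of P1] x] False uv(1) by simp
    qed
    moreover have "medge G R x \<notin> {?p, ?q}" if R': "R = R1 \<or> R = R2" for R
      using RP[OF R', of P1 ?p] RP[OF R', of P2 ?q] medge(1)[OF R(1)[OF R'] x]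
        medge(1)[OF P(1)[of P1] x] medge(1)[OF P(1)[of P2] x] by auto
    ultimately show ?thesis
      using third_edge[OF fin inc3[OF x] medge_incident[OF P(1)[of P1] x] medge_incident[OF P(1)[of P2] x] _
          medge_incident[OF R(1) x] medge_incident[OF R(1) x], of R1 R2] by blast
  qed
  have "R1 = R2" using pm_eq_medge[OF G R(1)[of R1]] pm_eq_medge[OF G R(1)[of R2]] eq by simp
  then show False using R12(2) by blast
qed

text \<open>The edges of \<open>F\<close> are paired off at the vertices of \<open>A\<close>, and
  again at those of \<open>B\<close>. A set containing exactly one edge of every pair meets each
  vertex exactly once, and \<open>transversal\<close> provides it.\<close>

lemma bipartite_two_regular_pm:
  assumes G: "finite_loopless_graph G" and AB: "A \<union> B = verts G" "A \<inter> B = {}"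
    and bip: "\<forall>e\<in>edges G. \<exists>a\<in>A. \<exists>b\<in>B. ends G e = {a, b}"
    and F: "F \<subseteq> edges G" "\<And>v. v \<in> verts G \<Longrightarrow> card {d \<in> F. v \<in> ends G d} = 2"
  shows "\<exists>N\<subseteq>F. perfect_matching G N"
proof -
  \<comment> \<open>\<open>oth v e\<close> is the second edge of \<open>F\<close> at
    \<open>v\<close>; \<open>en\<close> below selects the end of an edge in one colour
    class.\<close>
  define oth where "oth v e = (THE d. d \<in> F \<and> v \<in> ends G d \<and> d \<noteq> e)" for v e
  have oth: "oth v e \<in> F" "v \<in> ends G (oth v e)" "oth v e \<noteq> e" "{d \<in> F. v \<in> ends G d} = {e, oth v e}"
    if v: "v \<in> verts G" and e: "e \<in> F" "v \<in> ends G e" for v e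
  proof -
    obtain x y where xy: "{d \<in> F. v \<in> ends G d} = {x, y}" "x \<noteq> y" using F(2)[OF v] by (meson card_2_iff)
    have "e \<in> {x, y}" unfolding xy(1)[symmetric] using e by simp
    then obtain d where d: "{d \<in> F. v \<in> ends G d} = {e, d}" "d \<noteq> e"
      using xy by (cases "e = x") (auto simp: insert_commute)
    have "oth v e = d" unfolding oth_def
    proof (rule the_equality)
      show "d \<in> F \<and> v \<in> ends G d \<and> d \<noteq> e" using d by blast
      show "x = d" if "x \<in> F \<and> v \<in> ends G x \<and> x \<noteq> e" for x using d that by blast
    qed
    then show "oth v e \<in> F" "v \<in> ends G (oth v e)" "oth v e \<noteq> e" "{d \<in> F. v \<in> ends G d} = {e, oth v e}"
      using d by blast+
  qed
  define en where "en S e = (THE a. a \<in> S \<and> a \<in> ends G e)" for S e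
  have enI: "en S e = a" if S: "S = A \<or> S = B" and e: "e \<in> F" and a: "a \<in> S" "a \<in> ends G e" for S e a
  proof -
    obtain x y where xy: "x \<in> A" "y \<in> B" "ends G e = {x, y}" using bip e F(1) by blast
    have un: "b = a" if "b \<in> S" "b \<in> ends G e" for b
      using S
    proof
      assume "S = A"
      then have "y \<notin> S" using xy(2) AB(2) by blast
      moreover have "a \<in> {x, y}" "b \<in> {x, y}" using that(2) a(2) xy(3) by simp_all
      ultimately show ?thesis using that(1) a(1) by blast
    next
      assume "S = B"
      then have "x \<notin> S" using xy(1) AB(2) by blast
      moreover have "a \<in> {x, y}" "b \<in> {x, y}" using that(2) a(2) xy(3) by simp_all
      ultimately show ?thesis using that(1) a(1) by blast
    qed
    show ?thesis unfolding en_def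
    proof (rule the_equality)
      show "a \<in> S \<and> a \<in> ends G e" using a by simp
      show "b = a" if "b \<in> S \<and> b \<in> ends G e" for b using un that by simp
    qed
  qed
  have en: "en S e \<in> S" "en S e \<in> ends G e" "en S e \<in> verts G" if S: "S = A \<or> S = B" and e: "e \<in> F" for S e
  proof -
    obtain x y where xy: "x \<in> A" "y \<in> B" "ends G e = {x, y}" using bip e F(1) by blast
    then obtain a where "a \<in> S" "a \<in> ends G e" using S by blast
    then show "en S e \<in> S" "en S e \<in> ends G e" using enI[OF S e] by auto
    then show "en S e \<in> verts G" using S AB(1) by blast
  qed
  have inv: "oth (en S e) e \<in> F" "oth (en S e) e \<noteq> e" "oth (en S (oth (en S e) e)) (oth (en S e) e) = e"
    if S: "S = A \<or> S = B" and e: "e \<in> F" for S e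
  proof -
    note o = oth[OF en(3)[OF S e] e en(2)[OF S e]]
    show "oth (en S e) e \<in> F" "oth (en S e) e \<noteq> e" using o by auto
    have eq: "en S (oth (en S e) e) = en S e" using enI[OF S o(1) en(1)[OF S e] o(2)] .
    have "oth (en S e) (oth (en S e) e) \<in> {e, oth (en S e) e}"
      using oth(1,2)[OF en(3)[OF S e] o(1,2)] o(4) by blast
    then show "oth (en S (oth (en S e) e)) (oth (en S e) e) = e"
      using oth(3)[OF en(3)[OF S e] o(1,2)] unfolding eq by blast
  qed
  have finF: "finite F" using F(1) G finite_subset by (auto simp: finite_loopless_graph_def)
  interpret two_involutions F "\<lambda>e. oth (en A e) e" "\<lambda>e. oth (en B e) e"
    by unfold_locales (use inv finF in auto)
  obtain W where W: "W \<subseteq> F" "\<And>x. x \<in> F \<Longrightarrow> (oth (en A x) x \<in> W) \<longleftrightarrow> x \<notin> W"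
    "\<And>x. x \<in> F \<Longrightarrow> (oth (en B x) x \<in> W) \<longleftrightarrow> x \<notin> W"
    by (rule transversal) (rule that; assumption)
  have ex: "\<exists>!e. e \<in> W \<and> v \<in> ends G e" if v: "v \<in> verts G" for v
  proof -
    have "{d \<in> F. v \<in> ends G d} \<noteq> {}" using F(2)[OF v] by (metis card.empty zero_neq_numeral)
    then obtain d where d: "d \<in> F" "v \<in> ends G d" by blast
    obtain S where S: "S = A \<or> S = B" "v \<in> S" using v AB(1) by blast
    have env: "en S d = v" using enI[OF S(1) d(1) S(2) d(2)] .
    have two: "{d \<in> F. v \<in> ends G d} = {d, oth v d}" using oth(4)[OF v d] .
    have "(oth v d \<in> W) \<longleftrightarrow> d \<notin> W" using S(1) W(2,3)[OF d(1)] env by blast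
    moreover have "x = d \<or> x = oth v d" if "x \<in> W" "v \<in> ends G x" for x using two that W(1) by blast
    moreover have "v \<in> ends G (oth v d)" using oth(2)[OF v d] .
    ultimately show ?thesis using d(2) by (cases "d \<in> W") blast+
  qed
  have "W \<subseteq> edges G" using W(1) F(1) by (rule subset_trans)
  then have "perfect_matching G W" using ex by (simp add: perfect_matching_def)
  then show ?thesis using W(1) by blast
qed

text \<open>The edges split into three perfect matchings, two of which form a Hamiltonian cycle.
  Bipartiteness makes every chord odd, so each chord gives a perfect matching of its own; as only
  six exist, there are at most three chords. Simplicity then forces the hexagon with its three long
  diagonals.\<close>

lemma bipartite_cubic_K33:
  fixes G :: "('v, 'e) multigraph"
  assumes B: "balanced G" and deg: "degree G = 3" and no: "pms1 G = {}" and bip: "bipartite G"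
  shows "graph_iso G (graph_of_list K33_list)"
proof -
  have G: "finite_loopless_graph G" using balanced_graph[OF B] .
  obtain A D where AD: "A \<union> D = verts G" "A \<inter> D = {}" "\<forall>e\<in>edges G. \<exists>a\<in>A. \<exists>b\<in>D. ends G e = {a, b}"
    using bip by (auto simp: bipartite_def)
  obtain M where M: "perfect_matching G M" using B by (auto simp: balanced_def)
  have inc3: "card (incident_edges G x) = 3" if "x \<in> verts G" for x using card_incident[OF B that] deg by simp
  have "card {d \<in> edges G - M. x \<in> ends G d} = 2" if x: "x \<in> verts G" for x
  proof -
    have "{d \<in> edges G - M. x \<in> ends G d} = incident_edges G x - {medge G M x}"
      using medge(1)[OF M x] medge_eqI[OF M x] by (auto simp: incident_edges_def)
    then show ?thesis using inc3[OF x] medge_incident[OF M x] finite_incident[OF G] by simp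
  qed
  then obtain N where N: "N \<subseteq> edges G - M" "perfect_matching G N"
    using bipartite_two_regular_pm[OF G AD, of "edges G - M"] by blast
  have dj: "M \<inter> N = {}" using N(1) by blast
  define L where "L = edges G - M - N"
  have L: "perfect_matching G L" unfolding L_def using cubic_complement_pm[OF G M N(2) dj inc3] .
  have sing: "singles G = {}" using singles_empty[OF B no] .
  have pc: "card {P. perfect_matching G P \<and> d \<in> P} = 2" if "d \<in> edges G" for d
    using card_pms_at_edge[OF that B] sing by (simp add: pcount_def)
  have c6: "card {P. perfect_matching G P} = 6" using card_eq_pms12[OF B] pms2_card[OF B] no deg by simp
  obtain v where v: "v \<in> verts G" using B by (auto simp: balanced_def)
  have neM: "P \<noteq> {}" if "perfect_matching G P" for P using medge(1)[OF that v] by blast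
  \<comment> \<open>A third matching \<open>Q\<close> inside \<open>M \<union> N\<close> comes with
    its complement \<open>Q'\<close> there. Every edge of \<open>M \<union> N\<close> is then used
    twice, so apart from these four only \<open>L\<close> is possible, which makes five perfect
    matchings instead of six.\<close>
  have irred: "Q = M \<or> Q = N" if Q: "perfect_matching G Q" "Q \<subseteq> M \<union> N" for Q
  proof (rule ccontr)
    assume nQ: "\<not> ?thesis"
    define Q' where "Q' = M \<union> N - Q"
    have Q': "perfect_matching G Q'"
    proof -
      have ex: "\<exists>!e. e \<in> Q' \<and> x \<in> ends G e" if x: "x \<in> verts G" for x
      proof -
        have "d \<in> M \<union> N \<and> x \<in> ends G d \<longleftrightarrow> d = medge G M x \<or> d = medge G N x" for d
          using medge[OF M x] medge[OF N(2) x] medge_eqI[OF M x] medge_eqI[OF N(2) x] by blast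
        moreover have "d \<in> Q \<and> x \<in> ends G d \<longleftrightarrow> d = medge G Q x" for d
          using medge[OF Q(1) x] medge_eqI[OF Q(1) x] by blast
        moreover have "medge G M x \<noteq> medge G N x" using medge(1)[OF M x] medge(1)[OF N(2) x] dj by auto
        moreover have "medge G Q x = medge G M x \<or> medge G Q x = medge G N x"
          using calculation(1)[of "medge G Q x"] medge[OF Q(1) x] Q(2) by blast
        ultimately show ?thesis unfolding Q'_def by (metis Diff_iff)
      qed
      have "Q' \<subseteq> edges G" using pm_subset[OF M] pm_subset[OF N(2)] by (auto simp: Q'_def)
      then show ?thesis using ex by (simp add: perfect_matching_def)
    qed
    have "P = M \<or> P = N \<or> P = Q \<or> P = Q' \<or> P = L" if P: "perfect_matching G P" for P
    proof (rule ccontr)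
      assume nP: "\<not> ?thesis"
      have "d \<notin> P" if d: "d \<in> M \<union> N" for d
      proof
        assume dP: "d \<in> P"
        obtain X where X: "X = M \<or> X = N" "d \<in> X" using d by blast
        obtain Y where Y: "Y = Q \<or> Y = Q'" "d \<in> Y" using d Q'_def by blast
        have "Q' \<noteq> M" "Q' \<noteq> N"
          using nQ dj Q(2) pm_eqI[OF G N(2) Q(1)] pm_eqI[OF G M Q(1)] unfolding Q'_def by blast+
        then have "X \<noteq> Y" using X Y nQ by blast
        moreover have "{P, X, Y} \<subseteq> {P. perfect_matching G P \<and> d \<in> P}" using P dP X Y M N(2) Q(1) Q' by blast
        then have "card {P, X, Y} \<le> 2" using card_mono[OF finite_pms(2)[OF G]] pc[of d] pm_subset[OF P] dP by (metis subsetD)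
        moreover have "P \<noteq> X" "P \<noteq> Y" using nP X Y by blast+
        ultimately show False by simp
      qed
      then have "P \<subseteq> L" using pm_subset[OF P] by (auto simp: L_def)
      then show False using pm_eqI[OF G P L] nP by blast
    qed
    then have "{P. perfect_matching G P} \<subseteq> {M, N, Q, Q', L}" by blast
    then have "6 \<le> card {M, N, Q, Q', L}" unfolding c6[symmetric] by (intro card_mono) auto
    moreover have "card {M, N, Q, Q', L} \<le> 5" by (simp add: card_insert_if)
    ultimately show False by simp
  qed
  obtain c n where H: "ham_cycle G M N c n" using ham_cycle_exists[OF G M N(2) dj irred v] by blast
  have "ham_cubic G M N c n L" using cubic_ham_cubic[OF B deg H] by (simp add: L_def)
  then interpret ham_cubic G M N c n L .
  have side: "x \<in> A \<longleftrightarrow> y \<notin> A" if dd: "d \<in> edges G" "ends G d = {x, y}" for d x y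
  proof -
    obtain a b where "a \<in> A" "b \<in> D" "{x, y} = {a, b}" using bspec[OF AD(3) dd(1)] dd(2) by auto
    then show ?thesis using AD(2) by (auto simp: doubleton_eq_iff)
  qed
  have step: "c i \<in> A \<longleftrightarrow> c (i + 1) \<notin> A" if "i + 1 < n" for i
  proof (cases "even i")
    case True
    then show ?thesis using side[OF medge_edges[OF M c_in] ends_M] that by simp
  next
    case False
    then show ?thesis using side[OF medge_edges[OF N c_in] ends_N] that by simp
  qed
  have col: "i < n \<Longrightarrow> c i \<in> A \<longleftrightarrow> (even i \<longleftrightarrow> c 0 \<in> A)" for i
  proof (induction i)
    case (Suc i)
    then show ?case using step[of i] by auto
  qed simp
  have oddl: "odd (l i + i)" if "i < n" for i
    using side[OF _ ends_L[OF that]] medge_L(1)[OF that] col[OF that] col[OF l_props(1)[OF that]] by auto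
  have nadj: "l i \<noteq> j" if "i < n" "j < n" "d \<in> M \<union> N" "ends G d = {c i, c j}" for i j d
  proof
    assume "l i = j"
    then have "ends G (medge G L (c i)) = ends G d" using ends_L[OF that(1)] that(4) by simp
    moreover have "medge G L (c i) \<noteq> d" "medge G L (c i) \<in> edges G" "d \<in> edges G"
      using medge_L(1)[OF that(1)] that(3) pm_subset[OF M] pm_subset[OF N] by blast+
    ultimately show False using doubles_simple[OF B deg no] by blast
  qed
  have nM: "l i \<noteq> i + 1" if "i + 1 < n" for i
  proof (cases "even i")
    case True
    then show ?thesis using nadj[OF _ _ _ ends_M] medge(1)[OF M c_in] that by simp
  next
    case False
    then show ?thesis using nadj[OF _ _ _ ends_N] medge(1)[OF N c_in] that by simp
  qed
  have nP: "l (i + 1) \<noteq> i" if "i + 1 < n" for i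
    using nM[OF that] l_props(4)[OF that] by auto
  have n0: "l 0 \<noteq> n - 1"
    using nadj[of 0 "n - 1" "medge G N (c (n - 1))"] ends_N_last medge(1)[OF N c_in[of "n - 1"]] n_pos
    by (simp add: insert_commute)
  \<comment> \<open>The exchange along one odd chord uses \<open>d\<close> and otherwise only edges
    of the cycle.\<close>
  have single: "\<exists>Q. perfect_matching G Q \<and> Q \<inter> L = {d}" if d: "d \<in> L" for d
  proof -
    have dE: "d \<in> edges G" using d by (simp add: L_def)
    obtain a b where ab: "a < b" "b < n" "ends G d = {c a, c b}" using ends_pos[OF dE] .
    have "odd (b - a)" using side[OF dE ab(3)] col[of a] col[of b] ab(1,2) by (auto simp: even_diff_nat)
    have sub: "medge G M ` c ` I \<subseteq> M" "medge G N ` c ` I \<subseteq> N" if "I \<subseteq> {..<n}" for I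
      using medge(1)[OF M c_in] medge(1)[OF N c_in] that by blast+
    have *: "({d} \<union> medge G M ` c ` I \<union> medge G N ` c ` J) \<inter> L = {d}"
      if "I \<subseteq> {..<n}" "J \<subseteq> {..<n}" for I J
    proof -
      have "medge G M ` c ` I \<inter> L = {}" "medge G N ` c ` J \<inter> L = {}"
        using sub(1)[OF that(1)] sub(2)[OF that(2)] Ld by blast+
      then show ?thesis using d by (simp add: Int_Un_distrib2)
    qed
    show ?thesis
    proof (cases "even a")
      case True
      show ?thesis
        by (rule exI, rule conjI, rule odd_chord_pm(1)[OF dE ab(3,1,2) \<open>odd (b - a)\<close> True], rule *) (use ab in auto)
    next
      case False
      show ?thesis
        by (rule exI, rule conjI, rule odd_chord_pm(2)[OF dE ab(3,1,2) \<open>odd (b - a)\<close> False], rule *) (use ab in auto)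
    qed
  qed
  define q where "q d = (SOME Q. perfect_matching G Q \<and> Q \<inter> L = {d})" for d
  have q: "perfect_matching G (q d)" "q d \<inter> L = {d}" if "d \<in> L" for d
    using someI_ex[OF single[OF that]] by (auto simp: q_def)
  have inj: "inj_on q L" by (rule inj_onI) (metis q(2) singleton_inject)
  have cL: "n = 2 * card L" using card_verts_pm[OF G L] n_eq by simp
  have n4: "4 \<le> n"
  proof (rule ccontr)
    assume "\<not> 4 \<le> n"
    then have "n = 2" using even_n n_pos by (auto elim!: evenE)
    then have "l 0 = 1" using l_props(1,3)[of 0] by auto
    then show False using nM[of 0] \<open>n = 2\<close> by simp
  qed
  \<comment> \<open>\<open>M\<close>, \<open>N\<close>, \<open>L\<close> and the matchings
    \<open>q d\<close>, one for each chord, are all different.\<close>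
  have n6: "n \<le> 6"
  proof -
    have "q d \<notin> {M, N, L}" if "d \<in> L" for d
    proof -
      have "d \<in> q d" using q(2)[OF that] by blast
      then have "q d \<noteq> M" "q d \<noteq> N" using that by (auto simp: L_def)
      moreover have "q d \<noteq> L" using q(2)[OF that] cL n4 by auto
      ultimately show ?thesis by simp
    qed
    then have "{M, N, L} \<inter> q ` L = {}" by blast
    moreover have "finite L" using pm_finite[OF G L] .
    ultimately have "card ({M, N, L} \<union> q ` L) = card {M, N, L} + card L"
      using card_image[OF inj] by (subst card_Un_disjoint) auto
    moreover have "M \<noteq> N" "M \<noteq> L" "N \<noteq> L" using dj neM[OF M] neM[OF N] by (auto simp: L_def)
    moreover have "card ({M, N, L} \<union> q ` L) \<le> 6" unfolding c6[symmetric]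
      by (rule card_mono[OF finite_pms(1)[OF G]]) (use M N L q(1) in auto)
    ultimately show ?thesis using cL by simp
  qed
  have l0: "l 0 < n" "odd (l 0)" "l 0 \<noteq> 1" "l 0 \<noteq> n - 1" using l_props(1)[of 0] oddl[of 0] nM[of 0] n0 n4 by auto
  have n: "n = 6"
  proof (rule ccontr)
    assume "n \<noteq> 6"
    then have "n = 4" using n4 n6 even_n by (auto elim!: evenE)
    then have "l 0 = 0 \<or> l 0 = 1 \<or> l 0 = 2 \<or> l 0 = 3" using l0(1) by auto
    then show False using l0 \<open>n = 4\<close> by auto
  qed
  have lt6: "x < 6 \<longleftrightarrow> x = 0 \<or> x = 1 \<or> x = 2 \<or> x = 3 \<or> x = 4 \<or> x = (5::nat)" for x by auto
  have "l 0 = 3"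
  proof -
    have "l 0 < 6" "odd (l 0)" "l 0 \<noteq> 1" "l 0 \<noteq> 5" using l0 n by auto
    then show ?thesis unfolding lt6 by auto
  qed
  moreover have "l 2 = 5"
  proof -
    have "l 2 < 6" "odd (l 2)" "l 2 \<noteq> 1" "l 2 \<noteq> 3" using l_props(1)[of 2] oddl[of 2] nM[of 2] nP[of 1, unfolded one_add_one] n by auto
    then show ?thesis unfolding lt6 by auto
  qed
  moreover have "l 4 = 1"
  proof -
    have "l 4 < 6" "odd (l 4)" "l 4 \<noteq> 3" "l 4 \<noteq> 5" using l_props(1)[of 4] oddl[of 4] nM[of 4] nP[of 3] n by auto
    then show ?thesis unfolding lt6 by auto
  qed
  ultimately have l: "l 0 = 3" "l 2 = 5" "l 4 = 1" by auto
  have C: "map (\<lambda>a. (a, l a)) [0, 2, 4] = [(0, 3), (2, 5), (4, 1)]" using l by simp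
  have chk: "iso_list_check [(0, 0), (1, 3), (2, 1), (3, 4), (4, 2), (5, 5)]
    (map (\<lambda>i. (2 * i, 2 * i + 1)) [0..<3] @ map (\<lambda>i. (2 * i + 1, (2 * i + 2) mod 6)) [0..<3] @ [(0, 3), (2, 5), (4, 1)]) K33_list"
    by code_simp
  show ?thesis
  proof (rule graph_iso_trans[OF _ iso_list_check[OF chk]])
    show "graph_iso G (graph_of_list (map (\<lambda>i. (2 * i, 2 * i + 1)) [0..<3] @
      map (\<lambda>i. (2 * i + 1, (2 * i + 2) mod 6)) [0..<3] @ [(0, 3), (2, 5), (4, 1)]))"
      unfolding C[symmetric] n[symmetric] by (rule iso_list) (use n l in auto)
  qed
qed

subsection \<open>Contraction of the shores of a tight cut\<close>

text \<open>The shrunk shore is represented by \<open>r\<close>, so the vertex type does not change.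
  Edges keep their names, hence a cut edge is literally an edge of both contractions.\<close>

definition contract :: "('v, 'e) multigraph \<Rightarrow> 'v set \<Rightarrow> 'v \<Rightarrow> ('v, 'e) multigraph" where
  "contract G X r = \<lparr>verts = insert r X, edges = {e \<in> edges G. ends G e \<inter> X \<noteq> {}},
     ends = (\<lambda>e. if ends G e \<subseteq> X then ends G e else insert r (ends G e \<inter> X))\<rparr>"

text \<open>Any vertex of a shore can lend its name to that shore when it is shrunk:
  \<open>r\<close> stands for the complement of \<open>X\<close>, and \<open>s\<close> for
  \<open>X\<close> itself.\<close>

locale tight_shores =
  fixes G :: "('v, 'e) multigraph" and X :: "'v set" and r s :: 'v
  assumes B: "balanced G" and XV: "X \<subseteq> verts G" and tight: "\<And>M. perfect_matching G M \<Longrightarrow> card (cut G X \<inter> M) = 1"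
    and r: "r \<in> verts G - X" and s: "s \<in> X"
begin

abbreviation "Y \<equiv> verts G - X"
abbreviation "C \<equiv> cut G X"
abbreviation "GX \<equiv> contract G X r"
abbreviation "GY \<equiv> contract G Y s"

lemma G: "finite_loopless_graph G"
  using balanced_graph[OF B] .

lemma cut_endsE:
  assumes "e \<in> C" obtains x y where "ends G e = {x, y}" "x \<in> X" "y \<in> Y"
proof -
  have e: "e \<in> edges G" "card (ends G e \<inter> X) = 1" using assms by (auto simp: cut_def)
  obtain v w where vw: "ends G e = {v, w}" "v \<noteq> w" "v \<in> verts G" "w \<in> verts G" using graph_endsE[OF G e(1)] .
  consider "v \<in> X" "w \<in> X" | "v \<in> X" "w \<notin> X" | "v \<notin> X" "w \<in> X" | "v \<notin> X" "w \<notin> X" by blast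
  then show ?thesis
  proof cases
    case 1
    then have "ends G e \<inter> X = {v, w}" using vw(1) by auto
    then show ?thesis using e(2) vw(2) by simp
  next
    case 2 then show ?thesis using that[of v w] vw by auto
  next
    case 3 then show ?thesis using that[of w v] vw by (auto simp: insert_commute)
  next
    case 4
    then have "ends G e \<inter> X = {}" using vw(1) by auto
    then show ?thesis using e(2) by simp
  qed
qed

lemma cutI:
  assumes "e \<in> edges G" "ends G e = {x, y}" "x \<in> X" "y \<in> Y" shows "e \<in> C"
proof -
  have "ends G e \<inter> X = {x}" using assms by auto
  then show ?thesis using assms(1) by (simp add: cut_def)
qed

lemma edge_cases:
  assumes "e \<in> edges G" obtains "ends G e \<subseteq> X" | "ends G e \<subseteq> Y" | "e \<in> C"
proof -
  obtain v w where vw: "ends G e = {v, w}" "v \<in> verts G" "w \<in> verts G" using graph_endsE[OF G assms] by metis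
  show ?thesis
  proof (cases "v \<in> X"; cases "w \<in> X")
    assume "v \<in> X" "w \<notin> X"
    then show ?thesis using that(3) cutI[OF assms vw(1)] vw by blast
  next
    assume "v \<notin> X" "w \<in> X"
    then show ?thesis using that(3) cutI[OF assms, of w v] vw by (simp add: insert_commute)
  qed (use that(1,2) vw in auto)
qed

lemma YY: "verts G - Y = X"
  using XV by blast

lemma cut_Y: "cut G Y = C"
proof -
  have "card (ends G e \<inter> Y) = 1 \<longleftrightarrow> card (ends G e \<inter> X) = 1" if e: "e \<in> edges G" for e
  proof -
    obtain v w where vw: "ends G e = {v, w}" "v \<noteq> w" "v \<in> verts G" "w \<in> verts G" using graph_endsE[OF G e] .
    show ?thesis unfolding vw(1) using vw(2-4) by (cases "v \<in> X"; cases "w \<in> X") (auto simp: Int_insert_left)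
  qed
  then show ?thesis by (auto simp: cut_def)
qed

text \<open>Makes every fact about the contraction \<open>GX\<close> available for
  \<open>GY\<close>; the cut is the same set of edges.\<close>

lemma sym: "tight_shores G Y s r"
proof
  show "card (cut G Y \<inter> M) = 1" if "perfect_matching G M" for M using tight[OF that] cut_Y by simp
  show "s \<in> verts G - Y" using s XV by blast
qed (use B r in auto)

lemma contract_simps: "verts GX = insert r X" "edges GX = {e \<in> edges G. ends G e \<inter> X \<noteq> {}}"
  "ends GX e = (if ends G e \<subseteq> X then ends G e else insert r (ends G e \<inter> X))"
  by (simp_all add: contract_def)

lemma CX: "C \<subseteq> edges GX"
proof
  fix e assume e: "e \<in> C"
  obtain x y where "ends G e = {x, y}" "x \<in> X" "y \<in> Y" using cut_endsE[OF e] .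
  then show "e \<in> edges GX" using e by (auto simp: contract_simps cut_def)
qed

lemma ends_cut: "e \<in> C \<Longrightarrow> ends G e = {x, y} \<Longrightarrow> x \<in> X \<Longrightarrow> y \<in> Y \<Longrightarrow> ends GX e = {r, x}"
  by (auto simp: contract_simps)

lemma ends_inside: "ends G e \<subseteq> X \<Longrightarrow> ends GX e = ends G e"
  by (simp add: contract_simps)

lemma edges_GX: "e \<in> edges GX \<longleftrightarrow> e \<in> edges G \<and> (ends G e \<subseteq> X \<or> e \<in> C)"
proof
  assume e: "e \<in> edges GX"
  then have eE: "e \<in> edges G" "ends G e \<inter> X \<noteq> {}" by (auto simp: contract_simps)
  from eE(1) show "e \<in> edges G \<and> (ends G e \<subseteq> X \<or> e \<in> C)"
    by (cases rule: edge_cases) (use eE in auto)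
next
  assume e: "e \<in> edges G \<and> (ends G e \<subseteq> X \<or> e \<in> C)"
  then show "e \<in> edges GX"
  proof (elim conjE disjE)
    assume h: "e \<in> edges G" "ends G e \<subseteq> X"
    obtain v w where "ends G e = {v, w}" using graph_endsE[OF G h(1)] by metis
    then show ?thesis using h by (auto simp: contract_simps)
  qed (use CX in blast)
qed

lemma r_in_ends: "e \<in> edges GX \<Longrightarrow> r \<in> ends GX e \<longleftrightarrow> e \<in> C"
proof -
  assume e: "e \<in> edges GX"
  show ?thesis
  proof (cases "e \<in> C")
    case True
    obtain x y where "ends G e = {x, y}" "x \<in> X" "y \<in> Y" using cut_endsE[OF True] .
    then show ?thesis using ends_cut[OF True] True by simp
  next
    case False
    then have "ends G e \<subseteq> X" using e edges_GX by blast
    then show ?thesis using False r by (auto simp: contract_simps)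
  qed
qed

lemma x_in_ends: "x \<in> X \<Longrightarrow> x \<in> ends GX e \<longleftrightarrow> x \<in> ends G e"
  using r by (auto simp: contract_simps)

lemma x_edge: "x \<in> X \<Longrightarrow> e \<in> edges G \<Longrightarrow> x \<in> ends G e \<Longrightarrow> e \<in> edges GX"
  by (auto simp: contract_simps)

lemma finite_GX: "finite_loopless_graph GX"
proof -
  have "ends GX e \<subseteq> verts GX \<and> card (ends GX e) = 2" if e: "e \<in> edges GX" for e
  proof (cases "e \<in> C")
    case True
    obtain x y where xy: "ends G e = {x, y}" "x \<in> X" "y \<in> Y" using cut_endsE[OF True] .
    moreover have "r \<noteq> x" using r xy(2) by auto
    ultimately show ?thesis using ends_cut[OF True xy] by (auto simp: contract_simps(1))
  next
    case False
    then have i: "ends G e \<subseteq> X" and "e \<in> edges G" using e edges_GX by blast+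
    then show ?thesis using G ends_inside[OF i] by (auto simp: contract_simps(1) finite_loopless_graph_def)
  qed
  moreover have "finite (verts GX)" "finite (edges GX)"
    using G XV finite_subset by (auto simp: contract_simps finite_loopless_graph_def)
  ultimately show ?thesis by (simp add: finite_loopless_graph_def)
qed

lemma incident_x: "x \<in> X \<Longrightarrow> incident_edges GX x = incident_edges G x"
  using x_in_ends x_edge by (auto simp: incident_edges_def contract_simps(2))

lemma incident_r: "incident_edges GX r = C"
  using r_in_ends CX by (auto simp: incident_edges_def)

text \<open>Tightness is precisely the condition that one edge of \<open>M\<close> remains at the
  contracted vertex.\<close>

lemma restrict_pm:
  assumes M: "perfect_matching G M" shows "perfect_matching GX (M \<inter> edges GX)"
proof -
  have "\<exists>!e. e \<in> M \<inter> edges GX \<and> v \<in> ends GX e" if v: "v \<in> verts GX" for v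
  proof (cases "v = r")
    case True
    obtain c where c: "C \<inter> M = {c}" using tight[OF M] by (rule card_1_singletonE)
    have "e \<in> M \<inter> edges GX \<and> r \<in> ends GX e \<longleftrightarrow> e \<in> C \<inter> M" for e using r_in_ends CX by blast
    then show ?thesis unfolding True c by simp
  next
    case False
    then have x: "v \<in> X" using v by (simp add: contract_simps)
    have "e \<in> M \<inter> edges GX \<and> v \<in> ends GX e \<longleftrightarrow> e \<in> M \<and> v \<in> ends G e" for e
      using x_in_ends[OF x] x_edge[OF x] pm_subset[OF M] by blast
    moreover have "v \<in> verts G" using x XV by blast
    then have "\<exists>!e. e \<in> M \<and> v \<in> ends G e" using M by (simp add: perfect_matching_def)
    ultimately show ?thesis by simp
  qed
  then show ?thesis by (simp add: perfect_matching_def)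
qed

lemma pm_cut_edge:
  assumes N: "perfect_matching GX N" shows "N \<inter> C = {medge GX N r}"
proof -
  have rV: "r \<in> verts GX" by (simp add: contract_simps)
  have "e \<in> N \<inter> C \<longleftrightarrow> e = medge GX N r" for e
    using medge[OF N rV] medge_eqI[OF N rV] r_in_ends pm_subset[OF N] by blast
  then show ?thesis by blast
qed

end

section \<open>Gluing perfect matchings of the two contractions\<close>

context tight_shores
begin

interpretation Y: tight_shores G Y s r
  by (rule sym)

lemma edges_inter: "edges GX \<inter> edges GY = C"
proof
  show "edges GX \<inter> edges GY \<subseteq> C"
  proof
    fix e assume e: "e \<in> edges GX \<inter> edges GY"
    have "\<not> (ends G e \<subseteq> X \<and> ends G e \<subseteq> Y)"
      using e by (auto simp: contract_simps(2))
    then show "e \<in> C" using e edges_GX[of e] Y.edges_GX[of e] by (auto simp: cut_Y)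
  qed
  show "C \<subseteq> edges GX \<inter> edges GY" using CX Y.CX by (auto simp: cut_Y)
qed

lemma combine_pm:
  assumes N: "perfect_matching GX N" and N': "perfect_matching GY N'" and eq: "N \<inter> C = N' \<inter> C"
  shows "perfect_matching G (N \<union> N')" "(N \<union> N') \<inter> edges GX = N"
proof -
  note XY = edges_inter
  show r1: "(N \<union> N') \<inter> edges GX = N" using XY eq pm_subset[OF N] pm_subset[OF N'] by blast
  have r2: "(N \<union> N') \<inter> edges GY = N'" using XY eq pm_subset[OF N] pm_subset[OF N'] by blast
  have sub: "N \<union> N' \<subseteq> edges G"
    using pm_subset[OF N] pm_subset[OF N'] edges_GX Y.edges_GX by blast
  have "\<exists>!e. e \<in> N \<union> N' \<and> v \<in> ends G e" if v: "v \<in> verts G" for v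
  proof (cases "v \<in> X")
    case True
    have "e \<in> N \<union> N' \<and> v \<in> ends G e \<longleftrightarrow> e \<in> N \<and> v \<in> ends GX e" for e
      using x_in_ends[OF True, of e] x_edge[OF True, of e] sub r1 by blast
    moreover have "\<exists>!e. e \<in> N \<and> v \<in> ends GX e" using N True by (simp add: perfect_matching_def contract_simps(1))
    ultimately show ?thesis by simp
  next
    case False
    then have vY: "v \<in> Y" using v by blast
    have "e \<in> N \<union> N' \<and> v \<in> ends G e \<longleftrightarrow> e \<in> N' \<and> v \<in> ends GY e" for e
      using Y.x_in_ends[OF vY, of e] Y.x_edge[OF vY, of e] sub r2 by blast
    moreover have "\<exists>!e. e \<in> N' \<and> v \<in> ends GY e" using N' vY by (simp add: perfect_matching_def Y.contract_simps(1))
    ultimately show ?thesis by simp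
  qed
  then show "perfect_matching G (N \<union> N')" using sub by (simp add: perfect_matching_def)
qed

definition extensions :: "'e set \<Rightarrow> 'e set set" where
  "extensions N = {M. perfect_matching G M \<and> M \<inter> edges GX = N}"

text \<open>Extending \<open>N\<close> to a perfect matching of \<open>G\<close> means choosing a
  perfect matching of \<open>GY\<close> with the same cut edge.\<close>

lemma card_extensions:
  assumes N: "perfect_matching GX N" and c: "c \<in> N" "c \<in> C"
  shows "card (extensions N) = pcount GY c"
proof -
  have "c \<in> {medge GX N r}" unfolding pm_cut_edge[OF N, symmetric] using c by blast
  then have Nc: "N \<inter> C = {c}" using pm_cut_edge[OF N] by simp
  have "bij_betw (\<lambda>N'. N \<union> N') {N'. perfect_matching GY N' \<and> c \<in> N'} (extensions N)"
  proof (rule bij_betwI')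
    have eq: "N \<inter> C = N' \<inter> C" if "perfect_matching GY N'" "c \<in> N'" for N'
    proof -
      have "N' \<inter> C = {medge GY N' s}" using Y.pm_cut_edge[OF that(1)] by (simp add: cut_Y)
      then show ?thesis using Nc that(2) c(2) by auto
    qed
    fix A assume A: "A \<in> {N'. perfect_matching GY N' \<and> c \<in> N'}"
    show "N \<union> A \<in> extensions N" using combine_pm[OF N _ eq, of A] A by (auto simp: extensions_def)
    fix A' assume A': "A' \<in> {N'. perfect_matching GY N' \<and> c \<in> N'}"
    show "(N \<union> A = N \<union> A') = (A = A')"
    proof
      assume u: "N \<union> A = N \<union> A'"
      have "A \<subseteq> edges GY" "A' \<subseteq> edges GY" "N \<subseteq> edges GX" using A A' N pm_subset by auto
      moreover have "A \<inter> C = A' \<inter> C" using eq[of A] eq[of A'] A A' by simp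
      ultimately show "A = A'" using u edges_inter by blast
    qed simp
  next
    fix M assume M: "M \<in> extensions N"
    then have pm: "perfect_matching G M" "M \<inter> edges GX = N" by (auto simp: extensions_def)
    have "M \<subseteq> edges GX \<union> edges GY"
    proof
      fix e assume "e \<in> M"
      then have "e \<in> edges G" using pm_subset[OF pm(1)] by blast
      then show "e \<in> edges GX \<union> edges GY"
        by (cases rule: edge_cases) (use edges_GX Y.edges_GX \<open>e \<in> edges G\<close> in auto)
    qed
    then have "M = N \<union> (M \<inter> edges GY)" using pm(2) by blast
    moreover have "c \<in> M \<inter> edges GY" using c pm(2) Y.CX by (auto simp: cut_Y)
    ultimately show "\<exists>N'\<in>{N'. perfect_matching GY N' \<and> c \<in> N'}. M = N \<union> N'"
      using Y.restrict_pm[OF pm(1)] by blast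
  qed
  then show ?thesis unfolding pcount_def using bij_betw_same_card by metis
qed

lemma pcount_sum:
  assumes f: "f \<in> edges GX"
  shows "pcount G f = (\<Sum>N | perfect_matching GX N \<and> f \<in> N. card (extensions N))"
proof -
  have eq: "{M. perfect_matching G M \<and> f \<in> M} = (\<Union>N\<in>{N. perfect_matching GX N \<and> f \<in> N}. extensions N)"
    using restrict_pm f by (auto simp: extensions_def)
  have "card (\<Union>N\<in>{N. perfect_matching GX N \<and> f \<in> N}. extensions N) = (\<Sum>N | perfect_matching GX N \<and> f \<in> N. card (extensions N))"
  proof (rule card_UN_disjoint)
    show "finite {N. perfect_matching GX N \<and> f \<in> N}" using finite_pms(2)[OF finite_GX] .
    show "\<forall>i\<in>{N. perfect_matching GX N \<and> f \<in> N}. finite (extensions i)"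
      using finite_pms(2)[OF G] by (simp add: extensions_def)
    show "\<forall>i\<in>{N. perfect_matching GX N \<and> f \<in> N}. \<forall>j\<in>{N. perfect_matching GX N \<and> f \<in> N}. i \<noteq> j \<longrightarrow> extensions i \<inter> extensions j = {}"
      by (auto simp: extensions_def)
  qed
  then show ?thesis unfolding pcount_def eq .
qed

lemma pcount_GX_pos: "f \<in> edges GX \<Longrightarrow> 0 < pcount GX f"
proof -
  assume f: "f \<in> edges GX"
  then obtain M where M: "perfect_matching G M" "f \<in> M" using edge_in_pm[OF B] edges_GX by blast
  then have "M \<inter> edges GX \<in> {N. perfect_matching GX N \<and> f \<in> N}" using restrict_pm f by blast
  then show ?thesis unfolding pcount_def using finite_pms(2)[OF finite_GX] by (auto simp: card_gt_0_iff)
qed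

text \<open>The product formula: the two halves of a perfect matching through \<open>c\<close> can
  be chosen independently.\<close>

lemma pcount_cut:
  assumes c: "c \<in> C" shows "pcount G c = pcount GX c * pcount GY c"
proof -
  have "c \<in> edges GX" using CX c by blast
  then have "pcount G c = (\<Sum>N | perfect_matching GX N \<and> c \<in> N. card (extensions N))" by (rule pcount_sum)
  also have "\<dots> = (\<Sum>N | perfect_matching GX N \<and> c \<in> N. pcount GY c)"
    by (rule sum.cong) (use card_extensions c in auto)
  also have "\<dots> = pcount GX c * pcount GY c" by (simp add: pcount_def[of GX])
  finally show ?thesis .
qed

end

section \<open>Contractions are balanced of the same degree\<close>

context tight_shores
begin

interpretation Y: tight_shores G Y s r
  by (rule sym)

lemma pcount_GY_pos: "c \<in> C \<Longrightarrow> 0 < pcount GY c"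
  using Y.pcount_GX_pos Y.CX by (auto simp: cut_Y)

lemma pcount_cut_cases:
  assumes "c \<in> C"
  shows "pcount GX c = 1 \<or> pcount GY c = 1" "pcount GX c = 1 \<or> pcount GX c = 2"
proof -
  have cE: "c \<in> edges G" using assms by (simp add: cut_def)
  have "pcount GX c * pcount GY c \<le> 2" using B cE pcount_cut[OF assms] by (auto simp: balanced_def)
  moreover have p: "0 < pcount GX c" "0 < pcount GY c" using pcount_GX_pos CX assms pcount_GY_pos by auto
  ultimately show "pcount GX c = 1 \<or> pcount GY c = 1"
    using mult_le_mono[of 2 "pcount GX c" 2 "pcount GY c"] by linarith
  have "pcount GX c \<le> 2" using \<open>pcount GX c * pcount GY c \<le> 2\<close> p(2)
      mult_le_mono2[of 1 "pcount GY c" "pcount GX c"] by linarith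
  then show "pcount GX c = 1 \<or> pcount GX c = 2" using p(1) by linarith
qed

text \<open>In \<open>G\<close> the edges \<open>f\<close> and \<open>c\<close> lie in equally many
  perfect matchings, by balancedness. Counting those through \<open>f\<close> by their restrictions
  to \<open>GX\<close>, the restriction \<open>N\<close> contributes \<open>pcount GY c\<close> and
  every other one at least 1. With the product formula for \<open>c\<close> this leaves room for no
  other restriction if \<open>pcount GX c\<close> is 1, and for exactly one if it is 2.\<close>

lemma pcount_constant:
  assumes N: "perfect_matching GX N" and c: "c \<in> N" "c \<in> C" and f: "f \<in> N"
  shows "pcount GX f = pcount GX c"
proof -
  have fE: "f \<in> edges GX" using pm_subset[OF N] f by blast
  define K where "K = {N. perfect_matching GX N \<and> f \<in> N}"
  have fin: "finite K" using finite_pms(2)[OF finite_GX] by (simp add: K_def)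
  have NK: "N \<in> K" using N f by (simp add: K_def)
  have w1: "1 \<le> card (extensions A)" if "A \<in> K" for A
  proof -
    have A: "perfect_matching GX A" using that by (simp add: K_def)
    have "medge GX A r \<in> A \<inter> C" using pm_cut_edge[OF A] by blast
    then show ?thesis using card_extensions[OF A] pcount_GY_pos[of "medge GX A r"] by auto
  qed
  have wN: "card (extensions N) = pcount GY c" using card_extensions[OF N c] .
  then have "extensions N \<noteq> {}" using pcount_GY_pos[OF c(2)] by auto
  then obtain M where M: "M \<in> extensions N" by blast
  then have MM: "perfect_matching G M" "f \<in> M" "c \<in> M" using f c by (auto simp: extensions_def)
  then have same: "pcount G f = pcount G c" using B unfolding balanced_def by blast
  have sum: "pcount G f = pcount GY c + (\<Sum>A\<in>K - {N}. card (extensions A))"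
    using pcount_sum[OF fE] sum.remove[OF fin NK, of "\<lambda>A. card (extensions A)"] wN by (simp add: K_def)
  have ge: "card (K - {N}) \<le> (\<Sum>A\<in>K - {N}. card (extensions A))"
    using sum_mono[of "K - {N}" "\<lambda>_. 1" "\<lambda>A. card (extensions A)"] w1 by simp
  have cK: "card K = Suc (card (K - {N}))" using card.remove[OF fin NK] .
  have pK: "pcount GX f = card K" by (simp add: pcount_def K_def)
  have prod: "pcount G c = pcount GX c * pcount GY c" using pcount_cut[OF c(2)] .
  have cE: "c \<in> edges G" using c(2) by (simp add: cut_def)
  have p12: "pcount G c = 1 \<or> pcount G c = 2" using B cE by (simp add: balanced_def)
  show ?thesis
  proof (cases "pcount GX c = 1")
    case True
    then have "(\<Sum>A\<in>K - {N}. card (extensions A)) = 0" using sum same prod by simp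
    then show ?thesis using ge cK pK True by simp
  next
    case False
    have "pcount GX c = 2" using pcount_cut_cases(2)[OF c(2)] False by simp
    moreover from this have "pcount GY c = 1" using pcount_cut_cases(1)[OF c(2)] by simp
    ultimately have two: "pcount GX c = 2" "pcount GY c = 1" by auto
    then have "(\<Sum>A\<in>K - {N}. card (extensions A)) = 1" using sum same prod by simp
    moreover from this have "K - {N} \<noteq> {}" by (metis sum.empty zero_neq_one)
    then have "card (K - {N}) \<noteq> 0" using fin by simp
    ultimately have "card (K - {N}) = 1" using ge by linarith
    then show ?thesis using cK pK two by simp
  qed
qed

text \<open>Every perfect matching of \<open>GX\<close> contains an edge of the cut, and all its
  edges have the number 1 or 2 of that cut edge.\<close>

lemma balanced_GX: "balanced GX"
proof -
  obtain M where M: "perfect_matching G M" using B by (auto simp: balanced_def)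
  have 2: "pcount GX f = 1 \<or> pcount GX f = 2" if f: "f \<in> edges GX" for f
  proof -
    obtain P where P: "perfect_matching G P" "f \<in> P" using edge_in_pm[OF B] f edges_GX by blast
    define N where "N = P \<inter> edges GX"
    have N: "perfect_matching GX N" "f \<in> N" using restrict_pm[OF P(1)] P(2) f by (auto simp: N_def)
    have c: "medge GX N r \<in> N" "medge GX N r \<in> C" using pm_cut_edge[OF N(1)] by blast+
    then show ?thesis using pcount_constant[OF N(1) c N(2)] pcount_cut_cases(2)[OF c(2)] by simp
  qed
  have 3: "pcount GX e = pcount GX f" if N: "perfect_matching GX N" "e \<in> N" "f \<in> N" for N e f
  proof -
    have c: "medge GX N r \<in> N" "medge GX N r \<in> C" using pm_cut_edge[OF N(1)] by blast+
    show ?thesis using pcount_constant[OF N(1) c N(2)] pcount_constant[OF N(1) c N(3)] by simp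
  qed
  have 4: "verts GX \<noteq> {}" by (simp add: contract_simps)
  show ?thesis unfolding balanced_def using finite_GX restrict_pm[OF M] 2 3 4 by blast
qed

lemma degree_GX: "degree GX = degree G"
proof -
  have "s \<in> verts GX" "s \<in> verts G" using s XV by (auto simp: contract_simps)
  then show ?thesis using card_incident[OF balanced_GX, of s] card_incident[OF B, of s] incident_x[OF s] by simp
qed

lemma card_C: "card C = degree G"
  using card_incident[OF balanced_GX, of r] degree_GX incident_r by (simp add: contract_simps)

lemma card_pms1_GX: "card (C \<inter> singles GX) = card (pms1 GX)"
  using card_singles_at[OF balanced_GX, of r] incident_r by (simp add: contract_simps)

end

section \<open>Single edges in the cut\<close>

context tight_shores
begin

interpretation Y: tight_shores G Y s r
  by (rule sym)

lemmas balanced_GY = Y.balanced_GX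
lemmas degree_GY = Y.degree_GX
lemmas card_pms1_GY = Y.card_pms1_GX[unfolded cut_Y]

text \<open>Every cut edge is single in one of the contractions, and the single edges at a
  contracted vertex are as many as the perfect matchings of single edges there.\<close>

lemma degree_le: "degree G \<le> card (pms1 GX) + card (pms1 GY)"
proof -
  have "C \<subseteq> (C \<inter> singles GX) \<union> (C \<inter> singles GY)"
  proof
    fix c assume c: "c \<in> C"
    then have "c \<in> edges GX" "c \<in> edges GY" using CX Y.CX by (auto simp: cut_Y)
    then show "c \<in> (C \<inter> singles GX) \<union> (C \<inter> singles GY)" using pcount_cut_cases(1)[OF c] c by (auto simp: singles_def)
  qed
  moreover have "finite C" using G by (simp add: cut_def finite_loopless_graph_def)
  ultimately have "card C \<le> card ((C \<inter> singles GX) \<union> (C \<inter> singles GY))" by (intro card_mono) auto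
  also have "\<dots> \<le> card (C \<inter> singles GX) + card (C \<inter> singles GY)" by (rule card_Un_le)
  finally show ?thesis using card_C card_pms1_GX card_pms1_GY by simp
qed

text \<open>A perfect matching of single edges in \<open>GY\<close> would contain a cut edge that is
  single in both contractions, hence single in \<open>G\<close>.\<close>

lemma pcount_GY_double:
  assumes no: "pms1 G = {}" and one: "\<And>c. c \<in> C \<Longrightarrow> pcount GX c = 1"
  shows "pms1 GY = {}"
proof (rule ccontr)
  assume "pms1 GY \<noteq> {}"
  then obtain N where N: "perfect_matching GY N" "N \<subseteq> singles GY" by (auto simp: pms1_def)
  have c: "medge GY N s \<in> N" "medge GY N s \<in> C" using Y.pm_cut_edge[OF N(1)] by (auto simp: cut_Y)
  have "pcount GY (medge GY N s) = 1" using N(2) c(1) by (auto simp: singles_def)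
  then have "pcount G (medge GY N s) = 1" using pcount_cut[OF c(2)] one[OF c(2)] by simp
  then have "medge GY N s \<in> singles G" using c(2) by (simp add: singles_def cut_def)
  then show False using singles_empty[OF B no] by blast
qed

lemma ends_both:
  assumes "e \<in> C" "ends GX e = {r, x}" "ends GY e = {s, y}"
  shows "ends G e = {x, y}" "x \<in> X" "y \<in> Y"
proof -
  obtain a b where ab: "ends G e = {a, b}" "a \<in> X" "b \<in> Y" using cut_endsE[OF assms(1)] .
  have "ends GX e = {r, a}" using ends_cut[OF assms(1) ab] .
  then have "x = a" using assms(2) r ab(2) by (auto simp: doubleton_eq_iff)
  have "ends GY e = {s, b}" using Y.ends_cut[of e b a] assms(1) ab by (simp add: cut_Y YY insert_commute)
  then have "y = b" using assms(3) s ab(3) by (auto simp: doubleton_eq_iff)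
  then show "ends G e = {x, y}" "x \<in> X" "y \<in> Y" using ab \<open>x = a\<close> by auto
qed

end

subsection \<open>Decomposition along a tight cut\<close>

lemma (in tight_shores) card_verts_GX: "card (verts GX) = card X + 1"
proof -
  have "finite X" using G XV finite_subset by (auto simp: finite_loopless_graph_def)
  then show ?thesis using r by (simp add: contract_simps)
qed

text \<open>The conclusion of \<open>two_single_pms\<close> with named edges and with a prescribed
  vertex \<open>v\<close> as a corner. For a contraction \<open>v\<close> is the shrunk shore;
  \<open>Z\<close> then consists of the cut edges on a diagonal.\<close>

lemma K4_structure:
  fixes H :: "('v, 'e) multigraph"
  assumes B: "balanced H" and two: "2 \<le> card (pms1 H)" and deg: "3 \<le> degree H" and card: "2 < card (verts H)"
    and v: "v \<in> verts H"
  obtains a b d m1 m2 n1 n2 Z Y k where "verts H = {v, a, b, d}" "distinct [v, a, b, d]"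
    "edges H = {m1, m2, n1, n2} \<union> Z \<union> Y" "{m1, m2, n1, n2} \<inter> (Z \<union> Y) = {}" "distinct [m1, m2, n1, n2]"
    "ends H m1 = {v, a}" "ends H m2 = {b, d}" "ends H n1 = {a, b}" "ends H n2 = {v, d}"
    "\<And>e. e \<in> {m1, m2, n1, n2} \<Longrightarrow> pcount H e = 1"
    "k = degree H - 2" "k = 1 \<or> k = 2" "card Z = k" "card Y = k"
    "\<And>e. e \<in> Z \<Longrightarrow> ends H e = {v, b} \<and> pcount H e = k" "\<And>e. e \<in> Y \<Longrightarrow> ends H e = {a, d} \<and> pcount H e = k"
proof -
  have "\<exists>M N. M \<in> pms1 H \<and> N \<in> pms1 H \<and> M \<noteq> N"
  proof (rule ccontr)
    assume n: "\<not> ?thesis"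
    obtain M where "M \<in> pms1 H" using two by (metis card.empty equals0I not_numeral_le_zero)
    then have "pms1 H = {M}" using n by blast
    then show False using two by simp
  qed
  then obtain M N where MN: "M \<in> pms1 H" "N \<in> pms1 H" "M \<noteq> N" by blast
  obtain c k Z Y where *: "ham_cycle H M N c 4" "c 0 = v" "k = degree H - 2" "k = 1 \<or> k = 2"
    "edges H = M \<union> N \<union> Z \<union> Y" "(M \<union> N) \<inter> (Z \<union> Y) = {}"
    "\<And>e. e \<in> Z \<Longrightarrow> ends H e = {c 0, c 2} \<and> pcount H e = k" "\<And>e. e \<in> Y \<Longrightarrow> ends H e = {c 1, c 3} \<and> pcount H e = k"
    "card Z = k" "card Y = k"
    by (rule two_single_pms[OF B MN deg card v]) (rule that; assumption)
  interpret ham_cycle H M N c 4 by (rule *(1))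
  have lt4: "{..<4} = {0, 1, 2, 3 :: nat}" by auto
  have V: "verts H = {c 0, c 1, c 2, c 3}" using bij unfolding bij_betw_def lt4 by auto
  have ceq: "distinct [c 0, c 1, c 2, c 3]" by (simp add: c_eq)
  have E: "ends H (medge H M (c 0)) = {c 0, c 1}" "ends H (medge H M (c 2)) = {c 2, c 3}"
    "ends H (medge H N (c 1)) = {c 1, c 2}" "ends H (medge H N (c 3)) = {c 3, c 0}"
    using ends_M[of 0] ends_M[of 2] ends_N[of 1] ends_N_last by (simp_all add: numeral_eq_Suc)
  have in': "medge H M (c i) \<in> M" "medge H N (c i) \<in> N" if "i < 4" for i
    using medge(1)[OF M c_in[OF that]] medge(1)[OF N c_in[OF that]] by auto
  have "M = medge H M ` {c 0, c 1, c 2, c 3}" "N = medge H N ` {c 0, c 1, c 2, c 3}"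
    using pm_eq_medge[OF G M] pm_eq_medge[OF G N] V by auto
  moreover have "medge H M (c 1) = medge H M (c 0)" "medge H M (c 3) = medge H M (c 2)"
    "medge H N (c 0) = medge H N (c 3)" "medge H N (c 2) = medge H N (c 1)"
    using mate_eqI(2)[OF G M in'(1)[of 0], of "c 1" "c 0"] mate_eqI(2)[OF G M in'(1)[of 2], of "c 3" "c 2"]
      mate_eqI(2)[OF G N in'(2)[of 3], of "c 0" "c 3"] mate_eqI(2)[OF G N in'(2)[of 1], of "c 2" "c 1"] E
    by (simp_all add: insert_commute)
  ultimately have MN': "M \<union> N = {medge H M (c 0), medge H M (c 2), medge H N (c 1), medge H N (c 3)}" by auto
  have "distinct [medge H M (c 0), medge H M (c 2), medge H N (c 1), medge H N (c 3)]"
  proof -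
    have "medge H M (c 0) \<noteq> medge H M (c 2)" "medge H N (c 1) \<noteq> medge H N (c 3)"
      using E ceq by (auto simp: doubleton_eq_iff)
    moreover have "medge H M (c i) \<noteq> medge H N (c j)" if "i < 4" "j < 4" for i j
      using in'(1)[OF that(1)] in'(2)[OF that(2)] disj by auto
    ultimately show ?thesis by simp
  qed
  moreover have "pcount H e = 1" if "e \<in> M \<union> N" for e using that MN by (auto simp: pms1_def singles_def)
  ultimately have dist: "distinct [medge H M (c 0), medge H M (c 2), medge H N (c 1), medge H N (c 3)]"
    and p1: "\<And>e. e \<in> M \<union> N \<Longrightarrow> pcount H e = 1" by blast+
  note [simp] = *(2)
  show ?thesis
  proof (rule that[of "c 1" "c 2" "c 3" "medge H M (c 0)" "medge H M (c 2)" "medge H N (c 1)" "medge H N (c 3)" Z Y k])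
    show "verts H = {v, c 1, c 2, c 3}" using V *(2) by simp
    show "distinct [v, c 1, c 2, c 3]" using ceq *(2) by simp
    show "edges H = {medge H M (c 0), medge H M (c 2), medge H N (c 1), medge H N (c 3)} \<union> Z \<union> Y"
      unfolding *(5) MN' ..
    show "{medge H M (c 0), medge H M (c 2), medge H N (c 1), medge H N (c 3)} \<inter> (Z \<union> Y) = {}"
      using *(6) unfolding MN' .
    show "pcount H e = 1" if "e \<in> {medge H M (c 0), medge H M (c 2), medge H N (c 1), medge H N (c 3)}" for e
      using p1 that unfolding MN' by blast
    show "ends H (medge H M (c 0)) = {v, c 1}" "ends H (medge H M (c 2)) = {c 2, c 3}"
      "ends H (medge H N (c 1)) = {c 1, c 2}" "ends H (medge H N (c 3)) = {v, c 3}"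
      using E *(2) by (simp_all add: insert_commute)
    show "ends H e = {v, c 2} \<and> pcount H e = k" if "e \<in> Z" for e using *(7)[OF that] *(2) by simp
    show "ends H e = {c 1, c 3} \<and> pcount H e = k" if "e \<in> Y" for e using *(8)[OF that] .
  qed (fact dist *(3,4,9,10))+
qed

context tight_shores
begin

interpretation Y: tight_shores G Y s r
  by (rule sym)

lemma not_both_inside: "ends G e \<subseteq> X \<Longrightarrow> e \<in> edges G \<Longrightarrow> e \<notin> edges GY"
  by (auto simp: contract_simps(2) contract_def)

lemma edges_split: "edges G = edges GX \<union> edges GY"
proof
  show "edges G \<subseteq> edges GX \<union> edges GY"
  proof
    fix e assume e: "e \<in> edges G"
    then show "e \<in> edges GX \<union> edges GY"
      by (cases rule: edge_cases) (use edges_GX Y.edges_GX e in auto)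
  qed
qed (use edges_GX Y.edges_GX in auto)

text \<open>Splicing two copies of \<open>K\<^sub>4\<close> with a doubled perfect matching: single edges of one
  are identified with double edges of the other.\<close>

lemma degree_four_T3:
  assumes deg: "degree G = 4" and X2: "2 \<le> card X" and Y2: "2 \<le> card Y"
  shows "graph_iso G (graph_of_list T3_list)"
proof -
  have rX: "r \<in> verts GX" and sY: "s \<in> verts GY" by (auto simp: contract_simps(1) Y.contract_simps(1))
  \<comment> \<open>In degree 4 the diagonal edges are double, which leaves only two single edges at
    \<open>v\<close>.\<close>
  have le2: "card (pms1 K) \<le> 2" if K: "balanced K" "degree K = 4" "2 < card (verts K)" "v \<in> verts K" for K :: "('v, 'e) multigraph" and v
  proof (cases "2 \<le> card (pms1 K)")
    case True
    have d3: "3 \<le> degree K" using K(2) by simp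
    obtain a b d m1 m2 n1 n2 Z W k where *: "verts K = {v, a, b, d}" "distinct [v, a, b, d]"
      "edges K = {m1, m2, n1, n2} \<union> Z \<union> W" "{m1, m2, n1, n2} \<inter> (Z \<union> W) = {}" "distinct [m1, m2, n1, n2]"
      "ends K m1 = {v, a}" "ends K m2 = {b, d}" "ends K n1 = {a, b}" "ends K n2 = {v, d}"
      "\<And>e. e \<in> {m1, m2, n1, n2} \<Longrightarrow> pcount K e = 1"
      "k = degree K - 2" "k = 1 \<or> k = 2" "card Z = k" "card W = k"
      "\<And>e. e \<in> Z \<Longrightarrow> ends K e = {v, b} \<and> pcount K e = k" "\<And>e. e \<in> W \<Longrightarrow> ends K e = {a, d} \<and> pcount K e = k"
      by (rule K4_structure[OF K(1) True d3 K(3,4)]) (rule that; assumption)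
    have "incident_edges K v \<inter> singles K \<subseteq> {m1, n2}"
    proof
      fix e assume e: "e \<in> incident_edges K v \<inter> singles K"
      then have "v \<in> ends K e" "pcount K e = 1" "e \<in> edges K" by (auto simp: incident_edges_def singles_def)
      moreover have "k = 2" using *(11) K(2) by simp
      ultimately have "e \<in> {m1, m2, n1, n2}" using *(3,15,16) by auto
      then show "e \<in> {m1, n2}" using \<open>v \<in> ends K e\<close> *(2,7,8) by auto
    qed
    then have "card (incident_edges K v \<inter> singles K) \<le> card {m1, n2}" by (intro card_mono) auto
    then show ?thesis using card_singles_at[OF K(1,4)] card_insert_le_m1[of 2 "{n2}" m1] by simp
  qed simp
  have cX: "2 < card (verts GX)" "2 < card (verts GY)" using card_verts_GX Y.card_verts_GX X2 Y2 by auto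
  have l2: "card (pms1 GX) \<le> 2" "card (pms1 GY) \<le> 2"
    using le2[OF balanced_GX _ cX(1) rX] le2[OF balanced_GY _ cX(2) sY] degree_GX degree_GY deg by auto
  \<comment> \<open>The degree 4 is at most the sum of two numbers that are at most 2, so both are 2
    and both contractions have the same structure.\<close>
  then have g2: "2 \<le> card (pms1 GX)" "2 \<le> card (pms1 GY)" using degree_le deg by auto
  have d3: "3 \<le> degree GX" "3 \<le> degree GY" using degree_GX degree_GY deg by simp_all
  obtain a b d m1 m2 n1 n2 Z W k where x: "verts GX = {r, a, b, d}" "distinct [r, a, b, d]"
      "edges GX = {m1, m2, n1, n2} \<union> Z \<union> W" "{m1, m2, n1, n2} \<inter> (Z \<union> W) = {}" "distinct [m1, m2, n1, n2]"
      "ends GX m1 = {r, a}" "ends GX m2 = {b, d}" "ends GX n1 = {a, b}" "ends GX n2 = {r, d}"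
      "\<And>e. e \<in> {m1, m2, n1, n2} \<Longrightarrow> pcount GX e = 1"
      "k = degree GX - 2" "k = 1 \<or> k = 2" "card Z = k" "card W = k"
      "\<And>e. e \<in> Z \<Longrightarrow> ends GX e = {r, b} \<and> pcount GX e = k" "\<And>e. e \<in> W \<Longrightarrow> ends GX e = {a, d} \<and> pcount GX e = k"
    by (rule K4_structure[OF balanced_GX g2(1) d3(1) cX(1) rX]) (rule that; assumption)
  obtain a' b' d' m1' m2' n1' n2' Z' W' k' where y: "verts GY = {s, a', b', d'}" "distinct [s, a', b', d']"
      "edges GY = {m1', m2', n1', n2'} \<union> Z' \<union> W'" "{m1', m2', n1', n2'} \<inter> (Z' \<union> W') = {}" "distinct [m1', m2', n1', n2']"
      "ends GY m1' = {s, a'}" "ends GY m2' = {b', d'}" "ends GY n1' = {a', b'}" "ends GY n2' = {s, d'}"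
      "\<And>e. e \<in> {m1', m2', n1', n2'} \<Longrightarrow> pcount GY e = 1"
      "k' = degree GY - 2" "k' = 1 \<or> k' = 2" "card Z' = k'" "card W' = k'"
      "\<And>e. e \<in> Z' \<Longrightarrow> ends GY e = {s, b'} \<and> pcount GY e = k'" "\<And>e. e \<in> W' \<Longrightarrow> ends GY e = {a', d'} \<and> pcount GY e = k'"
    by (rule K4_structure[OF balanced_GY g2(2) d3(2) cX(2) sY]) (rule that; assumption)
  have k: "k = 2" "k' = 2" using x(11) y(11) degree_GX degree_GY deg by auto
  have CX': "C = {m1, n2} \<union> Z"
  proof -
    have "e \<in> edges GX \<and> r \<in> ends GX e \<longleftrightarrow> e \<in> {m1, n2} \<union> Z" for e
      using x(2,3,6-9,15,16) by auto
    then show ?thesis using incident_r by (auto simp: incident_edges_def)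
  qed
  have CY': "C = {m1', n2'} \<union> Z'"
  proof -
    have "e \<in> edges GY \<and> s \<in> ends GY e \<longleftrightarrow> e \<in> {m1', n2'} \<union> Z'" for e
      using y(2,3,6-9,15,16) by auto
    then show ?thesis using Y.incident_r by (auto simp: incident_edges_def cut_Y)
  qed
  have finZ: "finite Z" "finite Z'" using x(13) y(13) k by (auto intro: card_ge_0_finite)
  \<comment> \<open>A cut edge that is double in both contractions would lie in four perfect
    matchings of \<open>G\<close>. The double cut edges on one side are thus the single ones on the
    other.\<close>
  have ZZ: "e \<notin> Z'" if "e \<in> Z" for e
  proof
    assume "e \<in> Z'"
    then show False using pcount_cut_cases(1)[of e] x(15)[OF that] y(15)[of e] k CX' that by auto
  qed
  then have "Z \<subseteq> {m1', n2'}" using CX' CY' by blast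
  then have Z: "Z = {m1', n2'}" using x(13) y(5) k by (intro card_subset_eq) auto
  have "Z' \<subseteq> {m1, n2}" using ZZ CX' CY' by blast
  then have Z': "Z' = {m1, n2}" using y(13) x(5) k by (intro card_subset_eq) auto
  obtain w1 w2 where W: "W = {w1, w2}" "w1 \<noteq> w2" using x(14) k by (meson card_2_iff)
  obtain w1' w2' where W': "W' = {w1', w2'}" "w1' \<noteq> w2'" using y(14) k by (meson card_2_iff)
  have inC: "m1 \<in> C" "n2 \<in> C" "m1' \<in> C" "n2' \<in> C" using CX' CY' by auto
  have e1: "ends G m1 = {a, b'}" using ends_both[OF inC(1) x(6)] y(15)[of m1] Z' by auto
  have e2: "ends G n2 = {d, b'}" using ends_both[OF inC(2) x(9)] y(15)[of n2] Z' by auto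
  have e3: "ends G m1' = {b, a'}" using ends_both[OF inC(3) _ y(6)] x(15)[of m1'] Z by auto
  have e4: "ends G n2' = {b, d'}" using ends_both[OF inC(4) _ y(9)] x(15)[of n2'] Z by auto
  have insX: "ends G e = ends GX e" if "e \<in> edges GX" "r \<notin> ends GX e" for e
    using that edges_GX[of e] r_in_ends[of e] ends_inside[of e] by metis
  have insY: "ends G e = ends GY e" if "e \<in> edges GY" "s \<notin> ends GY e" for e
    using that Y.edges_GX[of e] Y.r_in_ends[of e] Y.ends_inside[of e] by metis
  have e5: "ends G m2 = {b, d}" "ends G n1 = {a, b}" "ends G w1 = {a, d}" "ends G w2 = {a, d}"
    using insX[of m2] insX[of n1] insX[of w1] insX[of w2] x(2,3,7,8,16) W by auto
  have e6: "ends G m2' = {b', d'}" "ends G n1' = {a', b'}" "ends G w1' = {a', d'}" "ends G w2' = {a', d'}"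
    using insY[of m2'] insY[of n1'] insY[of w1'] insY[of w2'] y(2,3,7,8,16) W' by auto
  have VX: "X = {a, b, d}"
  proof -
    have "insert r X = {r, a, b, d}" using x(1) by (simp add: contract_simps(1))
    then show ?thesis using r x(2) by auto
  qed
  have VY: "Y = {a', b', d'}"
  proof -
    have "insert s Y = {s, a', b', d'}" using y(1) by (simp add: Y.contract_simps(1))
    then show ?thesis using s y(2) by auto
  qed
  have V: "verts G = {b, b', a, d, a', d'}" using VX VY XV by blast
  have dV: "distinct [b, b', a, d, a', d']" using x(2) y(2) VX VY by auto
  define es where "es = [n1, m2, m1', n2', m1, n2, n1', m2', w1, w2, w1', w2']"
  have ses: "set es = edges G" unfolding edges_split x(3) y(3) Z Z' W W' es_def by auto
  have des: "distinct es"
  proof -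
    have "e \<noteq> f" if "ends G e \<noteq> ends G f" for e f using that by auto
    then have "w \<notin> {n1, m2, m1', n2', m1, n2, n1', m2'}" if "w = w1 \<or> w = w2 \<or> w = w1' \<or> w = w2'" for w
      using that e1 e2 e3 e4 e5 e6 dV by (auto simp: doubleton_eq_iff)
    moreover have "distinct [n1, m2, m1', n2', m1, n2, n1', m2']"
    proof -
      have "distinct (map (ends G) [n1, m2, m1', n2', m1, n2, n1', m2'])"
        using dV by (simp add: e1 e2 e3 e4 e5 e6 doubleton_eq_iff)
      then show ?thesis by (simp only: distinct_map)
    qed
    moreover have "w1 \<noteq> w1'" "w1 \<noteq> w2'" "w2 \<noteq> w1'" "w2 \<noteq> w2'" using e5(3,4) e6(3,4) dV by (auto simp: doubleton_eq_iff)
    ultimately show ?thesis using W(2) W'(2) unfolding es_def by auto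
  qed
  \<comment> \<open>The vertices \<open>b\<close> and \<open>b'\<close>, opposite to the contracted
    vertices, play the roles of \<open>p\<close> and \<open>u\<close>; the ends \<open>a\<close>,
    \<open>d\<close> and \<open>a'\<close>, \<open>d'\<close> of the doubled diagonals become
    \<open>q\<close>, \<open>r\<close> and \<open>s\<close>, \<open>t\<close>.\<close>
  define c where "c i = [b, b', a, d, a', d'] ! i" for i
  have vL: "fst ` set T3_list \<union> snd ` set T3_list = {0, 1, 2, 3, 4, 5}" by (auto simp: T3_list_def)
  show ?thesis
  proof (rule iso_listI[OF des ses])
    show "length es = length T3_list" by (simp add: es_def T3_list_def)
    show "bij_betw c (fst ` set T3_list \<union> snd ` set T3_list) (verts G)" unfolding vL V
      using dV by (auto simp: bij_betw_def c_def inj_on_def)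
    fix i assume "i < length T3_list"
    then have "i < 12" by (simp add: T3_list_def)
    then have "i = 0 \<or> i = 1 \<or> i = 2 \<or> i = 3 \<or> i = 4 \<or> i = 5 \<or> i = 6 \<or> i = 7 \<or> i = 8 \<or> i = 9 \<or> i = 10 \<or> i = 11"
      by presburger
    then show "ends G (es ! i) = {c (fst (T3_list ! i)), c (snd (T3_list ! i))}"
      by (elim disjE) (simp_all add: es_def T3_list_def c_def e1 e2 e3 e4 e5 e6 insert_commute)
  qed
qed

text \<open>In degree 3 the contraction \<open>GX\<close> is the complete graph on four vertices.
  Without \<open>r\<close> it is a triangle, each corner of which meets one cut edge, so
  \<open>G\<close> arises from \<open>GY\<close> by replacing \<open>s\<close>.\<close>

lemma degree_three_triangle:
  assumes deg: "degree G = 3" and two: "2 \<le> card (pms1 GX)" and X2: "2 \<le> card X"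
  shows "graph_iso G (triangle_replacement GY s)" "\<And>c. c \<in> C \<Longrightarrow> pcount GX c = 1" "card X = 3"
    "\<And>x. x \<in> X \<Longrightarrow> \<exists>!e. e \<in> C \<and> x \<in> ends G e"
proof -
  have d3: "3 \<le> degree GX" using degree_GX deg by simp
  have rX: "r \<in> verts GX" by (auto simp: contract_simps(1))
  have cX: "2 < card (verts GX)" using card_verts_GX X2 by auto
  have d3: "3 \<le> degree GX" "3 \<le> degree GY" using degree_GX degree_GY deg by simp_all
  obtain a b d m1 m2 n1 n2 Z W k where x: "verts GX = {r, a, b, d}" "distinct [r, a, b, d]"
      "edges GX = {m1, m2, n1, n2} \<union> Z \<union> W" "{m1, m2, n1, n2} \<inter> (Z \<union> W) = {}" "distinct [m1, m2, n1, n2]"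
      "ends GX m1 = {r, a}" "ends GX m2 = {b, d}" "ends GX n1 = {a, b}" "ends GX n2 = {r, d}"
      "\<And>e. e \<in> {m1, m2, n1, n2} \<Longrightarrow> pcount GX e = 1"
      "k = degree GX - 2" "k = 1 \<or> k = 2" "card Z = k" "card W = k"
      "\<And>e. e \<in> Z \<Longrightarrow> ends GX e = {r, b} \<and> pcount GX e = k" "\<And>e. e \<in> W \<Longrightarrow> ends GX e = {a, d} \<and> pcount GX e = k"
    by (rule K4_structure[OF balanced_GX two d3(1) cX rX]) (rule that; assumption)
  have k: "k = 1" using x(11) degree_GX deg by simp
  obtain z where Z: "Z = {z}" using x(13) k by (metis card_1_singletonE)
  obtain w where W: "W = {w}" using x(14) k by (metis card_1_singletonE)
  have zw: "ends GX z = {r, b}" "ends GX w = {a, d}" "pcount GX z = 1" using x(15,16) Z W k by auto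
  have Ce: "C = {m1, n2, z}"
  proof -
    have "e \<in> edges GX \<and> r \<in> ends GX e \<longleftrightarrow> e \<in> {m1, n2, z}" for e
      using x(2,3,6-9) zw Z W by auto
    then show ?thesis using incident_r by (auto simp: incident_edges_def)
  qed
  show "pcount GX c = 1" if "c \<in> C" for c using that Ce x(10) zw(3) by auto
  have VX: "X = {a, b, d}"
  proof -
    have "insert r X = {r, a, b, d}" using x(1) by (simp add: contract_simps(1))
    then show ?thesis using r x(2) by auto
  qed
  then show "card X = 3" using x(2) by auto
  show "\<exists>!e. e \<in> C \<and> v \<in> ends G e" if v: "v \<in> X" for v
  proof -
    have "v \<in> ends G e \<longleftrightarrow> v \<in> ends GX e" for e using x_in_ends[OF v] by simp
    moreover have "v \<noteq> r" using v r by blast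
    moreover have "v = a \<or> v = b \<or> v = d" using v VX by blast
    ultimately show ?thesis unfolding Ce using x(2,6,9) zw(1) by auto
  qed
  have insX: "ends G e = ends GX e \<and> e \<notin> edges GY" if "e \<in> edges GX" "r \<notin> ends GX e" for e
    using that edges_GX[of e] r_in_ends[of e] ends_inside[of e] not_both_inside[of e] by metis
  have e5: "ends G m2 = {b, d}" "ends G n1 = {a, b}" "ends G w = {a, d}" "m2 \<notin> edges GY" "n1 \<notin> edges GY" "w \<notin> edges GY"
    using insX[of m2] insX[of n1] insX[of w] x(2,3,7,8) zw W by auto
  have zn: "z \<noteq> m1" "z \<noteq> n2" "w \<noteq> m2" "w \<noteq> n1" "m1 \<noteq> n2" "m2 \<noteq> n1" using x(4,5) Z W by auto
  have incs: "incident_edges GY s = {m1, n2, z}" using Y.incident_r Ce by (simp add: cut_Y)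
  have ecut: "\<exists>y\<in>Y. ends G e = {q, y} \<and> ends GY e = {s, y}" if ec: "e \<in> C" "ends GX e = {r, q}" for e q
  proof -
    obtain p y where py: "ends G e = {p, y}" "p \<in> X" "y \<in> Y" using cut_endsE[OF ec(1)] .
    have "ends GX e = {r, p}" using ends_cut[OF ec(1) py] .
    then have "p = q" using ec(2) r py(2) by (auto simp: doubleton_eq_iff)
    moreover have "ends GY e = {s, y}" using Y.ends_cut[of e y p] ec(1) py by (simp add: cut_Y YY insert_commute)
    ultimately show ?thesis using py by auto
  qed
  let ?T = "triangle_replacement GY s"
  \<comment> \<open>A corner of \<open>X\<close> is named after its cut edge, and below a side after
    the cut edge of the opposite corner: \<open>m2\<close> is opposite to \<open>a\<close>,
    \<open>n1\<close> to \<open>d\<close>, and the remaining side to \<open>b\<close>.\<close>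
  define f where "f v = (if v \<in> Y then Inl v else if v = a then Inr m1 else if v = b then Inr z else Inr n2)" for v
  define g where "g e = (if e \<in> edges GY then Inl e else if e = m2 then Inr m1 else if e = n1 then Inr n2 else Inr z)" for e
  have T: "verts ?T = Inl ` Y \<union> Inr ` {m1, n2, z}" "edges ?T = Inl ` edges GY \<union> Inr ` {m1, n2, z}"
    "\<And>e. ends ?T (Inl e) = (if s \<in> ends GY e then Inl ` (ends GY e - {s}) \<union> {Inr e} else Inl ` ends GY e)"
    "\<And>e. ends ?T (Inr e) = Inr ` ({m1, n2, z} - {e})"
    using s by (auto simp: triangle_replacement_def incs Y.contract_simps(1))
  have abd: "a \<notin> Y" "b \<notin> Y" "d \<notin> Y" "a \<noteq> b" "a \<noteq> d" "b \<noteq> d" using VX x(2) by auto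
  have V: "verts G = Y \<union> {a, b, d}" using VX XV by blast
  have E: "edges G = edges GY \<union> {m2, n1, w}"
  proof -
    have "{m1, n2, z} \<subseteq> edges GY" using Ce Y.CX by (simp add: cut_Y)
    then show ?thesis unfolding edges_split x(3) Z W by auto
  qed
  have fv: "f a = Inr m1" "f b = Inr z" "f d = Inr n2" "\<And>v. v \<in> Y \<Longrightarrow> f v = Inl v" using abd by (auto simp: f_def)
  have gv: "g m2 = Inr m1" "g n1 = Inr n2" "g w = Inr z" "\<And>e. e \<in> edges GY \<Longrightarrow> g e = Inl e" using e5 zn by (auto simp: g_def)
  have "bij_betw f (verts G) (verts ?T)"
  proof -
    have "f ` verts G = f ` (Y \<union> {a, b, d})" by (simp only: V[symmetric])
    also have "\<dots> = f ` Y \<union> {f a, f b, f d}" by (simp only: image_Un image_insert image_empty)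
    also have "f ` Y = Inl ` Y" using fv(4) by (intro image_cong) auto
    finally have "f ` verts G = verts ?T" unfolding T fv by auto
    moreover have "inj_on f (Y \<union> {a, b, d})"
    proof (rule inj_onI)
      fix v w assume h: "v \<in> Y \<union> {a, b, d}" "w \<in> Y \<union> {a, b, d}" "f v = f w"
      have isl: "isl (f x) \<longleftrightarrow> x \<in> Y" if x: "x \<in> Y \<union> {a, b, d}" for x
      proof (cases "x \<in> Y")
        case False
        then have "x = a \<or> x = b \<or> x = d" using x by blast
        then show ?thesis using False fv(1-3) by (elim disjE) simp_all
      qed (use fv(4) in simp)
      show "v = w"
      proof (cases "v \<in> Y")
        case True
        then have "w \<in> Y" using isl[OF h(1)] isl[OF h(2)] h(3) by simp
        then show ?thesis using h(3) fv(4)[OF True] fv(4)[of w] by simp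
      next
        case False
        then have "w \<notin> Y" using isl[OF h(1)] isl[OF h(2)] h(3) by simp
        then have "v = a \<or> v = b \<or> v = d" "w = a \<or> w = b \<or> w = d" using h(1,2) False by blast+
        then show ?thesis using h(3) fv(1-3) zn by (elim disjE) simp_all
      qed
    qed
    then have "inj_on f (verts G)" by (simp only: V[symmetric])
    ultimately show ?thesis by (simp add: bij_betw_def)
  qed
  moreover have "bij_betw g (edges G) (edges ?T)"
  proof -
    have "g ` edges G = g ` edges GY \<union> {g m2, g n1, g w}" unfolding E by auto
    also have "g ` edges GY = Inl ` edges GY" using gv(4) by (intro image_cong) auto
    finally have "g ` edges G = edges ?T" unfolding T gv by auto
    moreover have "inj_on g (edges G)" unfolding E using zn e5 gv by (auto simp: inj_on_def)
    ultimately show ?thesis by (simp add: bij_betw_def)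
  qed
  moreover have "ends ?T (g e) = f ` ends G e" if e: "e \<in> edges G" for e
  proof -
    consider "e \<in> C" | "e \<in> edges GY" "e \<notin> C" | "e = m2" | "e = n1" | "e = w" using e E by blast
    then show ?thesis
    proof cases
      case 1
      obtain q where q: "ends GX e = {r, q}" "f q = Inr e" using 1 Ce x(6,9) zw(1) fv by auto
      obtain y where y: "y \<in> Y" "ends G e = {q, y}" "ends GY e = {s, y}" using ecut[OF 1 q(1)] by blast
      have "e \<in> edges GY" using 1 Y.CX by (auto simp: cut_Y)
      moreover have "y \<noteq> s" using y(1) s by blast
      ultimately show ?thesis using gv(4) T(3)[of e] y fv(4)[OF y(1)] q(2) by (simp add: insert_Diff_if insert_commute)
    next
      case 2
      then have ey: "ends G e \<subseteq> Y" using Y.edges_GX[of e] by (simp add: cut_Y)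
      then have "ends GY e = ends G e" using Y.ends_inside by blast
      moreover have "s \<notin> ends G e" using ey s by blast
      moreover have "f ` ends G e = Inl ` ends G e" using fv(4) ey by (intro image_cong) auto
      ultimately show ?thesis using gv(4)[OF 2(1)] T(3)[of e] by simp
    next
      case 3
      have "{m1, n2, z} - {m1} = {n2, z}" using zn by auto
      then show ?thesis unfolding 3 gv T(4) e5 using fv by (simp add: insert_commute)
    next
      case 4
      have "{m1, n2, z} - {n2} = {m1, z}" using zn by auto
      then show ?thesis unfolding 4 gv T(4) e5 using fv by (simp add: insert_commute)
    next
      case 5
      have "{m1, n2, z} - {z} = {m1, n2}" using zn by auto
      then show ?thesis unfolding 5 gv T(4) e5 using fv by (simp add: insert_commute)
    qed
  qed
  ultimately have "iso_via f g G ?T" by (simp add: iso_via_def)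
  then show "graph_iso G ?T" unfolding graph_iso_via by blast
qed

end

subsection \<open>Barriers\<close>

lemma even_closed:
  assumes G: "finite_loopless_graph G" and M: "perfect_matching G M" and K: "K \<subseteq> verts G" "\<And>x. x \<in> K \<Longrightarrow> mate G M x \<in> K"
  shows "even (card K)"
proof -
  have e: "ends G (medge G M x) = {x, mate G M x}" if "x \<in> K" for x using mate(1)[OF G M] K(1) that by blast
  have "matching_in G K (medge G M ` K)" unfolding matching_in_def
  proof (intro conjI ballI impI)
    show "medge G M ` K \<subseteq> edges G" using medge_edges[OF M] K(1) by blast
    show "ends G d \<subseteq> K" if d: "d \<in> medge G M ` K" for d using d e K(2) by auto
    fix d d' assume d: "d \<in> medge G M ` K" "d' \<in> medge G M ` K" "d \<noteq> d'"
    then have "d \<in> M" "d' \<in> M" using medge(1)[OF M] K(1) by auto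
    moreover have "ends G d \<subseteq> K" using d(1) e K(2) by auto
    then have "ends G d \<subseteq> verts G" using K(1) by blast
    ultimately show "ends G d \<inter> ends G d' = {}" using pm_unique[OF M, of _ d d'] d(3) by blast
  qed
  moreover have "covered G (medge G M ` K) = K" using e K(2) by (auto simp: covered_def)
  ultimately show ?thesis using card_covered[OF G, of K "medge G M ` K"] by simp
qed

text \<open>\<open>nopm\<close> forbids a perfect matching of the graph left after deleting
  \<open>s\<close> and its neighbours \<open>U\<close>, so some set \<open>S\<close> there leaves at
  least two more odd parts than it has elements. Adding \<open>U\<close> to \<open>S\<close> and
  \<open>{s}\<close> to the parts restores balance: at least as many odd parts as barrier vertices.
  Every perfect matching then joins each part to the barrier by exactly one edge. Hence all parts
  are shores of tight cuts, and if all are singletons the graph is bipartite.\<close>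

lemma barrier_tight_or_bipartite:
  fixes H :: "('v, 'e) multigraph"
  assumes B: "balanced H" and deg: "degree H = 3" and no: "pms1 H = {}" and s: "s \<in> verts H"
    and nopm: "\<And>A. A \<subseteq> edges H \<Longrightarrow> (\<And>e. e \<in> A \<Longrightarrow> ends H e \<inter> (\<Union>d\<in>incident_edges H s. ends H d) = {}) \<Longrightarrow>
      \<not> (\<forall>v\<in>verts H - (\<Union>d\<in>incident_edges H s. ends H d). \<exists>!e. e \<in> A \<and> v \<in> ends H e)"
  shows "bipartite H \<or> (\<exists>K. K \<subseteq> verts H \<and> odd (card K) \<and> 2 \<le> card K \<and> 2 \<le> card (verts H - K) \<and>
    (\<forall>M. perfect_matching H M \<longrightarrow> card (cut H K \<inter> M) = 1))"
proof -
  have G: "finite_loopless_graph H" using balanced_graph[OF B] .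
  have finV: "finite (verts H)" using G by (simp add: finite_loopless_graph_def)
  define I where "I = incident_edges H s"
  have I3: "card I = 3" "finite I" using card_incident[OF B s] deg finite_incident[OF G] by (auto simp: I_def)
  define U where "U = (\<Union>d\<in>I. ends H d) - {s}"
  have Iu: "\<exists>u. ends H d = {s, u} \<and> u \<noteq> s \<and> u \<in> verts H" if dI: "d \<in> I" for d
  proof -
    have d: "d \<in> edges H" "s \<in> ends H d" using dI by (auto simp: I_def incident_edges_def)
    obtain u where "ends H d = {s, u}" "s \<noteq> u" "u \<in> verts H" using graph_ends_otherE[OF G d] by metis
    then show ?thesis by auto
  qed
  define nb where "nb d = (SOME u. ends H d = {s, u} \<and> u \<noteq> s \<and> u \<in> verts H)" for d
  have nb: "ends H d = {s, nb d} \<and> nb d \<noteq> s \<and> nb d \<in> verts H" if "d \<in> I" for d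
    unfolding nb_def by (rule someI_ex[OF Iu[OF that]])
  have Unb: "U = nb ` I" using nb by (auto simp: U_def)
  \<comment> \<open>Without parallel edges the three neighbours of \<open>s\<close> are distinct,
    which the counting needs.\<close>
  have inj: "inj_on nb I"
  proof (rule inj_onI)
    fix d d' assume d: "d \<in> I" "d' \<in> I" "nb d = nb d'"
    then have "ends H d = ends H d'" using nb by auto
    then show "d = d'" using doubles_simple[OF B deg no, of d d'] d by (auto simp: I_def incident_edges_def)
  qed
  have U3: "card U = 3" unfolding Unb using card_image[OF inj] I3 by simp
  have UV: "U \<subseteq> verts H" "s \<notin> U" using Unb nb by auto
  define W where "W = verts H - insert s U"
  have sU: "(\<Union>d\<in>I. ends H d) = insert s U"
  proof -
    have "I \<noteq> {}" using I3 by auto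
    then show ?thesis using nb by (auto simp: U_def)
  qed
  obtain M0 where M0: "perfect_matching H M0" using B by (auto simp: balanced_def)
  have finU: "finite U" using UV(1) finV finite_subset by blast
  have "card W + 4 = card (verts H)"
  proof -
    have "card (insert s U) = 4" using U3 UV(2) finU by simp
    then show ?thesis unfolding W_def using card_Diff_subset[of "insert s U" "verts H"] card_mono[OF finV, of "insert s U"] UV(1) s finU by auto
  qed
  moreover have finW: "finite W" using finV by (simp add: W_def)
  ultimately have evW: "even (card W)" using card_verts_pm[OF G M0] by presburger
  have noW: "covered H A \<noteq> W" if A: "matching_in H W A" for A
  proof
    assume c: "covered H A = W"
    have "\<exists>!e. e \<in> A \<and> v \<in> ends H e" if v: "v \<in> W" for v
    proof -
      obtain e where e: "e \<in> A" "v \<in> ends H e" using v c by (auto simp: covered_def)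
      moreover have "e' = e" if "e' \<in> A" "v \<in> ends H e'" for e' using A that e unfolding matching_in_def by blast
      ultimately show ?thesis by blast
    qed
    moreover have "A \<subseteq> edges H" "\<And>e. e \<in> A \<Longrightarrow> ends H e \<inter> insert s U = {}" using A by (auto simp: matching_in_def W_def)
    ultimately show False using nopm[of A] unfolding I_def[symmetric] sU W_def by blast
  qed
  obtain S P where SP: "S \<subseteq> W" "\<Union>P = W - S" "disjoint P" "\<And>K. K \<in> P \<Longrightarrow> odd (card K)"
    "\<And>e. e \<in> edges H \<Longrightarrow> ends H e \<subseteq> W - S \<Longrightarrow> \<exists>K\<in>P. ends H e \<subseteq> K" "card S + 2 \<le> card P"
    by (rule odd_partition_if_no_perfect_matching[OF G finW evW]) (rule noW, assumption, (rule that; assumption))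
  define S' where "S' = S \<union> U"
  define P' where "P' = insert {s} P"
  have sP: "s \<notin> \<Union>P" using SP(2) by (auto simp: W_def)
  have UP: "\<Union>P' = verts H - S'"
  proof -
    have "verts H - S' = insert s (W - S)" using s SP(1) UV(2) by (auto simp: S'_def W_def)
    then show ?thesis using SP(2) by (simp add: P'_def)
  qed
  have S'V: "S' \<subseteq> verts H" "finite S'" using SP(1) UV(1) finV finite_subset[of S' "verts H"] by (auto simp: S'_def W_def)
  have cS': "card S' = card S + 3"
  proof -
    have "S \<inter> U = {}" "finite S" using SP(1) finV finite_subset[of S "verts H"] by (auto simp: W_def)
    then show ?thesis unfolding S'_def using card_Un_disjoint[of S U] finU U3 by simp
  qed
  have finP: "finite P"
  proof -
    have "P \<subseteq> Pow (verts H)" using SP(2) by (auto simp: W_def)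
    then show ?thesis using finV finite_subset by blast
  qed
  have "{s} \<notin> P" using sP by blast
  then have cP': "card S' \<le> card P'" "finite P'" using cS' SP(6) finP by (auto simp: P'_def)
  have oddP: "odd (card K)" if "K \<in> P'" for K using that SP(4) by (auto simp: P'_def)
  have dP: "K = K'" if "K \<in> P'" "K' \<in> P'" "x \<in> K" "x \<in> K'" for K K' x
    using that SP(3) sP unfolding P'_def disjoint_def by blast
  have edge: "\<exists>K\<in>P'. ends H e \<subseteq> K" if e: "e \<in> edges H" "ends H e \<inter> S' = {}" for e
  proof (cases "s \<in> ends H e")
    case True
    then have "e \<in> I" using e(1) by (simp add: I_def incident_edges_def)
    then have "nb e \<in> U" "nb e \<in> ends H e" using Unb nb by auto
    then show ?thesis using e(2) by (auto simp: S'_def)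
  next
    case False
    then have "ends H e \<subseteq> W - S" using e G by (auto simp: W_def S'_def finite_loopless_graph_def)
    then show ?thesis using SP(5)[OF e(1)] by (auto simp: P'_def)
  qed
  have main: "(\<forall>x\<in>S'. mate H M x \<notin> S') \<and> (\<forall>K\<in>P'. \<exists>!x. x \<in> K \<and> mate H M x \<in> S')" if M: "perfect_matching H M" for M
  proof -
    have KV: "K \<subseteq> verts H" if "K \<in> P'" for K using that UP by blast
    have stay: "mate H M x \<in> K" if K: "K \<in> P'" "x \<in> K" "mate H M x \<notin> S'" for K x
    proof -
      have xV: "x \<in> verts H" "x \<notin> S'" using K UP by blast+
      have en: "ends H (medge H M x) = {x, mate H M x}" using mate(1)[OF G M xV(1)] .
      then obtain K' where K': "K' \<in> P'" "ends H (medge H M x) \<subseteq> K'"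
        using edge[OF medge_edges[OF M xV(1)]] xV K(3) by auto
      then have "K' = K" using dP[OF K'(1) K(1) _ K(2)] en by blast
      then show ?thesis using K'(2) en by blast
    qed
    have ex: "\<exists>x. x \<in> K \<and> mate H M x \<in> S'" if K: "K \<in> P'" for K
      using even_closed[OF G M KV[OF K]] stay[OF K] oddP[OF K] by blast
    define x where "x K = (SOME x. x \<in> K \<and> mate H M x \<in> S')" for K
    have x: "x K \<in> K" "mate H M (x K) \<in> S'" if "K \<in> P'" for K
      using someI_ex[OF ex[OF that]] by (auto simp: x_def)
    define h where "h K = mate H M (x K)" for K
    have mm: "mate H M (mate H M y) = y" if "y \<in> verts H" for y using medge_mate(2)[OF G M that] .
    have hx: "mate H M (h K) = x K" if "K \<in> P'" for K using mm x(1)[OF that] KV[OF that] by (auto simp: h_def)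
    have injh: "inj_on h P'"
    proof (rule inj_onI)
      fix K K' assume K: "K \<in> P'" "K' \<in> P'" "h K = h K'"
      then have "x K = x K'" using hx[OF K(1)] hx[OF K(2)] by simp
      then show "K = K'" using dP[OF K(1,2), of "x K"] x(1)[OF K(1)] x(1)[OF K(2)] by simp
    qed
    have "h ` P' \<subseteq> S'" using x(2) by (auto simp: h_def)
    \<comment> \<open>The parts inject into the barrier and are at least as many, so each barrier
      vertex is matched into a part. In particular no edge of a perfect matching joins two barrier
      vertices.\<close>
    then have hS: "h ` P' = S'" using card_image[OF injh] cP'(1) S'V(2) card_mono[of S' "h ` P'"] by (intro card_subset_eq) auto
    have 1: "mate H M y \<notin> S'" if yS: "y \<in> S'" for y
    proof -
      obtain K where K: "K \<in> P'" "y = h K" using yS hS by blast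
      then have "mate H M y \<in> K" using hx x(1) by simp
      then show ?thesis using K(1) UP by blast
    qed
    have 2: "\<exists>!y. y \<in> K \<and> mate H M y \<in> S'" if K: "K \<in> P'" for K
    proof (rule ex1I[of _ "x K"])
      show "x K \<in> K \<and> mate H M (x K) \<in> S'" using x[OF K] by simp
      fix y assume y: "y \<in> K \<and> mate H M y \<in> S'"
      then obtain K' where K': "K' \<in> P'" "mate H M y = h K'" using hS by blast
      have yV: "y \<in> verts H" using y KV[OF K] by blast
      have "y = x K'" using mm[OF yV] hx[OF K'(1)] K'(2) by simp
      then have "K' = K" using dP[OF K'(1) K, of y] x(1)[OF K'(1)] y by simp
      then show "y = x K" using \<open>y = x K'\<close> by simp
    qed
    show ?thesis using 1 2 by blast
  qed
  have indep: "\<not> ends H e \<subseteq> S'" if e: "e \<in> edges H" for e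
  proof
    assume sub: "ends H e \<subseteq> S'"
    obtain M where M: "perfect_matching H M" "e \<in> M" using edge_in_pm[OF B e] .
    obtain v w where vw: "ends H e = {v, w}" using graph_endsE[OF G e] by metis
    have "mate H M v = w" using mate_eqI(1)[OF G M vw] .
    moreover have "v \<in> S'" "w \<in> S'" using sub vw by auto
    ultimately show False using conjunct1[OF main[OF M(1)]] by auto
  qed
  have tightK: "card (cut H K \<inter> M) = 1" if K: "K \<in> P'" and M: "perfect_matching H M" for K M
  proof -
    obtain y where y: "y \<in> K" "mate H M y \<in> S'" "\<And>z. z \<in> K \<Longrightarrow> mate H M z \<in> S' \<Longrightarrow> z = y"
    proof -
      have "\<exists>!x. x \<in> K \<and> mate H M x \<in> S'" using conjunct2[OF main[OF M]] K by (rule bspec)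
      then show ?thesis using that by blast
    qed
    have KV: "K \<subseteq> verts H" "K \<inter> S' = {}" using K UP by blast+
    have "cut H K \<inter> M = {medge H M y}"
    proof (intro equalityI subsetI)
      fix e assume e: "e \<in> cut H K \<inter> M"
      then have eE: "e \<in> edges H" "e \<in> M" "card (ends H e \<inter> K) = 1" by (auto simp: cut_def)
      then obtain z where z: "ends H e \<inter> K = {z}" by (metis card_1_singletonE)
      then have "z \<in> ends H e" by blast
      then obtain w where w: "ends H e = {z, w}" "z \<noteq> w" using graph_ends_otherE[OF G eE(1)] by metis
      have wK: "w \<notin> K"
      proof
        assume "w \<in> K"
        then have "w \<in> ends H e \<inter> K" using w(1) by simp
        then show False unfolding z using w(2) by simp
      qed
      have "ends H e \<inter> S' \<noteq> {}"
      proof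
        assume "ends H e \<inter> S' = {}"
        then obtain K' where "K' \<in> P'" "ends H e \<subseteq> K'" using edge[OF eE(1)] by blast
        then show False using dP[of K' K z] K z w wK by auto
      qed
      then have "w \<in> S'" using w z KV(2) by blast
      moreover have "mate H M z = w" "medge H M z = e" using mate_eqI[OF G M eE(2) w(1)] by auto
      ultimately show "e \<in> {medge H M y}" using y(3)[of z] z by auto
    next
      fix e assume "e \<in> {medge H M y}"
      then have e: "e = medge H M y" by simp
      have yV: "y \<in> verts H" using y(1) KV by blast
      have "ends H e = {y, mate H M y}" using mate(1)[OF G M yV] e by simp
      then have "ends H e \<inter> K = {y}" using y(1,2) KV(2) by auto
      then show "e \<in> cut H K \<inter> M" using medge(1)[OF M yV] medge_edges[OF M yV] e by (simp add: cut_def)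
    qed
    then show ?thesis by simp
  qed
  show ?thesis
  proof (cases "\<forall>K\<in>P'. card K = 1")
    case True
    have "\<exists>a\<in>S'. \<exists>b\<in>verts H - S'. ends H e = {a, b}" if e: "e \<in> edges H" for e
    proof -
      obtain v w where vw: "ends H e = {v, w}" "v \<noteq> w" "v \<in> verts H" "w \<in> verts H" using graph_endsE[OF G e] .
      have "ends H e \<inter> S' \<noteq> {}"
      proof
        assume "ends H e \<inter> S' = {}"
        then obtain K where K: "K \<in> P'" "ends H e \<subseteq> K" using edge[OF e] by blast
        then obtain q where "K = {q}" using True by (metis card_1_singletonE)
        then show False using K(2) vw by auto
      qed
      then show ?thesis using indep[OF e] vw by (cases "v \<in> S'") (auto simp: insert_commute)
    qed
    then have "bipartite H" unfolding bipartite_def using S'V(1)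
      by (intro exI[of _ S'] exI[of _ "verts H - S'"]) auto
    then show ?thesis by simp
  next
    case False
    then obtain K where K: "K \<in> P'" "card K \<noteq> 1" by blast
    have "odd (card K)" using oddP[OF K(1)] .
    then have "2 \<le> card K" using K(2) by (cases "card K"; cases "card K - 1") auto
    moreover have KV: "K \<subseteq> verts H" "S' \<subseteq> verts H - K" using K UP S'V(1) by blast+
    moreover have "card S' \<le> card (verts H - K)" using KV(2) finV by (intro card_mono) auto
    \<comment> \<open>The other shore contains the barrier, which has at least the three neighbours
      of \<open>s\<close>.\<close>
    ultimately show ?thesis using tightK[OF K(1)] \<open>odd (card K)\<close> cS' by (intro disjI2 exI[of _ K]) auto
  qed
qed

subsection \<open>The classification\<close>

definition cubic_list :: "nat \<Rightarrow> (nat \<times> nat) list \<Rightarrow> bool" where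
  "cubic_list k L \<longleftrightarrow> (\<forall>(a, b)\<in>set L. a \<noteq> b \<and> a < k \<and> b < k) \<and>
     (\<forall>u\<in>set (map fst L @ map snd L). length (filter (\<lambda>i. u = fst (L ! i) \<or> u = snd (L ! i)) [0..<length L]) = 3)"

lemma cubic_lists: "cubic_list 6 K33_list" "cubic_list 9 T4_list" "cubic_list 15 T5_list" "cubic_list 24 T6_list"
  by code_simp+

lemma loopless_lists:
  "\<forall>(a, b)\<in>set C1_list. a \<noteq> b" "\<forall>(a, b)\<in>set T2_list. a \<noteq> b" "\<forall>(a, b)\<in>set T3_list. a \<noteq> b"
  by code_simp+

text \<open>Up to isomorphism it does not matter which vertex of the complete bipartite graph is
  replaced first, nor which of the two remaining original vertices of its class comes
  second.\<close>

lemma K33_steps: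
  "\<forall>u\<in>set (map fst K33_list @ map snd K33_list). u = 0 \<or> u = 1 \<or> u = 2 \<or> u = 3 \<or> u = 4 \<or> u = 5"
  "iso_list_check [(0, 1), (2, 2), (3, 3), (4, 4), (5, 5), (9, 6), (10, 7), (11, 8)] (tri_list K33_list 6 1) T4_list"
  "iso_list_check [(0, 1), (1, 2), (3, 3), (4, 4), (5, 5), (12, 6), (13, 7), (14, 8)] (tri_list K33_list 6 2) T4_list"
  "iso_list_check [(0, 3), (1, 4), (2, 5), (4, 1), (5, 2), (6, 6), (9, 7), (12, 8)] (tri_list K33_list 6 3) T4_list"
  "iso_list_check [(0, 3), (1, 4), (2, 5), (3, 1), (5, 2), (7, 6), (10, 7), (13, 8)] (tri_list K33_list 6 4) T4_list"
  "iso_list_check [(0, 3), (1, 4), (2, 5), (3, 1), (4, 2), (8, 6), (11, 7), (14, 8)] (tri_list K33_list 6 5) T4_list"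
  "iso_list_check [(1, 2), (3, 3), (4, 4), (5, 5), (6, 6), (7, 7), (8, 8), (15, 12), (16, 13), (17, 14)] (tri_list T4_list 9 2) T5_list"
  by code_simp+

lemma list_vertices:
  "\<forall>u\<in>set (map fst T4_list @ map snd T4_list). u = 1 \<or> u = 2 \<or> u = 3 \<or> u = 4 \<or> u = 5 \<or> u = 6 \<or> u = 7 \<or> u = 8"
  "\<forall>u\<in>set (map fst T5_list @ map snd T5_list). u = 2 \<or> u = 3 \<or> u = 4 \<or> u = 5 \<or> u = 6 \<or> u = 7 \<or> u = 8 \<or> u = 12 \<or> u = 13 \<or> u = 14"
  "\<forall>u\<in>set (map fst T6_list @ map snd T6_list). u = 3 \<or> u = 4 \<or> u = 5 \<or> u = 6 \<or> u = 7 \<or> u = 8 \<or> u = 12 \<or> u = 13 \<or> u = 14 \<or> u = 21 \<or> u = 22 \<or> u = 23"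
  by code_simp+

text \<open>Replacing any other vertex leaves the class, since the cut around the new triangle is not tight.\<close>

lemma unbalanced_T4_a:
  "\<not> balanced_list (tri_list T4_list 9 3)"
  "\<not> balanced_list (tri_list T4_list 9 4)"
  "\<not> balanced_list (tri_list T4_list 9 5)"
  by code_simp+

lemma unbalanced_T4_b:
  "\<not> balanced_list (tri_list T4_list 9 6)"
  "\<not> balanced_list (tri_list T4_list 9 7)"
  "\<not> balanced_list (tri_list T4_list 9 8)"
  by code_simp+

lemmas unbalanced_T4 = unbalanced_T4_a unbalanced_T4_b

lemma unbalanced_T5_a:
  "\<not> balanced_list (tri_list T5_list 15 3)"
  "\<not> balanced_list (tri_list T5_list 15 4)"
  "\<not> balanced_list (tri_list T5_list 15 5)"
  by code_simp+

lemma unbalanced_T5_b: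
  "\<not> balanced_list (tri_list T5_list 15 6)"
  "\<not> balanced_list (tri_list T5_list 15 7)"
  "\<not> balanced_list (tri_list T5_list 15 8)"
  by code_simp+

lemma unbalanced_T5_c:
  "\<not> balanced_list (tri_list T5_list 15 12)"
  "\<not> balanced_list (tri_list T5_list 15 13)"
  "\<not> balanced_list (tri_list T5_list 15 14)"
  by code_simp+

lemmas unbalanced_T5 = unbalanced_T5_a unbalanced_T5_b unbalanced_T5_c

lemma unbalanced_T6_a:
  "\<not> balanced_list (tri_list T6_list 24 3)"
  "\<not> balanced_list (tri_list T6_list 24 4)"
  "\<not> balanced_list (tri_list T6_list 24 5)"
  by code_simp+

lemma unbalanced_T6_b:
  "\<not> balanced_list (tri_list T6_list 24 6)"
  "\<not> balanced_list (tri_list T6_list 24 7)"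
  "\<not> balanced_list (tri_list T6_list 24 8)"
  by code_simp+

lemma unbalanced_T6_c:
  "\<not> balanced_list (tri_list T6_list 24 12)"
  "\<not> balanced_list (tri_list T6_list 24 13)"
  "\<not> balanced_list (tri_list T6_list 24 14)"
  by code_simp+

lemma unbalanced_T6_d:
  "\<not> balanced_list (tri_list T6_list 24 21)"
  "\<not> balanced_list (tri_list T6_list 24 22)"
  "\<not> balanced_list (tri_list T6_list 24 23)"
  by code_simp+

lemmas unbalanced_T6 = unbalanced_T6_a unbalanced_T6_b unbalanced_T6_c unbalanced_T6_d

lemma tri_list_loopless:
  assumes L: "\<forall>(a, b)\<in>set L. a \<noteq> b \<and> a < k \<and> b < k"
    and I: "length (filter (\<lambda>i. u = fst (L ! i) \<or> u = snd (L ! i)) [0..<length L]) = 3"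
  shows "\<forall>(a, b)\<in>set (tri_list L k u). a \<noteq> b"
proof -
  define J where "J = filter (\<lambda>i. u = fst (L ! i) \<or> u = snd (L ! i)) [0..<length L]"
  have "distinct J" "length J = 3" using I by (auto simp: J_def)
  then have "J ! 0 \<noteq> J ! 1" "J ! 0 \<noteq> J ! 2" "J ! 1 \<noteq> J ! 2" by (simp_all add: nth_eq_iff_index_eq)
  moreover have L': "fst (L ! i) \<noteq> snd (L ! i) \<and> fst (L ! i) < k \<and> snd (L ! i) < k" if "i < length L" for i
    using bspec[OF L nth_mem[OF that]] by (simp add: case_prod_beta)
  have "(if fst (L ! i) = u then k + i else fst (L ! i)) \<noteq> (if snd (L ! i) = u then k + i else snd (L ! i))"
    if "i < length L" for i using L'[OF that] by auto
  ultimately show ?thesis unfolding tri_list_def J_def[symmetric] Let_def by auto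
qed

text \<open>Transfers an abstract replacement at \<open>s\<close> to the list of the smaller graph.
  Since \<open>G\<close> is balanced, so is the resulting list, and this is what excludes most
  vertices \<open>u\<close>.\<close>

lemma triangle_step:
  assumes G: "balanced G" and iso: "graph_iso G (triangle_replacement H s)" and wf: "wf_graph H" and s: "s \<in> verts H"
    and H: "graph_iso H (graph_of_list L)" and ok: "cubic_list k L"
  obtains u where "u \<in> set (map fst L @ map snd L)" "graph_iso G (graph_of_list (tri_list L k u))"
    "balanced_list (tri_list L k u)"
proof -
  obtain f g where fg: "iso_via f g H (graph_of_list L)" using H graph_iso_via by blast
  have "f s \<in> verts (graph_of_list L)" using fg s by (auto simp: iso_via_def bij_betw_def)
  then have u: "f s \<in> set (map fst L @ map snd L)" by (simp add: list_graph_simps)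
  have L: "\<forall>(a, b)\<in>set L. a \<noteq> b \<and> a < k \<and> b < k"
    and I': "length (filter (\<lambda>i. f s = fst (L ! i) \<or> f s = snd (L ! i)) [0..<length L]) = 3"
    using ok u unfolding cubic_list_def by blast+
  have "graph_iso (triangle_replacement H s) (graph_of_list (tri_list L k (f s)))"
    using tri_iso_list[OF fg wf s L I'] graph_iso_via by blast
  then have iso': "graph_iso G (graph_of_list (tri_list L k (f s)))" using graph_iso_trans[OF iso] by blast
  have ll: "\<forall>(a, b)\<in>set (tri_list L k (f s)). a \<noteq> b" using tri_list_loopless[OF L I'] .
  have "graph_iso (graph_of_list (tri_list L k (f s))) G"
    using graph_iso_sym[OF iso' wf_graph_finite[OF balanced_graph[OF G]]] .
  then have "balanced (graph_of_list (tri_list L k (f s)))"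
    using graph_iso_balanced[OF _ finite_graph_of_list[OF ll] G] by blast
  then have "balanced_list (tri_list L k (f s))" using balanced_list[OF ll] by simp
  then show ?thesis using that[OF u iso'] by blast
qed

text \<open>Shrinking the triangle at a shore removes two vertices and leaves a cubic graph of the
  same kind, which is bipartite or has again a suitable tight cut. The induction then adds triangles
  to the listed graphs one at a time.\<close>

lemma no_single_pms_classification:
  fixes G :: "('v, 'e) multigraph"
  shows "balanced G \<Longrightarrow> degree G = 3 \<Longrightarrow> pms1 G = {} \<Longrightarrow> X \<subseteq> verts G \<Longrightarrow> 2 \<le> card X \<Longrightarrow> 2 \<le> card (verts G - X) \<Longrightarrow>
    (\<And>M. perfect_matching G M \<Longrightarrow> card (cut G X \<inter> M) = 1) \<Longrightarrow>
    graph_iso G (graph_of_list T4_list) \<or> graph_iso G (graph_of_list T5_list) \<or> graph_iso G (graph_of_list T6_list)"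
proof (induction "card (verts G)" arbitrary: G X rule: less_induct)
  case (less G X)
  note B = less.prems(1) and deg = less.prems(2) and no = less.prems(3)
  have G: "finite_loopless_graph G" using balanced_graph[OF B] .
  \<comment> \<open>Stated for an arbitrary choice of shore, because it is not known beforehand
    which contraction has two perfect matchings of single edges.\<close>
  have step: ?case if TS: "tight_shores G X r s" and two: "2 \<le> card (pms1 (contract G X r))"
    and X2: "2 \<le> card X" and Y2: "2 \<le> card (verts G - X)" for X r s
  proof -
    interpret tight_shores G X r s by (rule TS)
    interpret Y: tight_shores G Y s r by (rule sym)
    note tri = degree_three_triangle[OF deg two X2]
    have BH: "balanced GY" and dH: "degree GY = 3" using balanced_GY degree_GY deg by auto
    have nH: "pms1 GY = {}" using pcount_GY_double[OF no tri(2)] .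
    have sH: "s \<in> verts GY" by (simp add: Y.contract_simps(1))
    have finV: "finite (verts G)" using G by (simp add: finite_loopless_graph_def)
    have less_card: "card (verts GY) < card (verts G)"
    proof -
      have "card X \<le> card (verts G)" using XV finV by (intro card_mono)
      moreover have "card Y = card (verts G) - card X" using XV finV finite_subset by (intro card_Diff_subset) auto
      ultimately show ?thesis using Y.card_verts_GX tri(3) by simp
    qed
    have inc: "incident_edges GY s = C" using Y.incident_r by (simp add: cut_Y)
    \<comment> \<open>A set \<open>A\<close> as excluded here could be completed by the three cut
      edges: they cover each corner of the triangle once and the three distinct neighbours of
      \<open>s\<close> once. The perfect matching so obtained would use three edges of the tight
      cut.\<close>
    have nopm: "\<not> (\<forall>v\<in>verts GY - (\<Union>d\<in>incident_edges GY s. ends GY d). \<exists>!e. e \<in> A \<and> v \<in> ends GY e)"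
      if A: "A \<subseteq> edges GY" "\<And>e. e \<in> A \<Longrightarrow> ends GY e \<inter> (\<Union>d\<in>incident_edges GY s. ends GY d) = {}" for A
    proof
      assume cov: "\<forall>v\<in>verts GY - (\<Union>d\<in>incident_edges GY s. ends GY d). \<exists>!e. e \<in> A \<and> v \<in> ends GY e"
      have Cne: "C \<noteq> {}" using card_C deg by auto
      have endC: "s \<in> ends GY d" if "d \<in> C" for d using that inc by (auto simp: incident_edges_def)
      have AC: "e \<notin> C \<and> ends G e \<subseteq> Y" if "e \<in> A" for e
      proof -
        obtain d where d: "d \<in> C" using Cne by blast
        then have "s \<notin> ends GY e" using A(2)[OF that] endC[OF d] inc by blast
        then have "e \<notin> C" using endC by blast
        then show ?thesis using A(1) that Y.edges_GX[of e] by (auto simp: cut_Y)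
      qed
      have ex: "\<exists>!e. e \<in> A \<union> C \<and> v \<in> ends G e" if v: "v \<in> verts G" for v
      proof (cases "v \<in> X")
        case True
        then have "v \<notin> ends G e" if "e \<in> A" for e using AC[OF that] by blast
        then show ?thesis using tri(4)[OF True] by blast
      next
        case False
        then have vY: "v \<in> Y" using v by blast
        have vE: "v \<in> ends GY e \<longleftrightarrow> v \<in> ends G e" for e using Y.x_in_ends[OF vY] .
        show ?thesis
        proof (cases "v \<in> (\<Union>d\<in>C. ends GY d)")
          case True
          then obtain d where d: "d \<in> C" "v \<in> ends GY d" by blast
          have nA: "e \<notin> A" if "v \<in> ends GY e" for e using A(2)[of e] that True inc by blast
          have ed: "e = d" if e: "e \<in> C" "v \<in> ends GY e" for e
          proof -
            have "v \<noteq> s" using vY s by blast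
            have eq: "ends GY x = {s, v}" if x: "x \<in> C" "v \<in> ends GY x" for x
            proof -
              have "x \<in> edges GY" using x(1) inc by (auto simp: incident_edges_def)
              then obtain w where "ends GY x = {s, w}" using graph_ends_otherE[OF Y.finite_GX _ endC[OF x(1)]] by metis
              then show ?thesis using x(2) \<open>v \<noteq> s\<close> by auto
            qed
            have "e \<in> edges GY" "d \<in> edges GY" using e(1) d(1) inc by (auto simp: incident_edges_def)
            then show ?thesis using doubles_simple[OF BH dH nH] eq[OF e] eq[OF d] by metis
          qed
          show ?thesis
          proof (rule ex1I[of _ d])
            show "d \<in> A \<union> C \<and> v \<in> ends G d" using d vE by simp
            show "e = d" if "e \<in> A \<union> C \<and> v \<in> ends G e" for e using ed[of e] nA[of e] vE[of e] that by blast
          qed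
        next
          case f: False
          then have "v \<in> verts GY - (\<Union>d\<in>incident_edges GY s. ends GY d)" using vY inc by (simp add: Y.contract_simps(1))
          from bspec[OF cov this] have "\<exists>!e. e \<in> A \<and> v \<in> ends GY e" .
          moreover have "e \<in> A \<union> C \<and> v \<in> ends G e \<longleftrightarrow> e \<in> A \<and> v \<in> ends GY e" for e using f vE[of e] by blast
          ultimately show ?thesis by simp
        qed
      qed
      have "A \<union> C \<subseteq> edges G" using A(1) Y.edges_GX by (auto simp: cut_def)
      then have "perfect_matching G (A \<union> C)" using ex by (simp add: perfect_matching_def)
      from tight[OF this] have "card (C \<inter> (A \<union> C)) = 1" .
      moreover have "C \<inter> (A \<union> C) = C" by blast
      ultimately show False using card_C deg by simp
    qed
    have wfH: "wf_graph GY" using wf_graph_finite[OF balanced_graph[OF BH]] .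
    consider "bipartite GY" | K where "K \<subseteq> verts GY" "2 \<le> card K" "2 \<le> card (verts GY - K)"
      "\<forall>M. perfect_matching GY M \<longrightarrow> card (cut GY K \<inter> M) = 1"
      using barrier_tight_or_bipartite[OF BH dH nH sH nopm] by blast
    then show ?thesis
    proof cases
      case 1
      obtain u where u: "u \<in> set (map fst K33_list @ map snd K33_list)" "graph_iso G (graph_of_list (tri_list K33_list 6 u))"
        by (rule triangle_step[OF B tri(1) wfH sH bipartite_cubic_K33[OF BH dH nH 1] cubic_lists(1)])
      note u01 = bspec[OF K33_steps(1) u(1)]
      have "graph_iso G (graph_of_list T4_list)"
        using u01
      proof (elim disjE)
        assume "u = 0" then show ?thesis using u(2) by (simp add: T4_list_def)
      next
        assume h: "u = 1" show ?thesis using graph_iso_trans[OF u(2)[unfolded h] iso_list_check[OF K33_steps(2)]] .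
      next
        assume h: "u = 2" show ?thesis using graph_iso_trans[OF u(2)[unfolded h] iso_list_check[OF K33_steps(3)]] .
      next
        assume h: "u = 3" show ?thesis using graph_iso_trans[OF u(2)[unfolded h] iso_list_check[OF K33_steps(4)]] .
      next
        assume h: "u = 4" show ?thesis using graph_iso_trans[OF u(2)[unfolded h] iso_list_check[OF K33_steps(5)]] .
      next
        assume h: "u = 5" show ?thesis using graph_iso_trans[OF u(2)[unfolded h] iso_list_check[OF K33_steps(6)]] .
      qed
      then show ?thesis by blast
    next
      case (2 K)
      have "graph_iso GY (graph_of_list T4_list) \<or> graph_iso GY (graph_of_list T5_list) \<or> graph_iso GY (graph_of_list T6_list)"
        by (rule less.hyps[OF less_card BH dH nH 2(1-3)]) (use 2(4) in blast)
      then show ?thesis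
      proof (elim disjE)
        assume h: "graph_iso GY (graph_of_list T4_list)"
        obtain u where u: "u \<in> set (map fst T4_list @ map snd T4_list)" "graph_iso G (graph_of_list (tri_list T4_list 9 u))"
            "balanced_list (tri_list T4_list 9 u)"
          by (rule triangle_step[OF B tri(1) wfH sH h cubic_lists(2)])
        have "u = 1 \<or> u = 2" using bspec[OF list_vertices(1) u(1)] u(3) by (elim disjE) (simp_all add: unbalanced_T4)
        then have "graph_iso G (graph_of_list T5_list)"
        proof
          assume "u = 1" then show ?thesis using u(2) by (simp add: T5_list_def)
        next
          assume h: "u = 2" show ?thesis using graph_iso_trans[OF u(2)[unfolded h] iso_list_check[OF K33_steps(7)]] .
        qed
        then show ?thesis by blast
      next
        assume h: "graph_iso GY (graph_of_list T5_list)"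
        obtain u where u: "u \<in> set (map fst T5_list @ map snd T5_list)" "graph_iso G (graph_of_list (tri_list T5_list 15 u))"
            "balanced_list (tri_list T5_list 15 u)"
          by (rule triangle_step[OF B tri(1) wfH sH h cubic_lists(3)])
        have "u = 2" using bspec[OF list_vertices(2) u(1)] u(3) by (elim disjE) (simp_all add: unbalanced_T5)
        then have "graph_iso G (graph_of_list T6_list)" using u(2) by (simp add: T6_list_def)
        then show ?thesis by blast
      next
        assume h: "graph_iso GY (graph_of_list T6_list)"
        obtain u where u: "u \<in> set (map fst T6_list @ map snd T6_list)" "graph_iso G (graph_of_list (tri_list T6_list 24 u))"
            "balanced_list (tri_list T6_list 24 u)"
          by (rule triangle_step[OF B tri(1) wfH sH h cubic_lists(4)])
        \<comment> \<open>No vertex of \<open>T6_list\<close> admits a further replacement, so this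
          case is contradictory.\<close>
        then show ?thesis using bspec[OF list_vertices(3) u(1)] u(3) by (elim disjE) (simp_all add: unbalanced_T6)
      qed
    qed
  qed
  have "verts G - X \<noteq> {}" "X \<noteq> {}"
    using less.prems(5,6) card.empty not_numeral_le_zero by metis+
  then obtain r s where rs: "r \<in> verts G - X" "s \<in> X" by blast
  have TS: "tight_shores G X r s" by unfold_locales (use less.prems rs in auto)
  then interpret tight_shores G X r s .
  have "2 \<le> card (pms1 GX) \<or> 2 \<le> card (pms1 GY)" using degree_le deg by linarith
  then show ?case
  proof
    assume "2 \<le> card (pms1 GX)"
    then show ?thesis using step[OF TS] less.prems(5,6) by blast
  next
    assume "2 \<le> card (pms1 GY)"
    then show ?thesis using step[OF sym] less.prems(5,6) YY by simp
  qed
qed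

text \<open>The edges outside a perfect matching are absent in degree 1 and form a second perfect
  matching in degree 2; two perfect matchings covering all edges make the graph bipartite.\<close>

lemma bipartite_if_degree_le_2:
  assumes B: "balanced G" and deg: "degree G \<le> 2"
  shows "bipartite G"
proof -
  have G: "finite_loopless_graph G" using balanced_graph[OF B] .
  obtain M where M: "perfect_matching G M" using B by (auto simp: balanced_def)
  have c: "card (incident_edges G v - {medge G M v}) = degree G - 1" if v: "v \<in> verts G" for v
    using card_incident[OF B v] medge_incident[OF M v] finite_incident[OF G] by simp
  have eq: "incident_edges G v - {medge G M v} = {e \<in> edges G - M. v \<in> ends G e}" if v: "v \<in> verts G" for v
    using medge(1)[OF M v] medge_eqI[OF M v] by (auto simp: incident_edges_def)
  consider "degree G \<le> 1" | "degree G = 2" using deg by linarith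
  then show ?thesis
  proof cases
    case 1
    have "e \<in> M" if e: "e \<in> edges G" for e
    proof (rule ccontr)
      assume "e \<notin> M"
      obtain v where v: "v \<in> verts G" "v \<in> ends G e" using graph_endsE[OF G e] by blast
      then have "{e \<in> edges G - M. v \<in> ends G e} \<noteq> {}" using e \<open>e \<notin> M\<close> by blast
      moreover have "card {e \<in> edges G - M. v \<in> ends G e} = 0" using c[OF v(1)] eq[OF v(1)] 1 by simp
      moreover have "finite {e \<in> edges G - M. v \<in> ends G e}" using G by (simp add: finite_loopless_graph_def)
      ultimately show False by (metis card_0_eq)
    qed
    then show ?thesis using bipartite_if_two_pms[OF G M M] by blast
  next
    case 2
    have ex: "\<exists>!e. e \<in> edges G - M \<and> v \<in> ends G e" if v: "v \<in> verts G" for v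
    proof -
      have "card {e \<in> edges G - M. v \<in> ends G e} = 1" using c[OF v] eq[OF v] 2 by simp
      then obtain e where e: "{e \<in> edges G - M. v \<in> ends G e} = {e}" by (rule card_1_singletonE)
      have "d \<in> edges G - M \<and> v \<in> ends G d \<longleftrightarrow> d = e" for d
        using arg_cong[OF e, of "\<lambda>S. d \<in> S"] by simp
      then show ?thesis by simp
    qed
    have "perfect_matching G (edges G - M)" unfolding perfect_matching_def using ex by blast
    then show ?thesis using bipartite_if_two_pms[OF G M, of "edges G - M"] by blast
  qed
qed

lemma balanced_if_iso_list:
  assumes "finite_loopless_graph G" "graph_iso G (graph_of_list L)" "balanced_list L" "\<forall>(a, b)\<in>set L. a \<noteq> b"
  shows "balanced G"
  using graph_iso_balanced[OF assms(2,1)] balanced_list[OF assms(4)] assms(3) by blast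

theorem theorem1p11:
  fixes G :: "('v, 'e) multigraph"
  assumes "finite_loopless_graph G"
    and "matching_covered G"
    and "\<not> bipartite G"
    and "\<exists>X. tight_cut G X \<and> \<not> trivial_cut G X"
  shows "G \<in> class_B \<longleftrightarrow>
    graph_iso G C_triangle_1 \<or> graph_iso G T2 \<or> graph_iso G T3 \<or>
    graph_iso G T4 \<or> graph_iso G T5 \<or> graph_iso G T6"
proof
  assume "G \<in> class_B"
  then have B: "balanced G" by (rule class_B_balanced)
  obtain X where X: "X \<subseteq> verts G" "odd (card X)" "\<And>M. perfect_matching G M \<Longrightarrow> card (cut G X \<inter> M) = 1"
    "card X \<noteq> 1" "card (verts G - X) \<noteq> 1"
    using assms(4) by (auto simp: tight_cut_def trivial_cut_def)
  obtain M where M: "perfect_matching G M" using B by (auto simp: balanced_def)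
  have finV: "finite (verts G)" using assms(1) by (simp add: finite_loopless_graph_def)
  have cV: "card (verts G) = card X + card (verts G - X)"
    using card_Diff_subset[of X "verts G"] card_mono[OF finV X(1)] X(1) finV finite_subset[OF X(1)] by simp
  moreover have "even (card (verts G))" using card_verts_pm[OF assms(1) M] by simp
  ultimately have "odd (card (verts G - X))" using X(2) by simp
  \<comment> \<open>Both shores are odd and neither is a single vertex.\<close>
  then have c3: "3 \<le> card X" "3 \<le> card (verts G - X)" using X(2,4,5) by presburger+
  then have n6: "6 \<le> card (verts G)" using cV by simp
  have "verts G - X \<noteq> {}" "X \<noteq> {}" using c3 card.empty not_numeral_le_zero by metis+
  then obtain r s where rs: "r \<in> verts G - X" "s \<in> X" by blast
  interpret tight_shores G X r s by unfold_locales (use B X rs in auto)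
  have "3 \<le> degree G" using bipartite_if_degree_le_2[OF B] assms(3) by linarith
  have two: "degree H = 3 \<or> degree H = 4"
    if H: "balanced H" "2 \<le> card (pms1 H)" "3 \<le> degree H" "2 < card (verts H)" for H :: "('v, 'e) multigraph"
  proof -
    obtain v where v: "v \<in> verts H" using H(1) by (auto simp: balanced_def)
    have "degree H - 2 = 1 \<or> degree H - 2 = 2"
      by (rule K4_structure[OF H v]) metis
    then show ?thesis using H(3) by linarith
  qed
  have cX: "2 < card (verts GX)" "2 < card (verts GY)"
    using card_verts_GX tight_shores.card_verts_GX[OF sym] c3 by simp_all
  have "2 \<le> card (pms1 GX) \<or> 2 \<le> card (pms1 GY)" using degree_le \<open>3 \<le> degree G\<close> by linarith
  \<comment> \<open>One contraction has at least two perfect matchings of single edges, so its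
    degree is 3 or 4, and contraction preserves the degree.\<close>
  then have deg: "degree G = 3 \<or> degree G = 4"
    using two[OF balanced_GX] two[OF balanced_GY] degree_GX degree_GY cX \<open>3 \<le> degree G\<close> by metis
  have lists: "graph_iso G (graph_of_list C1_list) \<or> graph_iso G (graph_of_list T2_list) \<or> graph_iso G (graph_of_list T3_list) \<or>
    graph_iso G (graph_of_list T4_list) \<or> graph_iso G (graph_of_list T5_list) \<or> graph_iso G (graph_of_list T6_list)"
    using deg
  proof
    assume d4: "degree G = 4"
    show ?thesis using degree_four_T3[OF d4] c3 by simp
  next
    assume d3: "degree G = 3"
    consider "2 \<le> card (pms1 G)" | "card (pms1 G) = 1" | "card (pms1 G) = 0" by linarith
    then show ?thesis
    proof cases
      case 1
      obtain v where v: "v \<in> verts G" using B by (auto simp: balanced_def)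
      \<comment> \<open>Two perfect matchings of single edges in \<open>G\<close> itself would leave
        only four vertices, fewer than two shores of size 3 require.\<close>
      have "card (verts G) \<le> 4"
        by (rule K4_structure[OF B 1 \<open>3 \<le> degree G\<close> _ v]) (use n6 in simp, simp add: card_insert_if)
      then show ?thesis using n6 by simp
    next
      case 2
      show ?thesis using cubic_one_single_pm[OF B d3 2 n6] by blast
    next
      case 3
      then have "pms1 G = {}" using finite_pms12(1)[OF assms(1)] by simp
      moreover have "2 \<le> card X" "2 \<le> card (verts G - X)" using c3 by simp_all
      ultimately show ?thesis using no_single_pms_classification[OF B d3 _ X(1) _ _ X(3)] by blast
    qed
  qed
  have to_graph: "graph_iso G K" if "graph_iso G (graph_of_list L)" "graph_iso K (graph_of_list L)" "wf_graph K" for K L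
    using graph_iso_trans[OF that(1) graph_iso_sym[OF that(2,3)]] .
  have wf2: "wf_graph T2" unfolding T2_def C_triangle_1_eq by (intro wf_triangle_replacement wf_graph_of_list)
  have wf6: "wf_graph T6" unfolding T6_def by (intro wf_triangle_replacement T5_wf)
  show "graph_iso G C_triangle_1 \<or> graph_iso G T2 \<or> graph_iso G T3 \<or>
    graph_iso G T4 \<or> graph_iso G T5 \<or> graph_iso G T6"
    using lists to_graph[OF _ T2_iso wf2] to_graph[OF _ T4_iso T4_wf] to_graph[OF _ T5_iso T5_wf] to_graph[OF _ T6_iso wf6]
    unfolding C_triangle_1_eq T3_eq by blast
next
  \<comment> \<open>For the converse balancedness is evaluated on the six lists and carried over to
    \<open>G\<close>; connectedness comes from \<open>matching_covered\<close>.\<close>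
  assume iso: "graph_iso G C_triangle_1 \<or> graph_iso G T2 \<or> graph_iso G T3 \<or>
    graph_iso G T4 \<or> graph_iso G T5 \<or> graph_iso G T6"
  have ll: "\<forall>(a, b)\<in>set T4_list. a \<noteq> b" "\<forall>(a, b)\<in>set T5_list. a \<noteq> b" "\<forall>(a, b)\<in>set T6_list. a \<noteq> b"
    using cubic_lists(2-4) unfolding cubic_list_def by blast+
  note bl = balanced_if_iso_list[OF assms(1)]
  have "balanced G"
    using iso
  proof (elim disjE)
    assume "graph_iso G C_triangle_1"
    then show ?thesis unfolding C_triangle_1_eq using bl balanced_lists(1) loopless_lists(1) by blast
  next
    assume "graph_iso G T2"
    from bl[OF graph_iso_trans[OF this T2_iso] balanced_lists(2) loopless_lists(2)] show ?thesis .
  next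
    assume "graph_iso G T3"
    then show ?thesis unfolding T3_eq using bl balanced_lists(3) loopless_lists(3) by blast
  next
    assume "graph_iso G T4"
    from bl[OF graph_iso_trans[OF this T4_iso] balanced_lists(4) ll(1)] show ?thesis .
  next
    assume "graph_iso G T5"
    from bl[OF graph_iso_trans[OF this T5_iso] balanced_lists(5) ll(2)] show ?thesis .
  next
    assume "graph_iso G T6"
    from bl[OF graph_iso_trans[OF this T6_iso] balanced_lists(6) ll(3)] show ?thesis .
  qed
  then show "G \<in> class_B"
    by (rule balanced_class_B) (use assms(2) in \<open>simp add: matching_covered_def\<close>)
qed

end
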